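(* Suppose the measured outputs satisfy $\theta_0,\theta_\ell\in H^1(0,T)$. Then the Fréchet gradient $J'(F)=\varphi(\cdot,\cdot;F)$ of the Tikhonov functional $$J(F)=\frac12\int_0^T[u_x(0,t;F)-\theta_0(t)]^2dt+\frac12\int_0^T[u_x(\ell,t;F)-\theta_\ell(t)]^2dt,\qquad F\in\mathcal F,$$ where $u(\cdot,\cdot;F)$ and $\varphi(\cdot,\cdot;F)$ are the weak solutions of the forward and adjoint problems (stated in the context), is Lipschitz continuous: for all $F,F+\delta F\in\mathcal F$, $$\Vert J'(F+\delta F)-J'(F)\Vert_{L^2(\Omega_T)}\le L_G\Vert\delta F\Vert_{L^2(\Omega_T)},\qquad L_G=\sqrt{\frac{\exp(T)-1}{2\kappa_0}}\;\ell^2\,C_0\,C_1,$$ where $C_0,C_1>0$, $C_1^2=\frac{5\ell\rho_0}{3}\left(\exp(T/\rho_0)-1\right)$, $C_0^2=\frac{20\ell C_T}{3r_0^2}$ and $C_T=\max(2/T,\,1+2T/3)$.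
   Context: Let $\ell,T>0$ and $\Omega_T=(0,\ell)\times(0,T)$. The coefficients satisfy $\rho_A,\mu,T_r,r,\kappa\in L^\infty(0,\ell)$ and there are constants with, for $x\in(0,\ell)$, $0<\rho_0\le\rho_A(x)\le\rho_1$, $0\le T_{r0}\le T_r(x)\le T_{r1}$, $0<r_0\le r(x)\le r_1$, $0\le\mu_0\le\mu(x)\le\mu_1$, $0<\kappa_0\le\kappa(x)\le\kappa_1$. Let $\mathcal V^2(0,\ell)=\{v\in H^2(0,\ell): v(0)=v(\ell)=0\}$. The set of admissible loads is $\mathcal F=\{F\in L^2(\Omega_T):\Vert F\Vert^2_{L^2(\Omega_T)}\le C_F\}$, with $C_F>0$ a fixed constant. Forward problem with load $F$: $\rho_A(x)u_{tt}+\mu(x)u_t-(T_r(x)u_x)_x+(r(x)u_{xx}+\kappa(x)u_{xxt})_{xx}=F(x,t)$ in $\Omega_T$; $u(x,0)=u_t(x,0)=0$ for $x\in(0,\ell)$; $u(0,t)=u(\ell,t)=0$ and $(r u_{xx}+\kappa u_{xxt})|_{x=0}=(r u_{xx}+\kappa u_{xxt})|_{x=\ell}=0$ for $t\in[0,T]$. Adjoint problem: $\rho_A(x)\varphi_{tt}-\mu(x)\varphi_t-(T_r(x)\varphi_x)_x+(r(x)\varphi_{xx}-\kappa(x)\varphi_{xxt})_{xx}=0$ in $\Omega_T$; $\varphi(x,T)=\varphi_t(x,T)=0$; $\varphi(0,t)=\varphi(\ell,t)=0$; $-(r\varphi_{xx}-\kappa\varphi_{xxt})|_{x=0}=p(t)$,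 $(r\varphi_{xx}-\kappa\varphi_{xxt})|_{x=\ell}=q(t)$, with $p(t)=u_x(0,t;F)-\theta_0(t)$, $q(t)=u_x(\ell,t;F)-\theta_\ell(t)$. Weak solutions $w$ ($w=u$ or $\varphi$) lie in $L^2(0,T;\mathcal V^2(0,\ell))$ with $w_t\in L^2(0,T;L^2(0,\ell))$, $w_{tt}\in L^2(0,T;H^{-2}(0,\ell))$, in the usual variational sense. For $u$: $u(\cdot,0)=0$ and for all $v\in H^1(0,T;\mathcal V^2(0,\ell))$ with $v(\cdot,T)=0$, $\int_0^T\int_0^\ell[-\rho_A u_tv_t+\mu u_tv+T_ru_xv_x+ru_{xx}v_{xx}-\kappa u_{xx}v_{xxt}]\,dx\,dt=\int_0^T\int_0^\ell Fv\,dx\,dt$. For $\varphi$: $\varphi(\cdot,T)=0$ and for all $v\in H^1(0,T;\mathcal V^2(0,\ell))$ with $v(\cdot,0)=0$, $\int_0^T\int_0^\ell[-\rho_A\varphi_tv_t-\mu\varphi_tv+T_r\varphi_xv_x+r\varphi_{xx}v_{xx}+\kappa\varphi_{xx}v_{xxt}]\,dx\,dt=\int_0^T[p(t)v_x(0,t)+q(t)v_x(\ell,t)]\,dt$. *)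

theory Defs
  imports "HOL-Analysis.Analysis"
begin

text \<open>
  Elements of function spaces are represented by real-valued functions; only their values on the
  underlying set matter, and they matter only up to null sets, except where point values are taken.
\<close>

definition L2 :: "'a::euclidean_space set \<Rightarrow> ('a \<Rightarrow> real) set" where
  "L2 S = {f \<in> borel_measurable (lebesgue_on S). integrable (lebesgue_on S) (\<lambda>z. (f z)\<^sup>2)}"

definition norm_L2 :: "'a::euclidean_space set \<Rightarrow> ('a \<Rightarrow> real) \<Rightarrow> real" where
  "norm_L2 S f = sqrt (\<integral>z. (f z)\<^sup>2 \<partial>lebesgue_on S)"

text \<open>An element of \<open>L\<^sup>\<infinity>(0,l)\<close> with essential bounds \<open>lo\<close> and \<open>hi\<close>.\<close>

definition coefficient :: "real \<Rightarrow> real \<Rightarrow> real \<Rightarrow> (real \<Rightarrow> real) \<Rightarrow> bool" where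
  "coefficient l lo hi a \<longleftrightarrow>
     a \<in> borel_measurable (lebesgue_on {0<..<l}) \<and>
     (AE x in lebesgue_on {0<..<l}. lo \<le> a x \<and> a x \<le> hi)"

definition test_function :: "real \<Rightarrow> real \<Rightarrow> (real \<Rightarrow> real) \<Rightarrow> bool" where
  "test_function a b \<eta> \<longleftrightarrow>
     (\<forall>n. (deriv ^^ n) \<eta> differentiable_on UNIV) \<and> closure {x. \<eta> x \<noteq> 0} \<subseteq> {a<..<b}"

definition weak_deriv :: "real \<Rightarrow> real \<Rightarrow> (real \<Rightarrow> real) \<Rightarrow> (real \<Rightarrow> real) \<Rightarrow> bool" where
  "weak_deriv a b f g \<longleftrightarrow>
     f \<in> L2 {a<..<b} \<and> g \<in> L2 {a<..<b} \<and>
     (\<forall>\<eta>. test_function a b \<eta> \<longrightarrow>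
        (\<integral>x. f x * deriv \<eta> x \<partial>lebesgue_on {a<..<b}) = - (\<integral>x. g x * \<eta> x \<partial>lebesgue_on {a<..<b}))"

definition H1 :: "real \<Rightarrow> real \<Rightarrow> (real \<Rightarrow> real) set" where
  "H1 a b = {f. \<exists>f'. weak_deriv a b f f'}"

definition H2 :: "real \<Rightarrow> real \<Rightarrow> (real \<Rightarrow> real) set" where
  "H2 a b = {f. \<exists>f' f''. weak_deriv a b f f' \<and> weak_deriv a b f' f''}"

text \<open>Point values of an \<open>H\<^sup>2\<close> function are those of its continuous representative.\<close>

definition V2 :: "real \<Rightarrow> (real \<Rightarrow> real) set" where
  "V2 l = {v \<in> H2 0 l. continuous_on {0..l} v \<and> v 0 = 0 \<and> v l = 0}"

definition Omega :: "real \<Rightarrow> real \<Rightarrow> (real \<times> real) set" where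
  "Omega l T = {0<..<l} \<times> {0<..<T}"

text \<open>
  Membership of \<open>w\<close> in \<open>L\<^sup>2(0,T;V\<^sup>2(0,l))\<close>, with \<open>w\<^sub>x = wx\<close> and \<open>w\<^sub>x\<^sub>x = wxx\<close>. A curve
  \<open>t \<mapsto> w(\<cdot>,t)\<close> in a space of functions on \<open>(0,l)\<close> is identified with the function \<open>w\<close> of \<open>(x,t)\<close>,
  Bochner measurability being joint measurability.
\<close>

definition L2_V2 :: "real \<Rightarrow> real \<Rightarrow> (real \<times> real \<Rightarrow> real) \<Rightarrow> (real \<times> real \<Rightarrow> real) \<Rightarrow>
    (real \<times> real \<Rightarrow> real) \<Rightarrow> bool" where
  "L2_V2 l T w wx wxx \<longleftrightarrow>
     w \<in> L2 (Omega l T) \<and> wx \<in> L2 (Omega l T) \<and> wxx \<in> L2 (Omega l T) \<and>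
     (AE t in lebesgue_on {0<..<T}. (\<lambda>x. w (x,t)) \<in> V2 l \<and>
        weak_deriv 0 l (\<lambda>x. w (x,t)) (\<lambda>x. wx (x,t)) \<and>
        weak_deriv 0 l (\<lambda>x. wx (x,t)) (\<lambda>x. wxx (x,t)))"

text \<open>
  The weak derivative \<open>w\<^sub>t = wt\<close> in \<open>L\<^sup>2(0,T;L\<^sup>2(0,l))\<close>: \<open>\<integral> w \<eta>' dt = - \<integral> wt \<eta> dt\<close> as elements
  of \<open>L\<^sup>2(0,l)\<close>.
\<close>

definition weak_dt :: "real \<Rightarrow> real \<Rightarrow> (real \<times> real \<Rightarrow> real) \<Rightarrow> (real \<times> real \<Rightarrow> real) \<Rightarrow> bool" where
  "weak_dt l T w wt \<longleftrightarrow>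
     w \<in> L2 (Omega l T) \<and> wt \<in> L2 (Omega l T) \<and>
     (\<forall>\<eta>. test_function 0 T \<eta> \<longrightarrow>
        (AE x in lebesgue_on {0<..<l}.
           (\<integral>t. w (x,t) * deriv \<eta> t \<partial>lebesgue_on {0<..<T})
             = - (\<integral>t. wt (x,t) * \<eta> t \<partial>lebesgue_on {0<..<T})))"

definition norm_H2 :: "real \<Rightarrow> (real \<Rightarrow> real) \<Rightarrow> real" where
  "norm_H2 l \<psi> = sqrt (\<integral>x. (\<psi> x)\<^sup>2 + (deriv \<psi> x)\<^sup>2 + (deriv (deriv \<psi>) x)\<^sup>2 \<partial>lebesgue_on {0<..<l})"

text \<open>
  \<open>H\<^sup>-\<^sup>2(0,l)\<close> is the dual of \<open>H\<^sup>2\<^sub>0(0,l)\<close>, the closure of the test functions in \<open>H\<^sup>2(0,l)\<close>; an element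
  is determined by its values on test functions. \<open>Hm2_bound l g C\<close> states that its norm is at most
  \<open>C\<close>.
\<close>

definition Hm2_bound :: "real \<Rightarrow> ((real \<Rightarrow> real) \<Rightarrow> real) \<Rightarrow> real \<Rightarrow> bool" where
  "Hm2_bound l g C \<longleftrightarrow>
     (\<forall>\<psi> \<psi>' a b. test_function 0 l \<psi> \<longrightarrow> test_function 0 l \<psi>' \<longrightarrow>
        g (\<lambda>x. a * \<psi> x + b * \<psi>' x) = a * g \<psi> + b * g \<psi>') \<and>
     (\<forall>\<psi>. test_function 0 l \<psi> \<longrightarrow> \<bar>g \<psi>\<bar> \<le> C * norm_H2 l \<psi>)"

definition L2_Hm2 :: "real \<Rightarrow> real \<Rightarrow> (real \<Rightarrow> (real \<Rightarrow> real) \<Rightarrow> real) \<Rightarrow> bool" where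
  "L2_Hm2 l T g \<longleftrightarrow>
     (\<forall>\<psi>. test_function 0 l \<psi> \<longrightarrow> (\<lambda>t. g t \<psi>) \<in> borel_measurable (lebesgue_on {0<..<T})) \<and>
     (\<exists>N \<in> L2 {0<..<T}. AE t in lebesgue_on {0<..<T}. Hm2_bound l (g t) (N t))"

definition weak_dt_Hm2 :: "real \<Rightarrow> real \<Rightarrow> (real \<times> real \<Rightarrow> real) \<Rightarrow>
    (real \<Rightarrow> (real \<Rightarrow> real) \<Rightarrow> real) \<Rightarrow> bool" where
  "weak_dt_Hm2 l T w g \<longleftrightarrow>
     w \<in> L2 (Omega l T) \<and> L2_Hm2 l T g \<and>
     (\<forall>\<eta> \<psi>. test_function 0 T \<eta> \<longrightarrow> test_function 0 l \<psi> \<longrightarrow>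
        (\<integral>(x,t). w (x,t) * deriv \<eta> t * \<psi> x \<partial>lebesgue_on (Omega l T))
          = - (\<integral>t. g t \<psi> * \<eta> t \<partial>lebesgue_on {0<..<T}))"

text \<open>
  A curve with \<open>w, w\<^sub>t \<in> L\<^sup>2(0,T;L\<^sup>2(0,l))\<close> has a representative in \<open>C([0,T];L\<^sup>2(0,l))\<close>, through
  which its values at the end times are defined.
\<close>

definition time_continuous :: "real \<Rightarrow> real \<Rightarrow> (real \<times> real \<Rightarrow> real) \<Rightarrow> bool" where
  "time_continuous l T w \<longleftrightarrow>
     (\<forall>t\<in>{0..T}. (\<lambda>x. w (x,t)) \<in> L2 {0<..<l} \<and>
        ((\<lambda>s. norm_L2 {0<..<l} (\<lambda>x. w (x,s) - w (x,t))) \<longlongrightarrow> 0) (at t within {0..T}))"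

definition vanishes_at_time :: "real \<Rightarrow> real \<Rightarrow> (real \<times> real \<Rightarrow> real) \<Rightarrow> bool" where
  "vanishes_at_time l t w \<longleftrightarrow> (AE x in lebesgue_on {0<..<l}. w (x,t) = 0)"

text \<open>
  \<open>v \<in> H\<^sup>1(0,T;V\<^sup>2(0,l))\<close>, with \<open>v\<^sub>x = vx\<close>, \<open>v\<^sub>x\<^sub>x = vxx\<close>, \<open>v\<^sub>t = vt\<close> and \<open>v\<^sub>x\<^sub>x\<^sub>t = vxxt\<close>.
\<close>

definition H1_V2 :: "real \<Rightarrow> real \<Rightarrow> (real \<times> real \<Rightarrow> real) \<Rightarrow> (real \<times> real \<Rightarrow> real) \<Rightarrow>
    (real \<times> real \<Rightarrow> real) \<Rightarrow> (real \<times> real \<Rightarrow> real) \<Rightarrow> (real \<times> real \<Rightarrow> real) \<Rightarrow> bool" where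
  "H1_V2 l T v vx vxx vt vxxt \<longleftrightarrow>
     L2_V2 l T v vx vxx \<and> (\<exists>vxt. L2_V2 l T vt vxt vxxt) \<and> weak_dt l T v vt \<and> time_continuous l T v"

text \<open>
  The derivative \<open>w\<^sub>x(x,t)\<close> at a point \<open>x \<in> [0,l]\<close>, one-sided at the end points; it exists for
  \<open>w(\<cdot>,t) \<in> V\<^sup>2(0,l)\<close> because \<open>H\<^sup>2(0,l)\<close> embeds in \<open>C\<^sup>1([0,l])\<close>.
\<close>

definition dx_at :: "real \<Rightarrow> (real \<times> real \<Rightarrow> real) \<Rightarrow> real \<Rightarrow> real \<Rightarrow> real" where
  "dx_at l w x t = vector_derivative (\<lambda>y. w (y,t)) (at x within {0..l})"

definition weak_solution_space :: "real \<Rightarrow> real \<Rightarrow> (real \<times> real \<Rightarrow> real) \<Rightarrow> (real \<times> real \<Rightarrow> real) \<Rightarrow>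
    (real \<times> real \<Rightarrow> real) \<Rightarrow> (real \<times> real \<Rightarrow> real) \<Rightarrow> bool" where
  "weak_solution_space l T w wx wxx wt \<longleftrightarrow>
     L2_V2 l T w wx wxx \<and> weak_dt l T w wt \<and> (\<exists>wtt. weak_dt_Hm2 l T wt wtt) \<and> time_continuous l T w"

text \<open>The condition \<open>u\<^sub>t(\<cdot>,0) = 0\<close> is contained in the identity, as \<open>v(\<cdot>,0)\<close> is arbitrary.\<close>

definition forward_weak_solution :: "real \<Rightarrow> real \<Rightarrow> (real \<Rightarrow> real) \<Rightarrow> (real \<Rightarrow> real) \<Rightarrow>
    (real \<Rightarrow> real) \<Rightarrow> (real \<Rightarrow> real) \<Rightarrow> (real \<Rightarrow> real) \<Rightarrow>
    (real \<times> real \<Rightarrow> real) \<Rightarrow> (real \<times> real \<Rightarrow> real) \<Rightarrow> bool" where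
  "forward_weak_solution l T \<rho>A \<mu> Tr r \<kappa> F u \<longleftrightarrow>
     (\<exists>ux uxx ut. weak_solution_space l T u ux uxx ut \<and> vanishes_at_time l 0 u \<and>
        (\<forall>v vx vxx vt vxxt. H1_V2 l T v vx vxx vt vxxt \<longrightarrow> vanishes_at_time l T v \<longrightarrow>
           (\<integral>(x,t). - \<rho>A x * ut (x,t) * vt (x,t) + \<mu> x * ut (x,t) * v (x,t)
                + Tr x * ux (x,t) * vx (x,t) + r x * uxx (x,t) * vxx (x,t)
                - \<kappa> x * uxx (x,t) * vxxt (x,t) \<partial>lebesgue_on (Omega l T))
             = (\<integral>z. F z * v z \<partial>lebesgue_on (Omega l T))))"

definition adjoint_weak_solution :: "real \<Rightarrow> real \<Rightarrow> (real \<Rightarrow> real) \<Rightarrow> (real \<Rightarrow> real) \<Rightarrow>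
    (real \<Rightarrow> real) \<Rightarrow> (real \<Rightarrow> real) \<Rightarrow> (real \<Rightarrow> real) \<Rightarrow>
    (real \<Rightarrow> real) \<Rightarrow> (real \<Rightarrow> real) \<Rightarrow> (real \<times> real \<Rightarrow> real) \<Rightarrow> bool" where
  "adjoint_weak_solution l T \<rho>A \<mu> Tr r \<kappa> p q \<phi> \<longleftrightarrow>
     (\<exists>\<phi>x \<phi>xx \<phi>t. weak_solution_space l T \<phi> \<phi>x \<phi>xx \<phi>t \<and> vanishes_at_time l T \<phi> \<and>
        (\<forall>v vx vxx vt vxxt. H1_V2 l T v vx vxx vt vxxt \<longrightarrow> vanishes_at_time l 0 v \<longrightarrow>
           (\<integral>(x,t). - \<rho>A x * \<phi>t (x,t) * vt (x,t) - \<mu> x * \<phi>t (x,t) * v (x,t)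
                + Tr x * \<phi>x (x,t) * vx (x,t) + r x * \<phi>xx (x,t) * vxx (x,t)
                + \<kappa> x * \<phi>xx (x,t) * vxxt (x,t) \<partial>lebesgue_on (Omega l T))
             = (\<integral>t. p t * dx_at l v 0 t + q t * dx_at l v l t \<partial>lebesgue_on {0<..<T})))"

definition admissible_loads :: "real \<Rightarrow> real \<Rightarrow> real \<Rightarrow> (real \<times> real \<Rightarrow> real) set" where
  "admissible_loads l T CF = {F \<in> L2 (Omega l T). (norm_L2 (Omega l T) F)\<^sup>2 \<le> CF}"

text \<open>The argument \<open>u\<close> is the solution operator \<open>F \<mapsto> u(\<cdot>,\<cdot>;F)\<close> of the forward problem.\<close>

definition tikhonov :: "real \<Rightarrow> real \<Rightarrow> (real \<Rightarrow> real) \<Rightarrow> (real \<Rightarrow> real) \<Rightarrow>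
    ((real \<times> real \<Rightarrow> real) \<Rightarrow> real \<times> real \<Rightarrow> real) \<Rightarrow> (real \<times> real \<Rightarrow> real) \<Rightarrow> real" where
  "tikhonov l T \<theta>\<^sub>0 \<theta>\<^sub>l u F =
     1/2 * (\<integral>t. (dx_at l (u F) 0 t - \<theta>\<^sub>0 t)\<^sup>2 \<partial>lebesgue_on {0<..<T}) +
     1/2 * (\<integral>t. (dx_at l (u F) l t - \<theta>\<^sub>l t)\<^sup>2 \<partial>lebesgue_on {0<..<T})"

text \<open>
  \<open>g\<close> is the Frechet gradient at \<open>F\<close>, with respect to the inner product of \<open>L\<^sup>2(S)\<close>, of the
  functional \<open>J\<close> with domain \<open>A\<close>. The notion is spelled out because the elements of \<open>L\<^sup>2(S)\<close> do not
  form a normed vector space type here.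
\<close>

definition has_L2_gradient :: "(('a::euclidean_space \<Rightarrow> real) \<Rightarrow> real) \<Rightarrow> ('a \<Rightarrow> real) \<Rightarrow>
    ('a \<Rightarrow> real) \<Rightarrow> 'a set \<Rightarrow> ('a \<Rightarrow> real) set \<Rightarrow> bool" where
  "has_L2_gradient J g F S A \<longleftrightarrow>
     g \<in> L2 S \<and>
     (\<forall>\<epsilon>>0. \<exists>\<delta>>0. \<forall>h\<in>L2 S. (\<lambda>z. F z + h z) \<in> A \<longrightarrow> norm_L2 S h < \<delta> \<longrightarrow>
        \<bar>J (\<lambda>z. F z + h z) - J F - (\<integral>z. g z * h z \<partial>lebesgue_on S)\<bar> \<le> \<epsilon> * norm_L2 S h)"

end

theory Submission
  imports Defs
begin

text \<open>
  Write \<open>u = K f\<close> with \<open>f = u\<^sub>x\<^sub>x\<close> and \<open>K\<close> the Green operator of the Dirichlet problem on \<open>(0,l)\<close>, and let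
  \<open>L\<close> be time integration from \<open>0\<close>, with adjoint \<open>I\<close>, time integration up to \<open>T\<close>. Test functions with
  \<open>v\<^sub>x\<^sub>x = I g\<close> turn the weak form into an identity between \<open>f\<close> and an arbitrary \<open>g\<close> in \<open>L\<^sup>2\<close> that involves
  only bounded operators, so it makes sense although \<open>u\<^sub>x\<^sub>x\<^sub>t\<close> is not known to be in \<open>L\<^sup>2\<close>.

  Taking \<open>g = f\<close> on \<open>(0,s)\<close> gives energy estimates of \<open>L f\<close> by \<open>L F\<close>. As \<open>L f\<close> solves the problem with load
  \<open>L F\<close> and the range of \<open>L\<close> is dense, these are estimates of \<open>f\<close> by \<open>F\<close>; the constant used is the geometric
  mean of the one that comes from the inertia \<open>\<rho>\<close> and the one that comes from the damping \<open>\<kappa>\<close>. Taking for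
  \<open>g\<close> the second derivative of the adjoint solution gives, again after density, the duality
  \<open>\<langle>F, \<phi>\<rangle> = \<langle>p, u\<^sub>x(0)\<rangle> + \<langle>q, u\<^sub>x(l)\<rangle>\<close>.

  So if \<open>B\<close> maps a load to the traces of \<open>u\<^sub>x\<close>, the increment of the gradient is \<open>B\<^sup>*B \<delta>F\<close>, the remainder in
  the expansion of \<open>J\<close> is half the square of the norm of \<open>B \<delta>F\<close>, and the claim is that the norm of \<open>B\<close>
  squared is at most \<open>L\<^sub>G\<close>, which holds with room to spare.
\<close>

subsection \<open>Square integrable functions\<close>

text \<open>Neither energy estimate alone reaches the claimed constant. \<open>L_G\<close> scales
  like the inverse square root of \<kappa>0. The inertia estimate does not contain \<kappa>0 and
  fails for large \<kappa>0; the damping estimate scales like the inverse of \<kappa>0 and fails for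
  small \<kappa>0. Their geometric mean has the right power of \<kappa>0, and also the right powers
  of \<open>l\<close> and \<open>r0\<close>. The density argument needs an estimate of its own. The
  two above bound \<open>L f\<close> by \<open>L F\<close>; before \<open>L (G n)\<close> can be
  sent to \<open>F\<close>, the solutions must be known to converge. A cruder bound of
  \<open>f\<close> by \<open>F\<close>, taken from the damping and costing a factor
  \<open>T\<close>, provides this. The statement lives on completed Lebesgue measure, and a product
  of completed measures is not complete. Fubini is therefore applied to Borel representatives on a
  genuine product measure, and the \<open>L2\<close> calculus is set up for an arbitrary measure so
  that it serves both sides.\<close>

definition sqi :: "'a measure \<Rightarrow> ('a \<Rightarrow> real) set" where
  "sqi M = {f \<in> borel_measurable M. integrable M (\<lambda>z. (f z)\<^sup>2)}"

definition inner_L2 :: "'a measure \<Rightarrow> ('a \<Rightarrow> real) \<Rightarrow> ('a \<Rightarrow> real) \<Rightarrow> real" where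
  "inner_L2 M f g = (\<integral>z. f z * g z \<partial>M)"

lemma L2_eq_sqi: "L2 S = sqi (lebesgue_on S)"
  by (simp add: L2_def sqi_def)

lemma norm_L2_eq: "norm_L2 S f = sqrt (inner_L2 (lebesgue_on S) f f)"
  by (simp add: norm_L2_def inner_L2_def power2_eq_square)

lemma sqi_measurable [measurable_dest]: "f \<in> sqi M \<Longrightarrow> f \<in> borel_measurable M"
  by (simp add: sqi_def)

lemma sqi_integrable_sq: "f \<in> sqi M \<Longrightarrow> integrable M (\<lambda>z. f z * f z)"
  by (simp add: sqi_def power2_eq_square)

lemma sqi_integrable_mult:
  assumes "f \<in> sqi M" "g \<in> sqi M"
  shows "integrable M (\<lambda>z. f z * g z)"
proof (rule Bochner_Integration.integrable_bound)
  show "integrable M (\<lambda>z. f z * f z + g z * g z)"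
    using assms by (intro Bochner_Integration.integrable_add sqi_integrable_sq)
  show "(\<lambda>z. f z * g z) \<in> borel_measurable M"
    using assms by measurable
  have "\<bar>f z * g z\<bar> \<le> f z * f z + g z * g z" for z
  proof -
    have "2 * (\<bar>f z\<bar> * \<bar>g z\<bar>) \<le> f z * f z + g z * g z"
      using sum_squares_ge_zero[of "\<bar>f z\<bar> - \<bar>g z\<bar>" 0] by (simp add: algebra_simps)
    moreover have "0 \<le> \<bar>f z\<bar> * \<bar>g z\<bar>" by simp
    ultimately show ?thesis unfolding abs_mult by linarith
  qed
  then show "AE z in M. norm (f z * g z) \<le> norm (f z * f z + g z * g z)"
    by (intro AE_I2) (auto intro: order_trans)
qed

lemma sqi_bounded_mult:
  assumes "f \<in> sqi M" "a \<in> borel_measurable M" "\<And>z. z \<in> space M \<Longrightarrow> \<bar>a z\<bar> \<le> c"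
  shows "(\<lambda>z. a z * f z) \<in> sqi M"
proof -
  have "integrable M (\<lambda>z. (a z * f z)\<^sup>2)"
  proof (rule Bochner_Integration.integrable_bound)
    show "integrable M (\<lambda>z. c\<^sup>2 * (f z * f z))"
      using assms(1) by (intro integrable_mult_right sqi_integrable_sq)
    show "(\<lambda>z. (a z * f z)\<^sup>2) \<in> borel_measurable M"
      using assms by measurable
    show "AE z in M. norm ((a z * f z)\<^sup>2) \<le> norm (c\<^sup>2 * (f z * f z))"
    proof (rule AE_I2)
      fix z assume "z \<in> space M"
      then have "(a z)\<^sup>2 \<le> c\<^sup>2" using assms(3) by (metis abs_ge_zero order_trans power2_abs power_mono)
      then show "norm ((a z * f z)\<^sup>2) \<le> norm (c\<^sup>2 * (f z * f z))"
        by (auto simp: power_mult_distrib power2_eq_square[of "f z"] intro!: mult_right_mono)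
    qed
  qed
  then show ?thesis using assms by (auto simp: sqi_def)
qed

lemma sqi_cmult: "f \<in> sqi M \<Longrightarrow> (\<lambda>z. c * f z) \<in> sqi M"
  by (rule sqi_bounded_mult[where c = "\<bar>c\<bar>"]) auto

lemma sqi_uminus: "f \<in> sqi M \<Longrightarrow> (\<lambda>z. - f z) \<in> sqi M"
  using sqi_cmult[of f M "-1"] by simp

lemma sqi_add:
  assumes "f \<in> sqi M" "g \<in> sqi M"
  shows "(\<lambda>z. f z + g z) \<in> sqi M"
proof -
  have "integrable M (\<lambda>z. f z * f z + 2 * (f z * g z) + g z * g z)"
    using assms by (intro Bochner_Integration.integrable_add integrable_mult_right sqi_integrable_mult)
  moreover have "f z * f z + 2 * (f z * g z) + g z * g z = (f z + g z)\<^sup>2" for z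
    by (simp add: power2_eq_square algebra_simps)
  ultimately show ?thesis using assms by (auto simp: sqi_def)
qed

lemma sqi_diff: "f \<in> sqi M \<Longrightarrow> g \<in> sqi M \<Longrightarrow> (\<lambda>z. f z - g z) \<in> sqi M"
  using sqi_add[of f M "\<lambda>z. - g z"] sqi_uminus[of g M] by (simp only: diff_conv_add_uminus)

lemma sqi_cong_AE:
  assumes "f \<in> sqi M" "g \<in> borel_measurable M" "AE z in M. f z = g z"
  shows "g \<in> sqi M"
proof -
  have "integrable M (\<lambda>z. (g z)\<^sup>2) \<longleftrightarrow> integrable M (\<lambda>z. (f z)\<^sup>2)"
    using assms by (intro integrable_cong_AE) auto
  then show ?thesis using assms by (auto simp: sqi_def)
qed

lemma (in finite_measure) sqi_bounded:
  assumes "f \<in> borel_measurable M" "\<And>z. z \<in> space M \<Longrightarrow> \<bar>f z\<bar> \<le> c"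
  shows "f \<in> sqi M"
proof -
  have "(\<lambda>z. f z * 1) \<in> sqi M"
    using assms by (intro sqi_bounded_mult[where c=c]) (auto simp: sqi_def)
  then show ?thesis by simp
qed

lemma (in finite_measure) sqi_integrable: "f \<in> sqi M \<Longrightarrow> integrable M f"
proof -
  assume f: "f \<in> sqi M"
  have "(\<lambda>_. 1) \<in> sqi M" by (rule sqi_bounded[where c = 1]) auto
  from sqi_integrable_mult[OF f this] show ?thesis by simp
qed

lemma inner_L2_commute: "inner_L2 M f g = inner_L2 M g f"
  by (simp add: inner_L2_def mult.commute)

lemma inner_L2_nonneg: "0 \<le> inner_L2 M f f"
  by (simp add: inner_L2_def)

lemma inner_L2_cmult: "inner_L2 M (\<lambda>z. c * f z) g = c * inner_L2 M f g"
  "inner_L2 M f (\<lambda>z. c * g z) = c * inner_L2 M f g"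
  proof -
  have "inner_L2 M (\<lambda>z. c * f z) g = (\<integral>z. c * (f z * g z) \<partial>M)"
    by (simp only: inner_L2_def mult.assoc)
  then show "inner_L2 M (\<lambda>z. c * f z) g = c * inner_L2 M f g" by (simp add: inner_L2_def)
  have "inner_L2 M f (\<lambda>z. c * g z) = (\<integral>z. c * (f z * g z) \<partial>M)"
    by (simp only: inner_L2_def mult.left_commute)
  then show "inner_L2 M f (\<lambda>z. c * g z) = c * inner_L2 M f g" by (simp add: inner_L2_def)
qed

lemma inner_L2_uminus: "inner_L2 M (\<lambda>z. - f z) g = - inner_L2 M f g"
  "inner_L2 M f (\<lambda>z. - g z) = - inner_L2 M f g"
  by (simp_all add: inner_L2_def)

lemma inner_L2_add:
  assumes "f \<in> sqi M" "g \<in> sqi M" "h \<in> sqi M"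
  shows "inner_L2 M (\<lambda>z. f z + g z) h = inner_L2 M f h + inner_L2 M g h"
    "inner_L2 M h (\<lambda>z. f z + g z) = inner_L2 M h f + inner_L2 M h g"
  using Bochner_Integration.integral_add[OF sqi_integrable_mult[OF assms(1,3)] sqi_integrable_mult[OF assms(2,3)]]
  by (simp_all only: inner_L2_def distrib_right distrib_left left_diff_distrib right_diff_distrib mult.commute[of "h _"])

lemma inner_L2_diff:
  assumes "f \<in> sqi M" "g \<in> sqi M" "h \<in> sqi M"
  shows "inner_L2 M (\<lambda>z. f z - g z) h = inner_L2 M f h - inner_L2 M g h"
    "inner_L2 M h (\<lambda>z. f z - g z) = inner_L2 M h f - inner_L2 M h g"
  using Bochner_Integration.integral_diff[OF sqi_integrable_mult[OF assms(1,3)] sqi_integrable_mult[OF assms(2,3)]]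
  by (simp_all only: inner_L2_def distrib_right distrib_left left_diff_distrib right_diff_distrib mult.commute[of "h _"])

lemma inner_L2_cong_AE:
  assumes "AE z in M. f z = f' z" "AE z in M. g z = g' z"
    and "f \<in> borel_measurable M" "f' \<in> borel_measurable M" "g \<in> borel_measurable M" "g' \<in> borel_measurable M"
  shows "inner_L2 M f g = inner_L2 M f' g'"
  unfolding inner_L2_def using assms by (intro integral_cong_AE) auto

lemma inner_L2_mult_shift: "inner_L2 M (\<lambda>z. a z * f z) g = inner_L2 M f (\<lambda>z. a z * g z)"
  by (simp add: inner_L2_def mult_ac)

lemma Cauchy_Schwarz_L2_sq:
  assumes "f \<in> sqi M" "g \<in> sqi M"
  shows "(inner_L2 M f g)\<^sup>2 \<le> inner_L2 M f f * inner_L2 M g g"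
proof -
  define a b c where "a = inner_L2 M f f" and "b = inner_L2 M f g" and "c = inner_L2 M g g"
  have quad: "0 \<le> a - 2 * s * b + s\<^sup>2 * c" for s
  proof -
    have "0 \<le> inner_L2 M (\<lambda>z. f z - s * g z) (\<lambda>z. f z - s * g z)"
      by (rule inner_L2_nonneg)
    also have "\<dots> = a - 2 * s * b + s\<^sup>2 * c"
      using assms
      by (simp add: inner_L2_diff sqi_cmult sqi_diff inner_L2_cmult a_def b_def c_def
          inner_L2_commute[of M g f] power2_eq_square algebra_simps)
    finally show ?thesis .
  qed
  have "a \<ge> 0" "c \<ge> 0" by (auto simp: a_def c_def inner_L2_nonneg)
  show ?thesis
  proof (cases "c = 0")
    case True
    have "b = 0"
    proof (rule ccontr)
      assume "b \<noteq> 0"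
      \<comment> \<open>With \<open>c = 0\<close> the quadratic has the value -1 at this
        \<open>s\<close>.\<close>
      with quad[of "(a + 1) / (2 * b)"] True show False by (simp add: field_simps)
    qed
    then show ?thesis using \<open>a \<ge> 0\<close> \<open>c \<ge> 0\<close> unfolding a_def b_def c_def by simp
  next
    case False
    with \<open>c \<ge> 0\<close> have "c > 0" by simp
    \<comment> \<open>\<open>b / c\<close> is the minimiser of the quadratic.\<close>
    then have "0 \<le> (a - 2 * (b/c) * b + (b/c)\<^sup>2 * c) * c" using quad[of "b/c"] by simp
    also have "\<dots> = a * c - b\<^sup>2" using \<open>c > 0\<close> by (simp add: field_simps power2_eq_square)
    finally show ?thesis unfolding a_def b_def c_def by simp
  qed
qed

lemma Cauchy_Schwarz_L2:
  assumes "f \<in> sqi M" "g \<in> sqi M"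
  shows "\<bar>inner_L2 M f g\<bar> \<le> sqrt (inner_L2 M f f) * sqrt (inner_L2 M g g)"
  using real_sqrt_le_mono[OF Cauchy_Schwarz_L2_sq[OF assms]] by (simp add: real_sqrt_mult)

lemma inner_L2_mono_abs:
  assumes "f \<in> sqi M" "g \<in> sqi M" "AE z in M. \<bar>f z\<bar> \<le> \<bar>g z\<bar>"
  shows "inner_L2 M f f \<le> inner_L2 M g g"
  unfolding inner_L2_def
proof (rule integral_mono_AE)
  show "AE z in M. f z * f z \<le> g z * g z"
    using assms(3) by eventually_elim (metis abs_le_square_iff power2_eq_square)
qed (use assms sqi_integrable_mult in auto)

lemma inner_L2_add_self_le:
  assumes "f \<in> sqi M" "g \<in> sqi M"
  shows "inner_L2 M (\<lambda>z. f z + g z) (\<lambda>z. f z + g z) \<le> 2 * inner_L2 M f f + 2 * inner_L2 M g g"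
proof -
  have "0 \<le> inner_L2 M (\<lambda>z. f z - g z) (\<lambda>z. f z - g z)" by (rule inner_L2_nonneg)
  then show ?thesis
    using assms by (simp add: inner_L2_diff inner_L2_add sqi_add sqi_diff inner_L2_commute[of M g f])
qed

lemma tendsto_inner_L2:
  assumes "\<And>n. f n \<in> sqi M" "g \<in> sqi M" "h \<in> sqi M"
    and "(\<lambda>n. inner_L2 M (\<lambda>z. f n z - g z) (\<lambda>z. f n z - g z)) \<longlonglongrightarrow> 0"
  shows "(\<lambda>n. inner_L2 M (f n) h) \<longlonglongrightarrow> inner_L2 M g h"
proof (rule LIM_zero_cancel, rule Lim_null_comparison)
  show "\<forall>\<^sub>F n in sequentially. norm (inner_L2 M (f n) h - inner_L2 M g h)
      \<le> sqrt (inner_L2 M (\<lambda>z. f n z - g z) (\<lambda>z. f n z - g z)) * sqrt (inner_L2 M h h)"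
    using Cauchy_Schwarz_L2[OF sqi_diff[OF assms(1,2)] assms(3)] assms by (simp add: inner_L2_diff)
  show "(\<lambda>n. sqrt (inner_L2 M (\<lambda>z. f n z - g z) (\<lambda>z. f n z - g z)) * sqrt (inner_L2 M h h)) \<longlonglongrightarrow> 0"
    using tendsto_mult[OF tendsto_real_sqrt[OF assms(4)] tendsto_const[of "sqrt (inner_L2 M h h)"]] by simp
qed


subsection \<open>Integral operators with bounded kernels\<close>

text \<open>A sup bound instead of square integrability: on a finite measure space the operator is
  then defined at every point, not only almost everywhere.\<close>

definition kernel :: "'a measure \<Rightarrow> ('a \<Rightarrow> 'a \<Rightarrow> real) \<Rightarrow> real \<Rightarrow> bool" where
  "kernel X k c \<longleftrightarrow> 0 \<le> c \<and> (\<lambda>(x,y). k x y) \<in> borel_measurable (X \<Otimes>\<^sub>M X) \<and>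
     (\<forall>x\<in>space X. \<forall>y\<in>space X. \<bar>k x y\<bar> \<le> c)"

definition kop :: "'a measure \<Rightarrow> ('a \<Rightarrow> 'a \<Rightarrow> real) \<Rightarrow> ('a \<Rightarrow> real) \<Rightarrow> 'a \<Rightarrow> real" where
  "kop X k f x = (\<integral>y. k x y * f y \<partial>X)"

lemma kernel_transpose:
  assumes "kernel X k c" shows "kernel X (\<lambda>x y. k y x) c"
proof -
  have "(\<lambda>(x,y). k x y) \<in> borel_measurable (X \<Otimes>\<^sub>M X)" using assms by (simp add: kernel_def)
  then have "(\<lambda>p. (\<lambda>(x,y). k x y) (snd p, fst p)) \<in> borel_measurable (X \<Otimes>\<^sub>M X)"
    by measurable
  then show ?thesis using assms by (simp add: kernel_def split_def)
qed

lemma kernel_section: "kernel X k c \<Longrightarrow> x \<in> space X \<Longrightarrow> k x \<in> borel_measurable X"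
  unfolding kernel_def using measurable_Pair2[of "\<lambda>(x,y). k x y" X X borel x] by simp

lemma kernel_measurable: "kernel X k c \<Longrightarrow> (\<lambda>p. k (fst p) (snd p)) \<in> borel_measurable (X \<Otimes>\<^sub>M X)"
  by (simp add: kernel_def split_def)

lemma (in pair_sigma_finite) integrable_prod_mult:
  fixes a :: "'a \<Rightarrow> real" and b :: "'b \<Rightarrow> real"
  assumes "integrable M1 a" "integrable M2 b"
  shows "integrable (M1 \<Otimes>\<^sub>M M2) (\<lambda>(x,y). a x * b y)"
proof (rule Fubini_integrable)
  note assms[THEN borel_measurable_integrable, measurable]
  show "(\<lambda>(x,y). a x * b y) \<in> borel_measurable (M1 \<Otimes>\<^sub>M M2)" by measurable
  show "integrable M1 (\<lambda>x. \<integral>y. norm (case (x, y) of (x, y) \<Rightarrow> a x * b y) \<partial>M2)"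
    using assms by (simp add: abs_mult)
qed (use assms in simp)

context finite_measure begin

lemma integrable_bounded_mult:
  assumes "f \<in> sqi M" "a \<in> borel_measurable M" "\<And>z. z \<in> space M \<Longrightarrow> \<bar>a z\<bar> \<le> c"
  shows "integrable M (\<lambda>z. a z * f z)"
  using sqi_integrable[OF sqi_bounded_mult[OF assms]] .

lemma abs_kop_le:
  assumes k: "kernel M k c" and f: "f \<in> sqi M" and x: "x \<in> space M"
  shows "\<bar>kop M k f x\<bar> \<le> c * (\<integral>y. \<bar>f y\<bar> \<partial>M)"
proof -
  have "\<bar>kop M k f x\<bar> \<le> (\<integral>y. \<bar>k x y * f y\<bar> \<partial>M)"
    unfolding kop_def by (rule integral_abs_bound)
  also have "\<dots> \<le> (\<integral>y. c * \<bar>f y\<bar> \<partial>M)"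
  proof (rule integral_mono)
    show "integrable M (\<lambda>y. \<bar>k x y * f y\<bar>)"
      using k x by (intro integrable_abs integrable_bounded_mult[OF f kernel_section[OF k x], of c])
        (auto simp: kernel_def)
    show "integrable M (\<lambda>y. c * \<bar>f y\<bar>)" using sqi_integrable[OF f] by simp
    show "\<bar>k x y * f y\<bar> \<le> c * \<bar>f y\<bar>" if "y \<in> space M" for y
      using k x that by (auto simp: kernel_def abs_mult intro!: mult_right_mono)
  qed
  finally show ?thesis by simp
qed

lemma integral_abs_sq_le:
  assumes f: "f \<in> sqi M"
  shows "(\<integral>y. \<bar>f y\<bar> \<partial>M)\<^sup>2 \<le> measure M (space M) * inner_L2 M f f"
proof -
  have a: "(\<lambda>y. \<bar>f y\<bar>) \<in> sqi M" using f by (auto simp: sqi_def)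
  have b: "(\<lambda>y. 1) \<in> sqi M" by (rule sqi_bounded[of _ 1]) auto
  show ?thesis using Cauchy_Schwarz_L2_sq[OF a b] by (simp add: inner_L2_def mult.commute)
qed

lemma kop_measurable:
  assumes k: "kernel M k c" and f: "f \<in> borel_measurable M"
  shows "kop M k f \<in> borel_measurable M"
proof -
  note kernel_measurable[OF k, measurable] and f[measurable]
  have "(\<lambda>x. \<integral>y. (\<lambda>p. k (fst p) (snd p) * f (snd p)) (x, y) \<partial>M) \<in> borel_measurable M"
    by measurable
  then show ?thesis by (simp add: kop_def[abs_def])
qed

lemma kop_sqi: "kernel M k c \<Longrightarrow> f \<in> sqi M \<Longrightarrow> kop M k f \<in> sqi M"
  by (rule sqi_bounded[OF kop_measurable abs_kop_le]) auto

lemma kop_adjoint: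
  assumes k: "kernel M k c" and f: "f \<in> sqi M" and g: "g \<in> sqi M"
  shows "inner_L2 M (kop M k f) g = inner_L2 M f (kop M (\<lambda>x y. k y x) g)"
proof -
  interpret P: pair_sigma_finite M M by unfold_locales
  interpret F: finite_measure "M \<Otimes>\<^sub>M M" by (rule finite_measure_pair_measure) unfold_locales
  note kernel_measurable[OF k, measurable] f[THEN sqi_measurable, measurable] g[THEN sqi_measurable, measurable]
  have "integrable (M \<Otimes>\<^sub>M M) (\<lambda>(x,y). \<bar>g x\<bar> * \<bar>f y\<bar>)"
    using sqi_integrable[OF f] sqi_integrable[OF g] by (intro P.integrable_prod_mult) auto
  then have "integrable (M \<Otimes>\<^sub>M M) (\<lambda>p. c * (\<bar>g (fst p)\<bar> * \<bar>f (snd p)\<bar>))"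
    by (simp add: split_def)
  then have I: "integrable (M \<Otimes>\<^sub>M M) (\<lambda>(x,y). k x y * f y * g x)"
  proof (rule Bochner_Integration.integrable_bound)
    show "(\<lambda>(x,y). k x y * f y * g x) \<in> borel_measurable (M \<Otimes>\<^sub>M M)"
      unfolding split_def by measurable
    have "\<bar>k x y * f y * g x\<bar> \<le> c * (\<bar>g x\<bar> * \<bar>f y\<bar>)" if "x \<in> space M" "y \<in> space M" for x y
    proof -
      have "\<bar>k x y * f y * g x\<bar> = \<bar>k x y\<bar> * (\<bar>g x\<bar> * \<bar>f y\<bar>)" by (simp add: abs_mult)
      also have "\<dots> \<le> c * (\<bar>g x\<bar> * \<bar>f y\<bar>)"
        using k that by (intro mult_right_mono) (auto simp: kernel_def)
      finally show ?thesis .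
    qed
    then show "AE p in M \<Otimes>\<^sub>M M. norm (case p of (x,y) \<Rightarrow> k x y * f y * g x) \<le> norm (c * (\<bar>g (fst p)\<bar> * \<bar>f (snd p)\<bar>))"
      using k by (intro AE_I2) (auto simp: space_pair_measure kernel_def abs_mult)
  qed
  have "inner_L2 M (kop M k f) g = (\<integral>x. (\<integral>y. k x y * f y * g x \<partial>M) \<partial>M)"
    by (simp add: inner_L2_def kop_def)
  also have "\<dots> = (\<integral>y. (\<integral>x. k x y * f y * g x \<partial>M) \<partial>M)"
    by (rule P.Fubini_integral[OF I, symmetric])
  also have "\<dots> = (\<integral>y. f y * (\<integral>x. k x y * g x \<partial>M) \<partial>M)"
    by (intro Bochner_Integration.integral_cong refl)
      (simp add: mult.commute[of _ "f _"] mult.assoc mult.left_commute[of _ "f _"])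
  finally show ?thesis by (simp add: inner_L2_def kop_def)
qed

lemma kop_add:
  assumes k: "kernel M k c" and "f \<in> sqi M" "g \<in> sqi M" "x \<in> space M"
  shows "kop M k (\<lambda>y. f y + g y) x = kop M k f x + kop M k g x"
proof -
  have "integrable M (\<lambda>y. k x y * f y)" "integrable M (\<lambda>y. k x y * g y)"
    using assms by (auto intro!: integrable_bounded_mult[of _ _ c] kernel_section[OF k] simp: kernel_def)
  then show ?thesis by (simp add: kop_def distrib_left)
qed

end

lemma kop_cmult: "kop M k (\<lambda>y. a * f y) x = a * kop M k f x"
proof -
  have "kop M k (\<lambda>y. a * f y) x = (\<integral>y. a * (k x y * f y) \<partial>M)"
    by (simp only: kop_def mult.left_commute)
  then show ?thesis by (simp add: kop_def)
qed

lemma (in finite_measure) kop_cong_AE: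
  assumes k: "kernel M k c" and "AE y in M. f y = g y" "f \<in> borel_measurable M" "g \<in> borel_measurable M" "x \<in> space M"
  shows "kop M k f x = kop M k g x"
  unfolding kop_def
proof (rule integral_cong_AE)
  show "AE y in M. k x y * f y = k x y * g y" using assms(2) by eventually_elim simp
qed (use assms kernel_section[OF k] in measurable)


section \<open>Integral operators acting in one variable of a product space\<close>

definition opx :: "'a measure \<Rightarrow> ('a \<Rightarrow> 'a \<Rightarrow> real) \<Rightarrow> ('a \<times> 'b \<Rightarrow> real) \<Rightarrow> 'a \<times> 'b \<Rightarrow> real" where
  "opx X k f = (\<lambda>(x,t). kop X k (\<lambda>y. f (y,t)) x)"

definition opt :: "'b measure \<Rightarrow> ('b \<Rightarrow> 'b \<Rightarrow> real) \<Rightarrow> ('a \<times> 'b \<Rightarrow> real) \<Rightarrow> 'a \<times> 'b \<Rightarrow> real" where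
  "opt Y m f = (\<lambda>(x,t). kop Y m (\<lambda>s. f (x,s)) t)"

lemma opx_apply: "opx X k f (x,t) = kop X k (\<lambda>y. f (y,t)) x"
  by (simp add: opx_def)

lemma opt_apply: "opt Y m f (x,t) = kop Y m (\<lambda>s. f (x,s)) t"
  by (simp add: opt_def)

text \<open>Reduces every fact about \<open>opx\<close> to the one about \<open>opt\<close> on the
  product with its factors exchanged.\<close>

lemma opt_swap: "opt X k (\<lambda>p. f (prod.swap p)) (prod.swap p) = opx X k f p"
  by (simp add: opx_def opt_def split_def)

lemma opx_cmult: "opx X k (\<lambda>z. c * f z) = (\<lambda>z. c * opx X k f z)"
  by (auto simp: opx_def kop_cmult)

lemma opt_cmult: "opt Y m (\<lambda>z. c * f z) = (\<lambda>z. c * opt Y m f z)"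
  by (auto simp: opt_def kop_cmult)

lemma opx_mult_snd: "opx X k (\<lambda>z. a (snd z) * f z) = (\<lambda>z. a (snd z) * opx X k f z)"
  by (auto simp: opx_def kop_cmult)

lemma opt_mult_fst: "opt Y m (\<lambda>z. a (fst z) * f z) = (\<lambda>z. a (fst z) * opt Y m f z)"
  by (auto simp: opt_def kop_cmult)

locale finite_pair = X: finite_measure X + Y: finite_measure Y
  for X :: "'a measure" and Y :: "'b measure"

sublocale finite_pair \<subseteq> pair_sigma_finite X Y ..

sublocale finite_pair \<subseteq> M: finite_measure "X \<Otimes>\<^sub>M Y"
  by (rule finite_measure_pair_measure) unfold_locales

context finite_pair begin

abbreviation "M \<equiv> X \<Otimes>\<^sub>M Y"

lemma swap_pair: "finite_pair Y X" by unfold_locales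

lemma AE_fst: "AE x in X. P x \<Longrightarrow> AE p in M. P (fst p)"
proof -
  assume "AE x in X. P x"
  then obtain N where N: "N \<in> null_sets X" "{x \<in> space X. \<not> P x} \<subseteq> N"
    by (auto simp: eventually_ae_filter)
  then have "N \<times> space Y \<in> null_sets M" by (intro Y.times_in_null_sets1) auto
  then show ?thesis using N(2) by (rule_tac AE_I'[where N="N \<times> space Y"]) (auto simp: space_pair_measure)
qed

lemma AE_snd: "AE t in Y. P t \<Longrightarrow> AE p in M. P (snd p)"
proof -
  assume "AE x in Y. P x"
  then obtain N where N: "N \<in> null_sets Y" "{x \<in> space Y. \<not> P x} \<subseteq> N"
    by (auto simp: eventually_ae_filter)
  then have "space X \<times> N \<in> null_sets M" by (intro Y.times_in_null_sets2) auto
  then show ?thesis using N(2) by (rule_tac AE_I'[where N="space X \<times> N"]) (auto simp: space_pair_measure)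
qed

lemma AE_section_fst: "AE p in M. P p \<Longrightarrow> AE x in X. AE t in Y. P (x,t)"
  by (drule AE_pair) simp

lemma sqi_swap: "f \<in> sqi M \<Longrightarrow> (\<lambda>p. f (prod.swap p)) \<in> sqi (Y \<Otimes>\<^sub>M X)"
  using integrable_product_swap[of "\<lambda>p. (f p)\<^sup>2"] 
  by (auto simp: sqi_def prod.swap_def split_def)

lemma inner_swap:
  assumes "f \<in> sqi M" "g \<in> sqi M"
  shows "inner_L2 (Y \<Otimes>\<^sub>M X) (\<lambda>p. f (prod.swap p)) (\<lambda>p. g (prod.swap p)) = inner_L2 M f g"
proof -
  have "(\<lambda>p. f p * g p) \<in> borel_measurable M" using assms by measurable
  from integral_product_swap[OF this] show ?thesis
    by (simp add: inner_L2_def prod.swap_def split_def)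
qed

lemma AE_swap:
  assumes "AE p in Y \<Otimes>\<^sub>M X. P p" shows "AE p in M. P (prod.swap p)"
proof -
  have e: "Y \<Otimes>\<^sub>M X = distr M (Y \<Otimes>\<^sub>M X) (\<lambda>(x, y). (y, x))"
    using pair_sigma_finite.distr_pair_swap[of Y X] 
    by (simp add: pair_sigma_finite_def X.sigma_finite_measure_axioms Y.sigma_finite_measure_axioms)
  have "AE p in distr M (Y \<Otimes>\<^sub>M X) (\<lambda>(x, y). (y, x)). P p" using assms unfolding e[symmetric] .
  from AE_distrD[OF _ this] show ?thesis by (simp add: prod.swap_def split_def)
qed

lemma AE_section_snd: "AE p in M. P p \<Longrightarrow> AE t in Y. AE x in X. P (x,t)"
  using finite_pair.AE_section_fst[OF swap_pair finite_pair.AE_swap[OF swap_pair], of P] by simp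

lemma sqi_section_fst: "f \<in> sqi M \<Longrightarrow> AE x in X. (\<lambda>t. f (x,t)) \<in> sqi Y"
proof -
  assume f: "f \<in> sqi M"
  have "AE x in X. integrable Y (\<lambda>t. (f (x,t))\<^sup>2)"
    by (rule AE_integrable_fst'[of "\<lambda>p. (f p)\<^sup>2"]) (use f in \<open>simp add: sqi_def\<close>)
  with AE_space show ?thesis
    by eventually_elim (use f in \<open>auto simp: sqi_def\<close>)
qed

lemma inner_sections_fst:
  assumes "f \<in> sqi M" "g \<in> sqi M"
  shows "inner_L2 M f g = (\<integral>x. inner_L2 Y (\<lambda>t. f (x,t)) (\<lambda>t. g (x,t)) \<partial>X)"
    "integrable X (\<lambda>x. inner_L2 Y (\<lambda>t. f (x,t)) (\<lambda>t. g (x,t)))"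
  using integral_fst'[OF sqi_integrable_mult[OF assms]] integrable_fst'[OF sqi_integrable_mult[OF assms]]
  by (simp_all add: inner_L2_def)

lemma sqi_section_snd: "f \<in> sqi M \<Longrightarrow> AE t in Y. (\<lambda>x. f (x,t)) \<in> sqi X"
  using finite_pair.sqi_section_fst[OF swap_pair sqi_swap] by simp

lemma inner_sections_snd:
  assumes "f \<in> sqi M" "g \<in> sqi M"
  shows "inner_L2 M f g = (\<integral>t. inner_L2 X (\<lambda>x. f (x,t)) (\<lambda>x. g (x,t)) \<partial>Y)"
    "integrable Y (\<lambda>t. inner_L2 X (\<lambda>x. f (x,t)) (\<lambda>x. g (x,t)))"
  using finite_pair.inner_sections_fst[OF swap_pair sqi_swap sqi_swap, OF assms] inner_swap[OF assms]
  by simp_all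

lemma opt_measurable:
  assumes k: "kernel Y m c" and f: "f \<in> borel_measurable M"
  shows "opt Y m f \<in> borel_measurable M"
proof -
  note kernel_measurable[OF k, measurable] and f[measurable]
  have "(\<lambda>p. \<integral>s. (\<lambda>q. m (snd (fst q)) (snd q) * f (fst (fst q), snd q)) (p, s) \<partial>Y) \<in> borel_measurable M"
  proof (rule Y.borel_measurable_lebesgue_integral)
    have "(\<lambda>q. (\<lambda>p. m (fst p) (snd p)) (snd (fst q), snd q)) \<in> borel_measurable (M \<Otimes>\<^sub>M Y)"
      by measurable
    then show "(\<lambda>(x, y). m (snd (fst (x, y))) (snd (x, y)) * f (fst (fst (x, y)), snd (x, y)))
      \<in> borel_measurable (M \<Otimes>\<^sub>M Y)" by simp
  qed
  then show ?thesis by (simp add: opt_def kop_def split_def)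
qed

lemma integral_const_snd:
  fixes h :: "'a \<Rightarrow> real"
  assumes "integrable X h"
  shows "integrable M (\<lambda>p. h (fst p))" "(\<integral>p. h (fst p) \<partial>M) = measure Y (space Y) * (\<integral>x. h x \<partial>X)"
proof -
  have "integrable M (\<lambda>(x,t). h x * 1)" using assms by (intro integrable_prod_mult) auto
  then show *: "integrable M (\<lambda>p. h (fst p))" by (simp add: split_def)
  show "(\<integral>p. h (fst p) \<partial>M) = measure Y (space Y) * (\<integral>x. h x \<partial>X)"
    using integral_fst'[OF *] by simp
qed

text \<open>By Cauchy-Schwarz on each section, the square of the value at \<open>(x,t)\<close> is at
  most a multiple of the squared norm of the section at \<open>x\<close>. This bound does not depend
  on \<open>t\<close>, so integrating it in \<open>t\<close> yields the second factor
  \<open>measure Y (space Y)\<close>.\<close>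

lemma opt_sqi_and_bound:
  assumes k: "kernel Y m c" and f: "f \<in> sqi M"
  shows "opt Y m f \<in> sqi M"
    "inner_L2 M (opt Y m f) (opt Y m f) \<le> (c * measure Y (space Y))\<^sup>2 * inner_L2 M f f"
proof -
  define N where "N x = inner_L2 Y (\<lambda>t. f (x,t)) (\<lambda>t. f (x,t))" for x
  define C where "C = c\<^sup>2 * measure Y (space Y)"
  have N: "integrable X N" "(\<integral>x. N x \<partial>X) = inner_L2 M f f"
    using inner_sections_fst[OF f f] unfolding N_def by auto
  have meas[measurable]: "opt Y m f \<in> borel_measurable M" using k f by (intro opt_measurable) auto
  have "AE p in M. (\<lambda>t. f (fst p,t)) \<in> sqi Y" using sqi_section_fst[OF f] by (rule AE_fst)
  with AE_space have bd: "AE p in M. (opt Y m f p)\<^sup>2 \<le> C * N (fst p)"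
  proof eventually_elim
    case (elim p)
    obtain x t where p: "p = (x,t)" by force
    with elim have t: "t \<in> space Y" and fx: "(\<lambda>t. f (x,t)) \<in> sqi Y" by (auto simp: space_pair_measure)
    have "(opt Y m f p)\<^sup>2 \<le> (c * (\<integral>s. \<bar>f (x,s)\<bar> \<partial>Y))\<^sup>2"
      using Y.abs_kop_le[OF k fx t] by (metis abs_le_square_iff abs_of_nonneg opt_apply order_trans p abs_ge_self)
    also have "\<dots> \<le> c\<^sup>2 * (measure Y (space Y) * N x)"
      using Y.integral_abs_sq_le[OF fx] by (simp add: power_mult_distrib N_def mult_left_mono)
    finally show ?case by (simp add: C_def p mult_ac)
  qed
  have I: "integrable M (\<lambda>p. C * N (fst p))" using integral_const_snd(1)[OF N(1)] by simp
  have I': "integrable M (\<lambda>p. (opt Y m f p)\<^sup>2)"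
  proof (rule Bochner_Integration.integrable_bound[OF I])
    show "AE x in M. norm ((opt Y m f x)\<^sup>2) \<le> norm (C * N (fst x))"
      using bd by eventually_elim (auto intro: order_trans[OF _ abs_ge_self])
  qed measurable
  then show "opt Y m f \<in> sqi M" using meas by (simp add: sqi_def)
  have "inner_L2 M (opt Y m f) (opt Y m f) \<le> (\<integral>p. C * N (fst p) \<partial>M)"
    using integral_mono_AE[OF I' I bd] by (simp add: inner_L2_def power2_eq_square)
  also have "\<dots> = (c * measure Y (space Y))\<^sup>2 * inner_L2 M f f"
    by (simp add: integral_const_snd(2)[OF N(1)] N(2) C_def power2_eq_square)
  finally show "inner_L2 M (opt Y m f) (opt Y m f) \<le> (c * measure Y (space Y))\<^sup>2 * inner_L2 M f f" .
qed

lemmas opt_sqi = opt_sqi_and_bound(1)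
lemmas opt_bound = opt_sqi_and_bound(2)

lemma opt_adjoint:
  assumes k: "kernel Y m c" and f: "f \<in> sqi M" and g: "g \<in> sqi M"
  shows "inner_L2 M (opt Y m f) g = inner_L2 M f (opt Y (\<lambda>s t. m t s) g)"
proof -
  note k' = kernel_transpose[OF k]
  have "AE x in X. inner_L2 Y (\<lambda>t. opt Y m f (x,t)) (\<lambda>t. g (x,t)) = inner_L2 Y (\<lambda>t. f (x,t)) (\<lambda>t. opt Y (\<lambda>s t. m t s) g (x,t))"
    using sqi_section_fst[OF f] sqi_section_fst[OF g]
    by eventually_elim (simp add: opt_apply Y.kop_adjoint[OF k] eta_contract_eq)
  then show ?thesis
    unfolding inner_sections_fst(1)[OF opt_sqi[OF k f] g] inner_sections_fst(1)[OF f opt_sqi[OF k' g]]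
    by (rule integral_cong_AE[rotated 2])
      (use inner_sections_fst(2)[OF opt_sqi[OF k f] g] inner_sections_fst(2)[OF f opt_sqi[OF k' g]] in auto)
qed

text \<open>Almost everywhere only: on a section that is not square integrable the integral may take
  its default value, and additivity can fail. Scalar multiples respect the default value, which is
  why \<open>opt_cmult\<close> is an equality of functions.\<close>

lemma opt_add_AE:
  assumes k: "kernel Y m c" and f: "f \<in> sqi M" and g: "g \<in> sqi M"
  shows "AE p in M. opt Y m (\<lambda>z. f z + g z) p = opt Y m f p + opt Y m g p"
  using AE_fst[OF sqi_section_fst[OF f]] AE_fst[OF sqi_section_fst[OF g]] AE_space
proof eventually_elim
  case (elim p)
  then show ?case by (cases p) (auto simp: opt_apply space_pair_measure Y.kop_add[OF k])
qed

lemma opt_cong_AE: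
  assumes k: "kernel Y m c" and e: "AE p in M. f p = g p" and "f \<in> borel_measurable M" "g \<in> borel_measurable M"
  shows "AE p in M. opt Y m f p = opt Y m g p"
  using AE_fst[OF AE_section_fst[OF e]] AE_space
proof eventually_elim
  case (elim p)
  then show ?case using assms
    by (cases p) (auto simp: opt_apply space_pair_measure intro!: Y.kop_cong_AE[OF k])
qed

end

context finite_pair begin

interpretation S: finite_pair Y X by (rule swap_pair)

lemma opx_eq: "opx X k f = (\<lambda>p. opt X k (\<lambda>p. f (prod.swap p)) (prod.swap p))"
  by (auto simp: opt_swap)

lemma opx_sqi:
  assumes k: "kernel X k c" and f: "f \<in> sqi M"
  shows "opx X k f \<in> sqi M"
  unfolding opx_eq by (intro S.sqi_swap S.opt_sqi[OF k] sqi_swap f)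

lemma opx_bound:
  assumes k: "kernel X k c" and f: "f \<in> sqi M"
  shows "inner_L2 M (opx X k f) (opx X k f) \<le> (c * measure X (space X))\<^sup>2 * inner_L2 M f f"
  using S.opt_bound[OF k sqi_swap[OF f]] unfolding opx_eq
  by (simp add: inner_swap f S.inner_swap S.opt_sqi[OF k] sqi_swap)

lemma opx_adjoint:
  assumes k: "kernel X k c" and f: "f \<in> sqi M" and g: "g \<in> sqi M"
  shows "inner_L2 M (opx X k f) g = inner_L2 M f (opx X (\<lambda>x y. k y x) g)"
proof -
  note k' = kernel_transpose[OF k]
  have "inner_L2 (Y \<Otimes>\<^sub>M X) (\<lambda>p. opx X k f (prod.swap p)) (\<lambda>p. g (prod.swap p)) =
    inner_L2 (Y \<Otimes>\<^sub>M X) (\<lambda>p. f (prod.swap p)) (\<lambda>p. opx X (\<lambda>x y. k y x) g (prod.swap p))"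
    using S.opt_adjoint[OF k sqi_swap[OF f] sqi_swap[OF g]] by (simp add: opx_eq)
  then show ?thesis using f g opx_sqi[OF k f] opx_sqi[OF k' g] by (simp add: inner_swap)
qed

lemma opx_add_AE:
  assumes k: "kernel X k c" and f: "f \<in> sqi M" and g: "g \<in> sqi M"
  shows "AE p in M. opx X k (\<lambda>z. f z + g z) p = opx X k f p + opx X k g p"
  using AE_swap[OF S.opt_add_AE[OF k sqi_swap[OF f] sqi_swap[OF g]]] by (simp add: opx_eq)

lemma opx_cong_AE:
  assumes k: "kernel X k c" and e: "AE p in M. f p = g p" and [measurable]: "f \<in> borel_measurable M" "g \<in> borel_measurable M"
  shows "AE p in M. opx X k f p = opx X k g p"
proof -
  have "AE p in Y \<Otimes>\<^sub>M X. f (prod.swap p) = g (prod.swap p)" by (rule S.AE_swap[OF e])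
  then have "AE p in Y \<Otimes>\<^sub>M X. opt X k (\<lambda>p. f (prod.swap p)) p = opt X k (\<lambda>p. g (prod.swap p)) p"
    by (rule S.opt_cong_AE[OF k]) (simp_all add: prod.swap_def)
  from AE_swap[OF this] show ?thesis by (simp add: opx_eq)
qed

text \<open>Fubini at one fixed point. The hypotheses concern only the kernel sections at this
  \<open>x\<close> and \<open>t\<close>, so that the identity is available outside the rectangle and
  at its boundary as well.\<close>

lemma opx_opt_commute:
  assumes k: "k x \<in> borel_measurable X" "\<And>y. y \<in> space X \<Longrightarrow> \<bar>k x y\<bar> \<le> c"
    and m: "m t \<in> borel_measurable Y" "\<And>s. s \<in> space Y \<Longrightarrow> \<bar>m t s\<bar> \<le> d"
    and f: "f \<in> sqi M"
  shows "opx X k (opt Y m f) (x,t) = opt Y m (opx X k f) (x,t)"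
proof -
  note k(1)[measurable] m(1)[measurable]
  have "integrable M (\<lambda>p. (k x (fst p) * m t (snd p)) * f p)"
  proof (rule M.integrable_bounded_mult[OF f])
    show "\<bar>k x (fst z) * m t (snd z)\<bar> \<le> \<bar>c\<bar> * \<bar>d\<bar>" if "z \<in> space M" for z
    proof -
      have "fst z \<in> space X" "snd z \<in> space Y" using that by (auto simp: space_pair_measure)
      then have "\<bar>k x (fst z)\<bar> \<le> \<bar>c\<bar>" "\<bar>m t (snd z)\<bar> \<le> \<bar>d\<bar>"
        using k(2) m(2) abs_ge_self order_trans by blast+
      then show ?thesis unfolding abs_mult by (intro mult_mono) auto
    qed
  qed measurable
  then have I: "integrable M (\<lambda>(y,s). k x y * m t s * f (y,s))" unfolding split_def by simp
  have "opx X k (opt Y m f) (x,t) = (\<integral>y. (\<integral>s. k x y * m t s * f (y,s) \<partial>Y) \<partial>X)"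
    unfolding opx_apply opt_apply kop_def integral_mult_right_zero[symmetric] mult.assoc ..
  also have "\<dots> = (\<integral>s. (\<integral>y. k x y * m t s * f (y,s) \<partial>X) \<partial>Y)"
    by (rule Fubini_integral[OF I, symmetric])
  also have "\<dots> = (\<integral>s. (\<integral>y. m t s * (k x y * f (y,s)) \<partial>X) \<partial>Y)"
    by (simp add: mult_ac)
  also have "\<dots> = opt Y m (opx X k f) (x,t)"
    by (simp add: opx_def opt_def kop_def)
  finally show ?thesis .
qed

lemma opx_opt_commute_AE:
  assumes "kernel X k c" "kernel Y m d" "f \<in> sqi M"
  shows "AE p in M. opx X k (opt Y m f) p = opt Y m (opx X k f) p"
proof (rule AE_I2)
  fix p assume "p \<in> space M"
  then show "opx X k (opt Y m f) p = opt Y m (opx X k f) p"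
    using assms kernel_section[OF assms(1)] kernel_section[OF assms(2)]
    by (cases p) (auto simp: space_pair_measure kernel_def intro!: opx_opt_commute)
qed

end


subsection \<open>Integration in time\<close>

text \<open>Borel sets, not their completion: the product of two such spaces is then Lebesgue
  measure on the Borel sets of the rectangle, see \<open>pair_ival\<close>.\<close>

definition ival :: "real \<Rightarrow> real \<Rightarrow> real measure" where
  "ival a b = restrict_space lborel {a<..<b}"

lemma space_ival [simp]: "space (ival a b) = {a<..<b}"
  by (simp add: ival_def space_restrict_space)

lemma measurable_ival: "f \<in> borel_measurable borel \<Longrightarrow> f \<in> borel_measurable (ival a b)"
  unfolding ival_def by (intro measurable_restrict_space1) simp

lemma measure_ival: "a \<le> b \<Longrightarrow> measure (ival a b) (space (ival a b)) = b - a"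
  by (simp add: ival_def space_restrict_space measure_restrict_space)

lemma finite_measure_ival: "finite_measure (ival a b)"
  unfolding ival_def by (intro finite_measureI) (use emeasure_bounded_finite[OF bounded_box[of "a::real" b, simplified box_real]] in \<open>auto simp: space_restrict_space emeasure_restrict_space\<close>)

lemma AE_ival_iff: "(AE x in ival a b. P x) \<longleftrightarrow> (AE x in lborel. x \<in> {a<..<b} \<longrightarrow> P x)"
  unfolding ival_def by (subst AE_restrict_space_iff) auto

lemma AE_ival_neq: "AE s in ival a b. s \<noteq> t"
  unfolding AE_ival_iff using AE_lborel_singleton[of t] by eventually_elim auto

lemma measurable_ival_pair:
  "f \<in> borel_measurable borel \<Longrightarrow> f \<in> borel_measurable (ival a b \<Otimes>\<^sub>M ival c d)"
  for f :: "real \<times> real \<Rightarrow> real"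
proof -
  assume f: "f \<in> borel_measurable borel"
  have 1: "(\<lambda>x. x) \<in> borel_measurable (ival a b)" "(\<lambda>x. x) \<in> borel_measurable (ival c d)"
    by (auto intro: measurable_ival)
  have "(\<lambda>p. (fst p, snd p)) \<in> measurable (ival a b \<Otimes>\<^sub>M ival c d) (borel \<Otimes>\<^sub>M borel)"
    using measurable_compose[OF measurable_fst 1(1)] measurable_compose[OF measurable_snd 1(2)]
    by (intro measurable_Pair) auto
  then show ?thesis using measurable_compose[OF _ f] by (simp add: borel_prod)
qed

text \<open>The Volterra kernel: \<open>kop\<close> with it is the primitive that vanishes at the
  left end, and with its transpose \<open>future\<close> the integral up to the right end. It serves
  in time and in space, and also as the cut-off to times before \<open>t\<close>.\<close>

definition past :: "real \<Rightarrow> real \<Rightarrow> real" where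
  "past t s = (if s < t then 1 else 0)"

abbreviation (input) future :: "real \<Rightarrow> real \<Rightarrow> real" where
  "future \<equiv> \<lambda>t s. past s t"

lemma past_bounds: "\<bar>past t s\<bar> \<le> 1" "0 \<le> past t s" "past t s \<le> 1"
  by (auto simp: past_def)

lemma kernel_ival:
  assumes "(\<lambda>(x,y). k x y) \<in> borel_measurable borel" "0 \<le> c"
    "\<And>x y. x \<in> {a<..<b} \<Longrightarrow> y \<in> {a<..<b} \<Longrightarrow> \<bar>k x y\<bar> \<le> c"
  shows "kernel (ival a b) k c"
  using assms by (auto simp: kernel_def intro: measurable_ival_pair)

lemma past_measurable: "(\<lambda>(t,s). past t s) \<in> borel_measurable borel"
proof -
  have "(\<lambda>(t,s). past t s) \<in> borel_measurable (borel \<Otimes>\<^sub>M borel)"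
    unfolding past_def by measurable
  then show ?thesis by (simp add: borel_prod)
qed

lemma kernel_past: "kernel (ival a b) past 1"
  by (intro kernel_ival past_measurable) (auto simp: past_bounds)

lemma kernel_future: "kernel (ival a b) future 1"
  by (rule kernel_transpose[OF kernel_past])

lemma past_section [measurable]: "past t \<in> borel_measurable (ival a b)" "(\<lambda>s. past s t) \<in> borel_measurable (ival a b)"
  unfolding past_def by (auto intro!: measurable_ival)

text \<open>The primitive and its adjoint add up to the rank one operator that sends
  \<open>g\<close> to the constant with value its integral; the inner product is half of that of
  this operator.\<close>

lemma inner_kop_past:
  assumes g: "g \<in> sqi (ival a b)"
  shows "inner_L2 (ival a b) (kop (ival a b) past g) g = (\<integral>x. g x \<partial>ival a b)\<^sup>2 / 2"
proof -
  interpret finite_measure "ival a b" by (rule finite_measure_ival)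
  let ?Y = "ival a b"
  let ?c = "\<integral>x. g x \<partial>?Y"
  have s: "kop ?Y past g t + kop ?Y future g t = ?c" for t
  proof -
    have "kop ?Y past g t + kop ?Y future g t = (\<integral>s. past t s * g s + past s t * g s \<partial>?Y)"
      unfolding kop_def
      by (rule Bochner_Integration.integral_add[symmetric])
        (auto intro!: integrable_bounded_mult[OF g, where c=1] simp: past_bounds)
    also have "\<dots> = ?c"
    proof (rule integral_cong_AE)
      show "AE x in ?Y. past t x * g x + past x t * g x = g x"
        using AE_ival_neq[of t] by eventually_elim (auto simp: past_def)
    qed (use g in measurable)
    finally show ?thesis .
  qed
  have "inner_L2 ?Y (kop ?Y past g) g = inner_L2 ?Y g (kop ?Y future g)"
    by (rule kop_adjoint[OF kernel_past g g])
  then have "2 * inner_L2 ?Y (kop ?Y past g) g = inner_L2 ?Y g (kop ?Y past g) + inner_L2 ?Y g (kop ?Y future g)"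
    by (simp add: inner_L2_commute)
  also have "\<dots> = inner_L2 ?Y g (\<lambda>t. kop ?Y past g t + kop ?Y future g t)"
    by (rule inner_L2_add(2)[symmetric]) (intro kop_sqi[OF kernel_past] kop_sqi[OF kernel_future] g)+
  also have "\<dots> = ?c * ?c"
    by (simp add: s inner_L2_def)
  finally show ?thesis by (simp add: power2_eq_square)
qed

text \<open>Causality: before time \<open>s\<close> the primitive sees only the part of
  \<open>g\<close> before \<open>s\<close>, so the preceding identity applies to the truncated
  function. This replaces the usual integration of the time derivative of a square.\<close>

lemma inner_kop_past_cut:
  assumes g: "g \<in> sqi (ival a b)"
  shows "inner_L2 (ival a b) (kop (ival a b) past g) (\<lambda>t. past s t * g t) = (kop (ival a b) past g s)\<^sup>2 / 2"
proof -
  let ?Y = "ival a b"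
  let ?h = "\<lambda>t. past s t * g t"
  have "past s t * kop ?Y past g t = past s t * kop ?Y past ?h t" for t
    unfolding kop_def past_def by (cases "t < s") (auto intro!: Bochner_Integration.integral_cong)
  then have "inner_L2 ?Y (kop ?Y past g) ?h = inner_L2 ?Y (kop ?Y past ?h) ?h"
    by (auto simp: inner_L2_def mult_ac past_def intro!: Bochner_Integration.integral_cong)
  also have "\<dots> = (\<integral>x. ?h x \<partial>?Y)\<^sup>2 / 2"
    by (intro inner_kop_past sqi_bounded_mult[OF g, where c=1]) (auto simp: past_bounds)
  finally show ?thesis by (simp add: kop_def)
qed

definition mulx :: "('a \<Rightarrow> real) \<Rightarrow> ('a \<times> 'b \<Rightarrow> real) \<Rightarrow> 'a \<times> 'b \<Rightarrow> real" where
  "mulx a f = (\<lambda>z. a (fst z) * f z)"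

definition cut :: "real \<Rightarrow> ('a \<times> real \<Rightarrow> real) \<Rightarrow> 'a \<times> real \<Rightarrow> real" where
  "cut s f = (\<lambda>z. past s (snd z) * f z)"

locale space_time = X: finite_measure X for X :: "'a measure" +
  fixes T :: real
  assumes T_pos: "T > 0"
begin

abbreviation "Y \<equiv> ival 0 T"

sublocale finite_pair X Y
  by (intro finite_pair.intro X.finite_measure_axioms finite_measure_ival)

abbreviation "L \<equiv> opt Y past"
abbreviation "I \<equiv> opt Y future"

lemma L_sqi: "f \<in> sqi M \<Longrightarrow> L f \<in> sqi M" by (rule opt_sqi[OF kernel_past])
lemma I_sqi: "f \<in> sqi M \<Longrightarrow> I f \<in> sqi M" by (rule opt_sqi[OF kernel_future])

lemma measure_Y: "measure Y (space Y) = T"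
  using T_pos measure_ival[of 0 T] by simp

lemma L_bound: "f \<in> sqi M \<Longrightarrow> inner_L2 M (L f) (L f) \<le> T\<^sup>2 * inner_L2 M f f"
  using opt_bound[OF kernel_past] measure_Y by simp

lemma L_adjoint: "f \<in> sqi M \<Longrightarrow> g \<in> sqi M \<Longrightarrow> inner_L2 M (L f) g = inner_L2 M f (I g)"
  by (rule opt_adjoint[OF kernel_past])

lemma L_mulx: "L (mulx a f) = mulx a (L f)"
  by (simp add: mulx_def opt_mult_fst)

lemma opx_cut: "opx X k (cut s f) = cut s (opx X k f)"
  by (simp add: cut_def opx_mult_snd)

lemma mulx_sqi:
  assumes "f \<in> sqi M" "a \<in> borel_measurable X" "\<And>x. x \<in> space X \<Longrightarrow> \<bar>a x\<bar> \<le> c"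
  shows "mulx a f \<in> sqi M"
  unfolding mulx_def using assms
  by (intro sqi_bounded_mult[where c = c]) (auto simp: space_pair_measure)

lemma cut_sqi: "f \<in> sqi M \<Longrightarrow> cut s f \<in> sqi M"
  unfolding cut_def
  by (intro sqi_bounded_mult[where c = 1]) (auto intro!: measurable_compose[OF measurable_snd past_section(1)] simp: past_bounds)

lemma L_section_measurable:
  assumes f: "f \<in> sqi M" shows "(\<lambda>x. L f (x,s)) \<in> borel_measurable X"
proof -
  note [measurable] = measurable_compose[OF measurable_snd past_section(1)] f[THEN sqi_measurable]
  have "(\<lambda>x. \<integral>t. (\<lambda>p. past s (snd p) * f p) (x,t) \<partial>Y) \<in> borel_measurable X" by measurable
  then show ?thesis by (simp add: opt_apply kop_def)
qed

text \<open>The weight depends on \<open>x\<close> alone, so the identity for one section can be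
  integrated in \<open>x\<close>. It holds for every \<open>s\<close>, because \<open>L h\<close>
  has a value at every time.\<close>

lemma inner_L_cut:
  assumes h: "h \<in> sqi M" and a: "a \<in> borel_measurable X" "\<And>x. x \<in> space X \<Longrightarrow> \<bar>a x\<bar> \<le> c"
  shows "inner_L2 M (mulx a (L h)) (cut s h) = (\<integral>x. a x * (L h (x,s))\<^sup>2 \<partial>X) / 2"
    "integrable X (\<lambda>x. a x * (L h (x,s))\<^sup>2)"
proof -
  have m: "mulx a (L h) \<in> sqi M" by (rule mulx_sqi[OF L_sqi[OF h] a])
  let ?f = "\<lambda>x. inner_L2 Y (\<lambda>t. mulx a (L h) (x,t)) (\<lambda>t. cut s h (x,t))"
  note i = inner_sections_fst[OF m cut_sqi[OF h]]
  have [measurable]: "(\<lambda>x. a x * (L h (x,s))\<^sup>2) \<in> borel_measurable X"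
    using L_section_measurable[OF h] a(1) by measurable
  have ae: "AE x in X. ?f x = a x * (L h (x,s))\<^sup>2 / 2"
    using sqi_section_fst[OF h]
    by eventually_elim (simp add: mulx_def cut_def opt_apply inner_L2_cmult inner_kop_past_cut eta_contract_eq)
  have "integrable X (\<lambda>x. a x * (L h (x,s))\<^sup>2 / 2)"
    using integrable_cong_AE[OF _ _ ae] i(2) by simp
  from integrable_mult_right[OF this, of 2] show "integrable X (\<lambda>x. a x * (L h (x,s))\<^sup>2)" by simp
  have "inner_L2 M (mulx a (L h)) (cut s h) = (\<integral>x. a x * (L h (x,s))\<^sup>2 / 2 \<partial>X)"
    unfolding i(1) by (rule integral_cong_AE[OF _ _ ae]) (use i(2) in auto)
  then show "inner_L2 M (mulx a (L h)) (cut s h) = (\<integral>x. a x * (L h (x,s))\<^sup>2 \<partial>X) / 2" by simp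
qed

lemma L_section_sqi: "h \<in> sqi M \<Longrightarrow> (\<lambda>x. L h (x,s)) \<in> sqi X"
  using inner_L_cut(2)[of h "\<lambda>_. 1" 1 s] L_section_measurable by (simp add: sqi_def)

lemma inner_L_cut_ge:
  assumes h: "h \<in> sqi M" and a: "a \<in> borel_measurable X" "\<And>x. x \<in> space X \<Longrightarrow> \<bar>a x\<bar> \<le> c"
    and lo: "\<And>x. x \<in> space X \<Longrightarrow> a0 \<le> a x"
  shows "a0 * inner_L2 X (\<lambda>x. L h (x,s)) (\<lambda>x. L h (x,s)) \<le> 2 * inner_L2 M (mulx a (L h)) (cut s h)"
proof -
  have "(\<integral>x. a0 * (L h (x,s))\<^sup>2 \<partial>X) \<le> (\<integral>x. a x * (L h (x,s))\<^sup>2 \<partial>X)"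
    using inner_L_cut(2)[OF h a] L_section_sqi[OF h] lo
    by (intro integral_mono mult_right_mono) (auto simp: sqi_def)
  then show ?thesis using inner_L_cut(1)[OF h a, of s] by (simp add: inner_L2_def power2_eq_square)
qed

lemma inner_mulx_cut_ge:
  assumes f: "f \<in> sqi M" and a: "a \<in> borel_measurable X" "\<And>x. x \<in> space X \<Longrightarrow> \<bar>a x\<bar> \<le> c"
    and lo: "\<And>x. x \<in> space X \<Longrightarrow> a0 \<le> a x"
  shows "a0 * inner_L2 M (cut s f) (cut s f) \<le> inner_L2 M (mulx a f) (cut s f)"
proof -
  have e: "inner_L2 M (mulx a f) (cut s f) = inner_L2 M (mulx a (cut s f)) (cut s f)"
    unfolding inner_L2_def by (rule Bochner_Integration.integral_cong) (auto simp: mulx_def cut_def past_def)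
  have "inner_L2 M (\<lambda>z. a0 * cut s f z) (cut s f) \<le> inner_L2 M (mulx a (cut s f)) (cut s f)"
    unfolding inner_L2_def
  proof (rule integral_mono)
    show "integrable M (\<lambda>z. a0 * cut s f z * cut s f z)"
      by (intro sqi_integrable_mult sqi_cmult cut_sqi f)
    show "integrable M (\<lambda>z. mulx a (cut s f) z * cut s f z)"
      by (intro sqi_integrable_mult mulx_sqi[OF _ a] cut_sqi f)
    show "a0 * cut s f z * cut s f z \<le> mulx a (cut s f) z * cut s f z" if "z \<in> space M" for z
      using lo[of "fst z"] that mult_right_mono[of a0 "a (fst z)" "(cut s f z)\<^sup>2"]
      by (auto simp: mulx_def space_pair_measure mult.assoc power2_eq_square)
  qed
  then show ?thesis unfolding e by (simp add: inner_L2_cmult)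
qed

end


subsection \<open>The integrated weak form\<close>

text \<open>Kept abstract in the space variable: \<open>K\<close> and \<open>K'\<close> stand for
  the operators that recover \<open>u\<close> and its derivative from the second derivative, and
  \<open>D\<close> bounds the operator norm of \<open>K\<close>. The estimates rest on bounded
  kernels, adjoints and Fubini.\<close>

locale beam = space_time +
  fixes K K' :: "'a \<Rightarrow> 'a \<Rightarrow> real" and cK cK' D :: real
    and \<rho> \<mu> Tr r \<kappa> :: "'a \<Rightarrow> real" and \<rho>0 \<rho>1 \<mu>1 Tr1 r0 r1 \<kappa>0 \<kappa>1 :: real
  assumes kerK: "kernel X K cK" and kerK': "kernel X K' cK'"
    and D: "D = cK * measure X (space X)"
    and meas: "\<rho> \<in> borel_measurable X" "\<mu> \<in> borel_measurable X" "Tr \<in> borel_measurable X"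
      "r \<in> borel_measurable X" "\<kappa> \<in> borel_measurable X"
    and pos: "0 < \<rho>0" "0 < r0" "0 < \<kappa>0"
    and rho: "\<And>x. x \<in> space X \<Longrightarrow> \<rho>0 \<le> \<rho> x" "\<And>x. x \<in> space X \<Longrightarrow> \<rho> x \<le> \<rho>1"
    and mu: "\<And>x. x \<in> space X \<Longrightarrow> 0 \<le> \<mu> x" "\<And>x. x \<in> space X \<Longrightarrow> \<mu> x \<le> \<mu>1"
    and Tr: "\<And>x. x \<in> space X \<Longrightarrow> 0 \<le> Tr x" "\<And>x. x \<in> space X \<Longrightarrow> Tr x \<le> Tr1"
    and r: "\<And>x. x \<in> space X \<Longrightarrow> r0 \<le> r x" "\<And>x. x \<in> space X \<Longrightarrow> r x \<le> r1"
    and kappa: "\<And>x. x \<in> space X \<Longrightarrow> \<kappa>0 \<le> \<kappa> x" "\<And>x. x \<in> space X \<Longrightarrow> \<kappa> x \<le> \<kappa>1"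
begin

lemma coef_bounds:
  "x \<in> space X \<Longrightarrow> \<bar>\<rho> x\<bar> \<le> \<rho>1" "x \<in> space X \<Longrightarrow> \<bar>\<mu> x\<bar> \<le> \<mu>1" "x \<in> space X \<Longrightarrow> \<bar>Tr x\<bar> \<le> Tr1"
  "x \<in> space X \<Longrightarrow> \<bar>r x\<bar> \<le> r1" "x \<in> space X \<Longrightarrow> \<bar>\<kappa> x\<bar> \<le> \<kappa>1"
  using rho[of x] mu[of x] Tr[of x] r[of x] kappa[of x] pos by auto

lemmas coef_sqi =
  mulx_sqi[OF _ meas(1) coef_bounds(1)] mulx_sqi[OF _ meas(2) coef_bounds(2)]
  mulx_sqi[OF _ meas(3) coef_bounds(3)] mulx_sqi[OF _ meas(4) coef_bounds(4)]
  mulx_sqi[OF _ meas(5) coef_bounds(5)]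

abbreviation "k \<equiv> opx X K"
abbreviation "k' \<equiv> opx X K'"

lemmas K_sqi = opx_sqi[OF kerK]
lemmas K'_sqi = opx_sqi[OF kerK']

lemmas sqi_rules = coef_sqi K_sqi K'_sqi L_sqi I_sqi cut_sqi sqi_add sqi_diff sqi_cmult sqi_uminus

text \<open>What the weak form becomes for a test function whose second space derivative is
  \<open>I g\<close>, after all time integrals have been moved to the solution. \<open>fi\<close> is
  a separate argument because it is \<open>L f\<close> in the forward and \<open>I f\<close> in the
  adjoint problem.\<close>

definition form :: "('a \<times> real \<Rightarrow> real) \<Rightarrow> ('a \<times> real \<Rightarrow> real) \<Rightarrow> ('a \<times> real \<Rightarrow> real) \<Rightarrow> ('a \<times> real \<Rightarrow> real) \<Rightarrow> real" where
  "form f fi ut g = inner_L2 M (mulx \<rho> ut) (k g) + inner_L2 M (mulx \<mu> (k f)) (k g)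
     + inner_L2 M (mulx Tr (k' fi)) (k' g) + inner_L2 M (mulx r fi) g + inner_L2 M (mulx \<kappa> f) g"

text \<open>\<open>k f = L ut\<close> says at once that \<open>ut\<close> is the time derivative of
  \<open>u = k f\<close> and that \<open>u\<close> vanishes at time 0.\<close>

definition solves :: "('a \<times> real \<Rightarrow> real) \<Rightarrow> ('a \<times> real \<Rightarrow> real) \<Rightarrow> ('a \<times> real \<Rightarrow> real) \<Rightarrow> bool" where
  "solves F f ut \<longleftrightarrow> F \<in> sqi M \<and> f \<in> sqi M \<and> ut \<in> sqi M \<and> (AE p in M. k f p = L ut p) \<and>
     (\<forall>g\<in>sqi M. form f (L f) ut g = inner_L2 M (L F) (k g))"

lemma mulx_cong_AE: "AE p in M. f p = g p \<Longrightarrow> AE p in M. mulx a f p = mulx a g p"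
  by (auto simp: mulx_def)

lemma inner_mulx_nonneg:
  assumes "\<And>x. x \<in> space X \<Longrightarrow> 0 \<le> a x"
  shows "0 \<le> inner_L2 M (mulx a f) (cut s f)"
  unfolding inner_L2_def
proof (rule integral_nonneg_AE, rule AE_I2)
  fix p assume "p \<in> space M"
  then have "0 \<le> a (fst p)" using assms by (auto simp: space_pair_measure)
  then have "0 \<le> a (fst p) * (past s (snd p) * (f p * f p))" by (simp add: past_bounds)
  then show "0 \<le> mulx a f p * cut s f p" by (simp add: mulx_def cut_def mult_ac)
qed

lemma commute_AE:
  assumes f: "f \<in> sqi M"
  shows "AE p in M. k (L f) p = L (k f) p" "AE p in M. k' (L f) p = L (k' f) p"
    "AE p in M. k (I f) p = I (k f) p" "AE p in M. k' (I f) p = I (k' f) p"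
  using opx_opt_commute_AE[OF kerK kernel_past f] opx_opt_commute_AE[OF kerK' kernel_past f]
    opx_opt_commute_AE[OF kerK kernel_future f] opx_opt_commute_AE[OF kerK' kernel_future f]
  by auto

text \<open>Test with \<open>g = f\<close> on \<open>(0,s)\<close>: no time derivative of \<open>f\<close> is needed.\<close>

lemma energy:
  assumes S: "solves F f ut"
  shows "\<rho>0 * inner_L2 X (\<lambda>x. L ut (x,s)) (\<lambda>x. L ut (x,s)) + r0 * inner_L2 X (\<lambda>x. L f (x,s)) (\<lambda>x. L f (x,s))
    + 2 * \<kappa>0 * inner_L2 M (cut s f) (cut s f) \<le> 2 * inner_L2 M (L F) (cut s (k f))"
proof -
  have sq: "F \<in> sqi M" "f \<in> sqi M" "ut \<in> sqi M" and e: "AE p in M. k f p = L ut p"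
    using S by (auto simp: solves_def)
  note [intro] = sq
  have kc: "k (cut s f) = cut s (k f)" "k' (cut s f) = cut s (k' f)"
    by (rule opx_cut)+
  \<comment> \<open>As \<open>k f = L ut\<close>, the inertia term pairs \<open>ut\<close> with its
    own primitive, which is the situation of \<open>inner_L_cut_ge\<close>.\<close>
  have 1: "inner_L2 M (mulx \<rho> ut) (k (cut s f)) = inner_L2 M (mulx \<rho> (L ut)) (cut s ut)"
  proof -
    have "inner_L2 M (mulx \<rho> ut) (k (cut s f)) = inner_L2 M (mulx \<rho> ut) (cut s (L ut))"
      unfolding kc using e
      by (intro inner_L2_cong_AE sqi_measurable sqi_rules sq) (auto simp: cut_def)
    also have "\<dots> = inner_L2 M (mulx \<rho> (L ut)) (cut s ut)"
      by (auto simp: inner_L2_def mulx_def cut_def intro!: Bochner_Integration.integral_cong)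
    finally show ?thesis .
  qed
  have 3: "inner_L2 M (mulx Tr (k' (L f))) (k' (cut s f)) = inner_L2 M (mulx Tr (L (k' f))) (cut s (k' f))"
    unfolding kc using commute_AE(2)[OF sq(2)]
    by (intro inner_L2_cong_AE sqi_measurable sqi_rules sq) (auto simp: mulx_def)
  have "form f (L f) ut (cut s f) = inner_L2 M (L F) (k (cut s f))"
    using S cut_sqi[OF sq(2)] by (auto simp: solves_def)
  then have eq: "inner_L2 M (mulx \<rho> (L ut)) (cut s ut) + inner_L2 M (mulx \<mu> (k f)) (cut s (k f))
    + inner_L2 M (mulx Tr (L (k' f))) (cut s (k' f)) + inner_L2 M (mulx r (L f)) (cut s f)
    + inner_L2 M (mulx \<kappa> f) (cut s f) = inner_L2 M (L F) (cut s (k f))"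
    unfolding form_def 1 3 by (simp add: kc)
  have "\<rho>0 * inner_L2 X (\<lambda>x. L ut (x,s)) (\<lambda>x. L ut (x,s)) \<le> 2 * inner_L2 M (mulx \<rho> (L ut)) (cut s ut)"
    by (rule inner_L_cut_ge[OF sq(3) meas(1) coef_bounds(1) rho(1)])
  moreover have "0 \<le> inner_L2 M (mulx \<mu> (k f)) (cut s (k f))"
    by (rule inner_mulx_nonneg) (rule mu)
  moreover have "0 \<le> inner_L2 M (mulx Tr (L (k' f))) (cut s (k' f))"
    using inner_L_cut_ge[OF K'_sqi[OF sq(2)] meas(3) coef_bounds(3) Tr(1), of s] by simp
  moreover have "r0 * inner_L2 X (\<lambda>x. L f (x,s)) (\<lambda>x. L f (x,s)) \<le> 2 * inner_L2 M (mulx r (L f)) (cut s f)"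
    by (rule inner_L_cut_ge[OF sq(2) meas(4) coef_bounds(4) r(1)])
  moreover have "\<kappa>0 * inner_L2 M (cut s f) (cut s f) \<le> inner_L2 M (mulx \<kappa> f) (cut s f)"
    by (rule inner_mulx_cut_ge[OF sq(2) meas(5) coef_bounds(5) kappa(1)])
  ultimately show ?thesis using eq by linarith
qed

lemma cut_mono: "f \<in> sqi M \<Longrightarrow> inner_L2 M (cut s f) (cut s f) \<le> inner_L2 M f f"
  by (intro inner_L2_mono_abs sqi_rules AE_I2) (auto simp: cut_def past_def)

lemma inner_Y_average:
  assumes h: "h \<in> sqi M" and b: "\<And>s. inner_L2 X (\<lambda>x. L h (x,s)) (\<lambda>x. L h (x,s)) \<le> b"
  shows "inner_L2 M (L h) (L h) \<le> T * b"
proof -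
  interpret Yf: finite_measure Y by (rule finite_measure_ival)
  have "inner_L2 M (L h) (L h) \<le> (\<integral>s. b \<partial>Y)"
    unfolding inner_sections_snd(1)[OF L_sqi L_sqi, OF h h]
    by (intro integral_mono inner_sections_snd(2) L_sqi h b) auto
  then show ?thesis using measure_Y by simp
qed

lemma D_nonneg: "0 \<le> D"
  using kerK by (simp add: D kernel_def)

lemma norm_k_le: "f \<in> sqi M \<Longrightarrow> sqrt (inner_L2 M (k f) (k f)) \<le> D * sqrt (inner_L2 M f f)"
  using real_sqrt_le_mono[OF opx_bound[OF kerK]] D_nonneg by (simp add: real_sqrt_mult D)

text \<open>For the first bound the inertia term controls \<open>k f\<close>, which equals
  \<open>L ut\<close>, by \<open>L F\<close>; this is inserted into the right-hand side before the
  term with \<open>r0\<close> is read off. For the second, \<open>k f\<close> is bounded by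
  \<open>D\<close> times \<open>f\<close> and absorbed in the damping. The factor \<open>T\<close>
  comes from integrating the estimate at time \<open>s\<close> over all \<open>s\<close>.\<close>

lemma energy_bound:
  assumes S: "solves F f ut"
  shows "r0 * inner_L2 M (L f) (L f) \<le> 4 * T\<^sup>2 / \<rho>0 * inner_L2 M (L F) (L F)"
    and "r0 * inner_L2 M (L f) (L f) \<le> T * D\<^sup>2 / (2 * \<kappa>0) * inner_L2 M (L F) (L F)"
proof -
  have sq: "F \<in> sqi M" "f \<in> sqi M" "ut \<in> sqi M" and e: "AE p in M. k f p = L ut p"
    using S by (auto simp: solves_def)
  define A where "A = sqrt (inner_L2 M (L F) (L F))"
  define U where "U = sqrt (inner_L2 M (k f) (k f))"
  have A: "A \<ge> 0" "A * A = inner_L2 M (L F) (L F)" and U: "U \<ge> 0" "U * U = inner_L2 M (k f) (k f)"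
    by (auto simp: A_def U_def inner_L2_nonneg)
  have UL: "inner_L2 M (L ut) (L ut) = U * U"
    unfolding U(2) using e by (intro inner_L2_cong_AE sqi_measurable sqi_rules sq) auto
  have q: "0 \<le> inner_L2 X g g" "0 \<le> inner_L2 M h h" for g h by (rule inner_L2_nonneg)+
  have c1: "inner_L2 M (L F) (cut s (k f)) \<le> A * sqrt (inner_L2 M (cut s (k f)) (cut s (k f)))" for s
    using Cauchy_Schwarz_L2[of "L F" M "cut s (k f)"] sqi_rules sq unfolding A_def by fastforce
  also have c2: "A * sqrt (inner_L2 M (cut s (k f)) (cut s (k f))) \<le> A * U" for s
    using cut_mono[OF K_sqi[OF sq(2)], of s] A(1) by (auto simp: U_def intro!: mult_left_mono)
  finally have c3: "inner_L2 M (L F) (cut s (k f)) \<le> A * U" for s .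
  have b1: "inner_L2 X (\<lambda>x. L ut (x,s)) (\<lambda>x. L ut (x,s)) \<le> 2 * A * U / \<rho>0" for s
  proof -
    have "\<rho>0 * inner_L2 X (\<lambda>x. L ut (x,s)) (\<lambda>x. L ut (x,s)) \<le> 2 * (A * U)"
      using energy[OF S, of s] c3[of s] mult_nonneg_nonneg[OF less_imp_le[OF pos(2)] q(1)[of "\<lambda>x. L f (x,s)"]]
        mult_nonneg_nonneg[OF less_imp_le[OF pos(3)] q(2)[of "cut s f"]] by linarith
    then show ?thesis using pos by (simp add: field_simps)
  qed
  \<comment> \<open>The norm of \<open>L ut\<close> is \<open>U\<close> itself, so the estimate is
    quadratic in \<open>U\<close> on the left and linear on the right, and one factor
    \<open>U\<close> cancels.\<close>
  have "U * U \<le> T * (2 * A * U / \<rho>0)"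
    using inner_Y_average[OF sq(3) b1] UL by simp
  then have U': "U \<le> T * (2 * A / \<rho>0)"
    using U(1) A(1) T_pos pos by (cases "U = 0") (auto simp: field_simps)
  have b2: "inner_L2 X (\<lambda>x. L f (x,s)) (\<lambda>x. L f (x,s)) \<le> 2 * A * U / r0" for s
  proof -
    have "r0 * inner_L2 X (\<lambda>x. L f (x,s)) (\<lambda>x. L f (x,s)) \<le> 2 * (A * U)"
      using energy[OF S, of s] c3[of s] mult_nonneg_nonneg[OF less_imp_le[OF pos(1)] q(1)[of "\<lambda>x. L ut (x,s)"]]
        mult_nonneg_nonneg[OF less_imp_le[OF pos(3)] q(2)[of "cut s f"]] by linarith
    then show ?thesis using pos by (simp add: field_simps)
  qed
  have "r0 * inner_L2 M (L f) (L f) \<le> r0 * (T * (2 * A * U / r0))"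
    using inner_Y_average[OF sq(2) b2] pos by (intro mult_left_mono) auto
  also have "\<dots> = 2 * T * A * U" using pos by simp
  also have "\<dots> \<le> 2 * T * A * (T * (2 * A / \<rho>0))" using U' T_pos A(1) by (intro mult_left_mono) auto
  finally show "r0 * inner_L2 M (L f) (L f) \<le> 4 * T\<^sup>2 / \<rho>0 * inner_L2 M (L F) (L F)"
    by (simp add: power2_eq_square flip: A(2)) (simp add: mult_ac)
  have b3: "inner_L2 X (\<lambda>x. L f (x,s)) (\<lambda>x. L f (x,s)) \<le> A\<^sup>2 * D\<^sup>2 / (2 * \<kappa>0) / r0" for s
  proof -
    define Q where "Q = sqrt (inner_L2 M (cut s f) (cut s f))"
    have Q: "Q * Q = inner_L2 M (cut s f) (cut s f)" by (simp add: Q_def q)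
    have "A * sqrt (inner_L2 M (cut s (k f)) (cut s (k f))) \<le> A * (D * Q)"
      using norm_k_le[OF cut_sqi[OF sq(2)], of s] A(1) by (simp add: opx_cut Q_def mult_left_mono)
    then have "inner_L2 M (L F) (cut s (k f)) \<le> A * (D * Q)" using c1[of s] by linarith
    then have "r0 * inner_L2 X (\<lambda>x. L f (x,s)) (\<lambda>x. L f (x,s)) + 2 * \<kappa>0 * (Q * Q) \<le> 2 * (A * (D * Q))"
      using energy[OF S, of s] mult_nonneg_nonneg[OF less_imp_le[OF pos(1)] q(1)[of "\<lambda>x. L ut (x,s)"]]
      unfolding Q by linarith
    \<comment> \<open>Young's inequality with the weight for which the term in \<open>Q * Q\<close>
      is exactly the damping term on the left.\<close>
    moreover have "2 * (A * (D * Q)) \<le> 2 * \<kappa>0 * (Q * Q) + A\<^sup>2 * D\<^sup>2 / (2 * \<kappa>0)"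
    proof -
      have "0 \<le> (2 * \<kappa>0 * Q - A * D)\<^sup>2 / (2 * \<kappa>0)" using pos by simp
      also have "\<dots> = 2 * \<kappa>0 * (Q * Q) + A\<^sup>2 * D\<^sup>2 / (2 * \<kappa>0) - 2 * (A * (D * Q))"
        using pos by (simp add: power2_eq_square field_simps)
      finally show ?thesis by simp
    qed
    ultimately have "r0 * inner_L2 X (\<lambda>x. L f (x,s)) (\<lambda>x. L f (x,s)) \<le> A\<^sup>2 * D\<^sup>2 / (2 * \<kappa>0)"
      by linarith
    then show ?thesis unfolding pos_le_divide_eq[OF pos(2)] by (simp only: mult.commute)
  qed
  have "r0 * inner_L2 M (L f) (L f) \<le> r0 * (T * (A\<^sup>2 * D\<^sup>2 / (2 * \<kappa>0) / r0))"
    using inner_Y_average[OF sq(2) b3] pos by (intro mult_left_mono) auto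
  also have "\<dots> = T * D\<^sup>2 / (2 * \<kappa>0) * A\<^sup>2" using pos by simp
  finally show "r0 * inner_L2 M (L f) (L f) \<le> T * D\<^sup>2 / (2 * \<kappa>0) * inner_L2 M (L F) (L F)"
    by (simp add: A(2) power2_eq_square[of A])
qed

text \<open>Takes the energy inequality at the final time and keeps only the damping term. Unlike
  \<open>energy_bound\<close> it bounds \<open>f\<close> itself by \<open>F\<close>; its constant is
  too large for the theorem, but it makes approximating solutions converge.\<close>

lemma basic_bound:
  assumes S: "solves F f ut"
  shows "inner_L2 M f f \<le> (T * D / \<kappa>0)\<^sup>2 * inner_L2 M F F"
proof -
  have sq: "F \<in> sqi M" "f \<in> sqi M" "ut \<in> sqi M"
    using S by (auto simp: solves_def)
  define A where "A = sqrt (inner_L2 M F F)"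
  define Q where "Q = sqrt (inner_L2 M f f)"
  have A: "A \<ge> 0" "A * A = inner_L2 M F F" and Q: "Q \<ge> 0" "Q * Q = inner_L2 M f f"
    by (auto simp: A_def Q_def inner_L2_nonneg)
  \<comment> \<open>The cut-off at time \<open>T\<close> is the identity on the rectangle.\<close>
  have c: "inner_L2 M (cut T h) (cut T g) = inner_L2 M h g" "inner_L2 M h (cut T g) = inner_L2 M h g" "inner_L2 M (cut T h) g = inner_L2 M h g" for h g
    by (auto simp: inner_L2_def cut_def past_def space_pair_measure intro!: Bochner_Integration.integral_cong)
  have q: "0 \<le> inner_L2 X g g" for g by (rule inner_L2_nonneg)
  have "sqrt (inner_L2 M (L F) (L F)) \<le> T * A"
    using real_sqrt_le_mono[OF L_bound[OF sq(1)]] T_pos by (simp add: real_sqrt_mult A_def)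
  moreover have "sqrt (inner_L2 M (k f) (k f)) \<le> D * Q"
    using norm_k_le[OF sq(2)] by (simp add: Q_def)
  ultimately have "sqrt (inner_L2 M (L F) (L F)) * sqrt (inner_L2 M (k f) (k f)) \<le> (T * A) * (D * Q)"
    using T_pos A by (intro mult_mono) (auto simp: inner_L2_nonneg)
  moreover have "inner_L2 M (L F) (k f) \<le> sqrt (inner_L2 M (L F) (L F)) * sqrt (inner_L2 M (k f) (k f))"
    using Cauchy_Schwarz_L2[OF L_sqi[OF sq(1)] K_sqi[OF sq(2)]] by linarith
  moreover have "2 * \<kappa>0 * (Q * Q) \<le> 2 * inner_L2 M (L F) (k f)"
    using energy[OF S, of T] mult_nonneg_nonneg[OF less_imp_le[OF pos(1)] q[of "\<lambda>x. L ut (x,T)"]]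
      mult_nonneg_nonneg[OF less_imp_le[OF pos(2)] q[of "\<lambda>x. L f (x,T)"]]
    unfolding c Q by linarith
  ultimately have "\<kappa>0 * (Q * Q) \<le> (T * A) * (D * Q)" by linarith
  then have "Q \<le> T * D / \<kappa>0 * A"
    using Q(1) A(1) T_pos pos D_nonneg by (cases "Q = 0") (auto simp: field_simps)
  then have "Q * Q \<le> (T * D / \<kappa>0 * A) * (T * D / \<kappa>0 * A)"
    using Q(1) by (intro mult_mono) auto
  then show ?thesis unfolding A(2)[symmetric] Q(2)[symmetric] by (simp add: power2_eq_square mult_ac)
qed

text \<open>\<open>I\<close> commutes with the operators in \<open>x\<close> and with coefficients
  independent of time, and its adjoint is \<open>L\<close>.\<close>

lemma inner_k_I:
  assumes "A \<in> sqi M" "g \<in> sqi M" and a: "a \<in> borel_measurable X" "\<And>x. x \<in> space X \<Longrightarrow> \<bar>a x\<bar> \<le> c"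
  shows "inner_L2 M (mulx a A) (k (I g)) = inner_L2 M (mulx a (L A)) (k g)"
    "inner_L2 M (mulx a A) (k' (I g)) = inner_L2 M (mulx a (L A)) (k' g)"
    "inner_L2 M (mulx a A) (I g) = inner_L2 M (mulx a (L A)) g"
proof -
  note m = mulx_sqi[OF assms(1) a]
  have "inner_L2 M (mulx a A) (k (I g)) = inner_L2 M (mulx a A) (I (k g))"
    by (intro inner_L2_cong_AE commute_AE assms) (auto intro!: sqi_measurable m sqi_rules assms)
  then show "inner_L2 M (mulx a A) (k (I g)) = inner_L2 M (mulx a (L A)) (k g)"
    using L_adjoint[OF m K_sqi[OF assms(2)]] by (simp add: L_mulx)
  have "inner_L2 M (mulx a A) (k' (I g)) = inner_L2 M (mulx a A) (I (k' g))"
    by (intro inner_L2_cong_AE commute_AE assms) (auto intro!: sqi_measurable m sqi_rules assms)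
  then show "inner_L2 M (mulx a A) (k' (I g)) = inner_L2 M (mulx a (L A)) (k' g)"
    using L_adjoint[OF m K'_sqi[OF assms(2)]] by (simp add: L_mulx)
  show "inner_L2 M (mulx a A) (I g) = inner_L2 M (mulx a (L A)) g"
    using L_adjoint[OF m assms(2)] by (simp add: L_mulx)
qed

lemma mulx_1: "mulx (\<lambda>_. 1) f = f"
  by (simp add: mulx_def)

text \<open>Testing with \<open>I g\<close> puts one more \<open>L\<close> on the solution and on
  the load, because no coefficient depends on time.\<close>

lemma solves_L:
  assumes S: "solves F f ut"
  shows "solves (L F) (L f) (L ut)"
proof -
  have sq: "F \<in> sqi M" "f \<in> sqi M" "ut \<in> sqi M" and e: "AE p in M. k f p = L ut p"
    using S by (auto simp: solves_def)
  have e1: "AE p in M. L (k f) p = L (L ut) p"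
    by (rule opt_cong_AE[OF kernel_past e]) (auto intro!: sqi_measurable sqi_rules sq)
  then have e': "AE p in M. k (L f) p = L (L ut) p"
    using commute_AE(1)[OF sq(2)] by eventually_elim simp
  have "form (L f) (L (L f)) (L ut) g = inner_L2 M (L (L F)) (k g)" if g: "g \<in> sqi M" for g
  proof -
    note K2 = inner_k_I[OF _ g]
    have "form f (L f) ut (I g) = inner_L2 M (L F) (k (I g))"
      using S I_sqi[OF g] by (auto simp: solves_def)
    moreover have "inner_L2 M (L F) (k (I g)) = inner_L2 M (L (L F)) (k g)"
      using K2(1)[OF L_sqi[OF sq(1)], of "\<lambda>_. 1" 1] by (simp add: mulx_1)
    moreover have "form f (L f) ut (I g) = form (L f) (L (L f)) (L ut) g"
    proof -
      have 1: "inner_L2 M (mulx \<mu> (L (k f))) (k g) = inner_L2 M (mulx \<mu> (k (L f))) (k g)"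
        by (intro inner_L2_cong_AE mulx_cong_AE sqi_measurable sqi_rules sq g)
          (use commute_AE(1)[OF sq(2)] in auto)
      have 2: "inner_L2 M (mulx Tr (L (k' (L f)))) (k' g) = inner_L2 M (mulx Tr (k' (L (L f)))) (k' g)"
        by (intro inner_L2_cong_AE mulx_cong_AE sqi_measurable sqi_rules sq g)
          (use commute_AE(2)[OF L_sqi[OF sq(2)]] in auto)
      show ?thesis unfolding form_def
        by (simp add: K2(1)[OF _ meas(1) coef_bounds(1)] K2(1)[OF _ meas(2) coef_bounds(2)]
          K2(2)[OF _ meas(3) coef_bounds(3)] K2(3)[OF _ meas(4) coef_bounds(4)]
          K2(3)[OF _ meas(5) coef_bounds(5)] sq sqi_rules 1 2)
    qed
    ultimately show ?thesis by simp
  qed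
  with e' show ?thesis by (auto simp: solves_def intro!: sqi_rules sq)
qed

end


section \<open>Superposition and duality\<close>

context beam begin

lemma opx_lincomb_AE:
  assumes "kernel X q c" "f \<in> sqi M" "g \<in> sqi M"
  shows "AE p in M. opx X q (\<lambda>z. f z + a * g z) p = opx X q f p + a * opx X q g p"
  using opx_add_AE[OF assms(1,2) sqi_cmult[OF assms(3)]] by (simp add: opx_cmult)

lemma L_lincomb_AE:
  assumes "f \<in> sqi M" "g \<in> sqi M"
  shows "AE p in M. L (\<lambda>z. f z + a * g z) p = L f p + a * L g p"
  using opt_add_AE[OF kernel_past assms(1) sqi_cmult[OF assms(2)]] by (simp add: opt_cmult)

lemma inner_lincomb_AE:
  assumes "AE p in M. h p = f p + a * g p" "f \<in> sqi M" "g \<in> sqi M" "h \<in> sqi M" "w \<in> sqi M"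
  shows "inner_L2 M h w = inner_L2 M f w + a * inner_L2 M g w"
proof -
  have "inner_L2 M h w = inner_L2 M (\<lambda>p. f p + a * g p) w"
    by (intro inner_L2_cong_AE assms) (auto intro!: sqi_measurable sqi_rules assms)
  then show ?thesis by (simp add: inner_L2_add inner_L2_cmult assms sqi_rules)
qed

lemma k_eq_lincomb:
  assumes e: "AE p in M. h p = f p + a * g p" "f \<in> sqi M" "g \<in> sqi M" "h \<in> sqi M" and q: "kernel X q c"
  shows "AE p in M. opx X q h p = opx X q f p + a * opx X q g p"
proof -
  have "AE p in M. opx X q h p = opx X q (\<lambda>z. f z + a * g z) p"
    by (rule opx_cong_AE[OF q e(1)]) (auto intro!: sqi_measurable sqi_rules e)
  with opx_lincomb_AE[OF q e(2,3), of a] show ?thesis by eventually_elim simp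
qed

lemma form_lincomb:
  assumes e: "AE p in M. f p = f1 p + a * f2 p" "AE p in M. fi p = fi1 p + a * fi2 p"
    "AE p in M. ut p = ut1 p + a * ut2 p"
    and sq: "f \<in> sqi M" "f1 \<in> sqi M" "f2 \<in> sqi M" "fi \<in> sqi M" "fi1 \<in> sqi M" "fi2 \<in> sqi M"
    "ut \<in> sqi M" "ut1 \<in> sqi M" "ut2 \<in> sqi M" "g \<in> sqi M"
  shows "form f fi ut g = form f1 fi1 ut1 g + a * form f2 fi2 ut2 g"
proof -
  have kf: "AE p in M. k f p = k f1 p + a * k f2 p" and k'f: "AE p in M. k' fi p = k' fi1 p + a * k' fi2 p"
    by (intro k_eq_lincomb[OF _ _ _ _ kerK] k_eq_lincomb[OF _ _ _ _ kerK'] e sq)+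
  have m: "AE p in M. mulx b h p = mulx b h1 p + a * mulx b h2 p" if "AE p in M. h p = h1 p + a * h2 p" for b h h1 h2
    using that by (auto simp: mulx_def algebra_simps)
  show ?thesis
    unfolding form_def using sq
    by (simp add: inner_lincomb_AE[OF m[OF e(3)]] inner_lincomb_AE[OF m[OF kf]] inner_lincomb_AE[OF m[OF k'f]]
      inner_lincomb_AE[OF m[OF e(2)]] inner_lincomb_AE[OF m[OF e(1)]] sqi_rules algebra_simps)
qed

lemma solves_lincomb:
  assumes "solves F f ut" "solves G g vt"
  shows "solves (\<lambda>z. F z + a * G z) (\<lambda>z. f z + a * g z) (\<lambda>z. ut z + a * vt z)"
proof -
  have sq: "F \<in> sqi M" "f \<in> sqi M" "ut \<in> sqi M" "G \<in> sqi M" "g \<in> sqi M" "vt \<in> sqi M"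
    and e: "AE p in M. k f p = L ut p" "AE p in M. k g p = L vt p"
    using assms by (auto simp: solves_def)
  have "AE p in M. k (\<lambda>z. f z + a * g z) p = L (\<lambda>z. ut z + a * vt z) p"
    using e opx_lincomb_AE[OF kerK sq(2,5), of a] L_lincomb_AE[OF sq(3,6), of a]
    by eventually_elim simp
  moreover have "form (\<lambda>z. f z + a * g z) (L (\<lambda>z. f z + a * g z)) (\<lambda>z. ut z + a * vt z) h
      = inner_L2 M (L (\<lambda>z. F z + a * G z)) (k h)" if h: "h \<in> sqi M" for h
  proof -
    have "form (\<lambda>z. f z + a * g z) (L (\<lambda>z. f z + a * g z)) (\<lambda>z. ut z + a * vt z) h
      = form f (L f) ut h + a * form g (L g) vt h"
      by (rule form_lincomb) (auto intro!: L_lincomb_AE sqi_rules sq h)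
    also have "\<dots> = inner_L2 M (L F) (k h) + a * inner_L2 M (L G) (k h)"
      using assms h by (auto simp: solves_def)
    also have "\<dots> = inner_L2 M (L (\<lambda>z. F z + a * G z)) (k h)"
      by (intro inner_lincomb_AE[symmetric] L_lincomb_AE sqi_rules sq h)
    finally show ?thesis .
  qed
  ultimately show ?thesis using sq by (auto simp: solves_def intro!: sqi_rules)
qed

text \<open>\<open>n0\<close> and \<open>nl\<close> are the kernels of the boundary slopes, and
  \<open>p\<close>, \<open>q\<close> are boundary data regarded as functions on the product.
  \<omega> is minus the time derivative of the adjoint solution, so that
  \<open>k \<psi> = I \<omega>\<close> contains the final condition.\<close>

definition adjoint_solves where
  "adjoint_solves n0 nl p q \<psi> \<omega> \<longleftrightarrow> p \<in> sqi M \<and> q \<in> sqi M \<and> \<psi> \<in> sqi M \<and> \<omega> \<in> sqi M \<and> (AE z in M. k \<psi> z = I \<omega> z) \<and>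
     (\<forall>g\<in>sqi M. form \<psi> (I \<psi>) \<omega> g = inner_L2 M (I p) (opx X n0 g) + inner_L2 M (I q) (opx X nl g))"

text \<open>Exchanging \<open>L\<close> with \<open>I\<close> and solution with test function turns
  \<open>form\<close> for one problem into \<open>form\<close> for the other. Testing the forward
  identity with \<psi> and the adjoint one with \<open>f\<close> therefore gives equal left-hand
  sides. The result is the duality for the load \<open>L F\<close> and its solution
  \<open>L f\<close>.\<close>

lemma duality_integrated:
  assumes S: "solves F f ut" and A: "adjoint_solves n0 nl p q \<psi> \<omega>"
    and n: "kernel X n0 c0" "kernel X nl c1"
  shows "inner_L2 M (L F) (k \<psi>) = inner_L2 M p (opx X n0 (L f)) + inner_L2 M q (opx X nl (L f))"
proof -
  have sq: "F \<in> sqi M" "f \<in> sqi M" "ut \<in> sqi M" and e: "AE p in M. k f p = L ut p"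
    using S by (auto simp: solves_def)
  have sqa: "p \<in> sqi M" "q \<in> sqi M" "\<psi> \<in> sqi M" "\<omega> \<in> sqi M" and ea: "AE p in M. k \<psi> p = I \<omega> p"
    using A by (auto simp: adjoint_solves_def)
  have tr: "inner_L2 M (I h) (opx X m f) = inner_L2 M h (opx X m (L f))" if h: "h \<in> sqi M" and m: "kernel X m c" for h m c
  proof -
    have "inner_L2 M (I h) (opx X m f) = inner_L2 M h (L (opx X m f))"
      using L_adjoint[OF opx_sqi[OF m sq(2)] h] by (simp add: inner_L2_commute)
    also have "\<dots> = inner_L2 M h (opx X m (L f))"
      using opx_opt_commute_AE[OF m kernel_past sq(2)]
      by (intro inner_L2_cong_AE) (auto intro!: sqi_measurable sqi_rules opx_sqi[OF m] sq h simp: eq_commute)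
    finally show ?thesis .
  qed
  have 1: "inner_L2 M (mulx \<rho> \<omega>) (k f) = inner_L2 M (mulx \<rho> ut) (k \<psi>)"
  proof -
    have "inner_L2 M (mulx \<rho> \<omega>) (k f) = inner_L2 M (L ut) (mulx \<rho> \<omega>)"
      unfolding inner_L2_commute[of _ "L ut"] by (intro inner_L2_cong_AE e) (auto intro!: sqi_measurable sqi_rules sq sqa)
    also have "\<dots> = inner_L2 M ut (mulx \<rho> (I \<omega>))"
      using L_adjoint[OF sq(3) coef_sqi(1)[OF sqa(4)]] by (simp add: mulx_def opt_mult_fst)
    also have "\<dots> = inner_L2 M ut (mulx \<rho> (k \<psi>))"
      using ea by (intro inner_L2_cong_AE mulx_cong_AE) (auto intro!: sqi_measurable sqi_rules sq sqa simp: eq_commute)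
    finally show ?thesis by (simp add: mulx_def inner_L2_mult_shift)
  qed
  have 2: "inner_L2 M (mulx a A) B = inner_L2 M (mulx a B) A" for a A B
    by (simp add: inner_L2_def mulx_def mult_ac)
  have 3: "inner_L2 M (mulx Tr (k' (I \<psi>))) (k' f) = inner_L2 M (mulx Tr (k' (L f))) (k' \<psi>)"
  proof -
    have "inner_L2 M (mulx Tr (k' (I \<psi>))) (k' f) = inner_L2 M (mulx Tr (k' f)) (k' (I \<psi>))"
      by (rule 2)
    also have "\<dots> = inner_L2 M (mulx Tr (L (k' f))) (k' \<psi>)"
      by (rule inner_k_I(2)[OF _ _ meas(3) coef_bounds(3)]) (intro sqi_rules sq sqa)+
    also have "\<dots> = inner_L2 M (mulx Tr (k' (L f))) (k' \<psi>)"
      using commute_AE(2)[OF sq(2)]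
      by (intro inner_L2_cong_AE mulx_cong_AE) (auto intro!: sqi_measurable sqi_rules sq sqa simp: eq_commute)
    finally show ?thesis .
  qed
  have 4: "inner_L2 M (mulx r (I \<psi>)) f = inner_L2 M (mulx r (L f)) \<psi>"
    unfolding 2[of r "I \<psi>" f] by (rule inner_k_I(3)[OF _ _ meas(4) coef_bounds(4)]) (intro sqi_rules sq sqa)+
  have "inner_L2 M (L F) (k \<psi>) = form f (L f) ut \<psi>"
    using S sqa by (auto simp: solves_def)
  also have "\<dots> = form \<psi> (I \<psi>) \<omega> f"
    unfolding form_def 1 3 4 2[of \<mu> "k \<psi>" "k f"] 2[of \<kappa> \<psi> f] ..
  also have "\<dots> = inner_L2 M (I p) (opx X n0 f) + inner_L2 M (I q) (opx X nl f)"
    using A sq by (auto simp: adjoint_solves_def)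
  finally show ?thesis using tr[OF sqa(1) n(1)] tr[OF sqa(2) n(2)] by simp
qed

end

section \<open>Removing the time integration by density\<close>

locale beam_dense = beam +
  assumes dense: "\<And>F. F \<in> sqi M \<Longrightarrow> \<exists>G. (\<forall>n. G n \<in> sqi M) \<and>
      (\<lambda>n::nat. inner_L2 M (\<lambda>z. L (G n) z - F z) (\<lambda>z. L (G n) z - F z)) \<longlonglongrightarrow> 0"
    and exist: "\<And>F. F \<in> sqi M \<Longrightarrow> \<exists>f ut. solves F f ut"
begin

text \<open>\<open>L (g n)\<close> solves the problem with load \<open>L (G n)\<close>, which tends
  to \<open>F\<close>. Its difference from \<open>f\<close> solves the problem with the difference
  of the loads, and \<open>basic_bound\<close> sends it to 0.\<close>

lemma approximating_solutions:
  assumes S: "solves F f ut"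
  obtains G g vt where "\<forall>n::nat. solves (G n) (g n) (vt n)"
    "(\<lambda>n. inner_L2 M (\<lambda>z. L (G n) z - F z) (\<lambda>z. L (G n) z - F z)) \<longlonglongrightarrow> 0"
    "(\<lambda>n. inner_L2 M (\<lambda>z. L (g n) z - f z) (\<lambda>z. L (g n) z - f z)) \<longlonglongrightarrow> 0"
proof -
  have "F \<in> sqi M" using S by (auto simp: solves_def)
  from dense[OF this] obtain G where G: "\<And>n::nat. G n \<in> sqi M"
    "(\<lambda>n. inner_L2 M (\<lambda>z. L (G n) z - F z) (\<lambda>z. L (G n) z - F z)) \<longlonglongrightarrow> 0" by auto
  have "\<exists>g vt. solves (G n) g vt" for n using exist[OF G(1)] .
  then obtain g vt where g: "\<And>n. solves (G n) (g n) (vt n)" by metis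
  have "solves (\<lambda>z. L (G n) z + -1 * F z) (\<lambda>z. L (g n) z + -1 * f z) (\<lambda>z. L (vt n) z + -1 * ut z)" for n
    by (rule solves_lincomb[OF solves_L[OF g] S])
  from basic_bound[OF this] have b: "inner_L2 M (\<lambda>z. L (g n) z - f z) (\<lambda>z. L (g n) z - f z)
      \<le> (T * D / \<kappa>0)\<^sup>2 * inner_L2 M (\<lambda>z. L (G n) z - F z) (\<lambda>z. L (G n) z - F z)" for n
    by simp
  have "(\<lambda>n. inner_L2 M (\<lambda>z. L (g n) z - f z) (\<lambda>z. L (g n) z - f z)) \<longlonglongrightarrow> 0"
  proof (rule tendsto_sandwich[OF _ _ tendsto_const])
    show "(\<lambda>n. (T * D / \<kappa>0)\<^sup>2 * inner_L2 M (\<lambda>z. L (G n) z - F z) (\<lambda>z. L (G n) z - F z)) \<longlonglongrightarrow> 0"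
      using tendsto_mult[OF tendsto_const G(2), of "(T * D / \<kappa>0)\<^sup>2"] by simp
  qed (use b in \<open>auto simp: inner_L2_nonneg\<close>)
  then show ?thesis by (rule that[OF allI[OF g] G(2)])
qed

lemma tendsto_inner_self:
  assumes f: "\<And>n::nat. f n \<in> sqi M" "g \<in> sqi M"
    and l: "(\<lambda>n. inner_L2 M (\<lambda>z. f n z - g z) (\<lambda>z. f n z - g z)) \<longlonglongrightarrow> 0"
  shows "(\<lambda>n. inner_L2 M (f n) (f n)) \<longlonglongrightarrow> inner_L2 M g g"
proof -
  have "inner_L2 M (f n) (f n) = inner_L2 M (\<lambda>z. f n z - g z) (\<lambda>z. f n z - g z) + 2 * inner_L2 M (f n) g - inner_L2 M g g" for n
    using f by (simp add: inner_L2_diff sqi_diff inner_L2_commute[of M g "f n"])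
  moreover have "(\<lambda>n. inner_L2 M (\<lambda>z. f n z - g z) (\<lambda>z. f n z - g z) + 2 * inner_L2 M (f n) g - inner_L2 M g g)
      \<longlonglongrightarrow> 0 + 2 * inner_L2 M g g - inner_L2 M g g"
    by (intro tendsto_intros l tendsto_inner_L2[OF f f(2) l])
  ultimately show ?thesis by simp
qed

text \<open>The assumed estimate is applied to the approximating solutions \<open>g n\<close>, for
  which \<open>L (g n)\<close> and \<open>L (G n)\<close> converge to \<open>f\<close> and
  \<open>F\<close>; the constant survives in the limit.\<close>

lemma solution_bound:
  assumes S: "solves F f ut"
    and C: "\<And>F f ut. solves F f ut \<Longrightarrow> inner_L2 M (L f) (L f) \<le> C * inner_L2 M (L F) (L F)"
  shows "inner_L2 M f f \<le> C * inner_L2 M F F"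
proof -
  obtain G g vt where g0: "\<forall>n::nat. solves (G n) (g n) (vt n)"
    and l: "(\<lambda>n. inner_L2 M (\<lambda>z. L (G n) z - F z) (\<lambda>z. L (G n) z - F z)) \<longlonglongrightarrow> 0"
    "(\<lambda>n. inner_L2 M (\<lambda>z. L (g n) z - f z) (\<lambda>z. L (g n) z - f z)) \<longlonglongrightarrow> 0"
    by (rule approximating_solutions[OF S])
  note g = g0[rule_format]
  have sq: "L (G n) \<in> sqi M" "L (g n) \<in> sqi M" "F \<in> sqi M" "f \<in> sqi M" for n
    using g[of n] S by (auto simp: solves_def intro!: sqi_rules)
  show ?thesis
  proof (rule tendsto_le[OF sequentially_bot])
    show "(\<lambda>n. inner_L2 M (L (g n)) (L (g n))) \<longlonglongrightarrow> inner_L2 M f f"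
      by (rule tendsto_inner_self[OF sq(2,4) l(2)])
    show "(\<lambda>n. C * inner_L2 M (L (G n)) (L (G n))) \<longlonglongrightarrow> C * inner_L2 M F F"
      by (intro tendsto_intros tendsto_inner_self[OF sq(1,3) l(1)])
  qed (use C[OF g] in auto)
qed

text \<open>The limit of \<open>duality_integrated\<close> along approximating solutions, both sides
  being continuous for the norm.\<close>

lemma duality:
  assumes S: "solves F f ut" and A: "adjoint_solves n0 nl p q \<psi> \<omega>"
    and n: "kernel X n0 c0" "kernel X nl c1"
  shows "inner_L2 M F (k \<psi>) = inner_L2 M p (opx X n0 f) + inner_L2 M q (opx X nl f)"
proof -
  obtain G g vt where g0: "\<forall>n::nat. solves (G n) (g n) (vt n)"
    and l: "(\<lambda>n. inner_L2 M (\<lambda>z. L (G n) z - F z) (\<lambda>z. L (G n) z - F z)) \<longlonglongrightarrow> 0"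
    "(\<lambda>n. inner_L2 M (\<lambda>z. L (g n) z - f z) (\<lambda>z. L (g n) z - f z)) \<longlonglongrightarrow> 0"
    by (rule approximating_solutions[OF S])
  note g = g0[rule_format]
  have sq: "L (G n) \<in> sqi M" "L (g n) \<in> sqi M" "F \<in> sqi M" "f \<in> sqi M" for n
    using g[of n] S by (auto simp: solves_def intro!: sqi_rules)
  have sqa: "p \<in> sqi M" "q \<in> sqi M" "\<psi> \<in> sqi M"
    using A by (auto simp: adjoint_solves_def)
  have adj: "inner_L2 M h (opx X m w) = inner_L2 M w (opx X (\<lambda>x y. m y x) h)"
    if "kernel X m c" "h \<in> sqi M" "w \<in> sqi M" for m c h w
    using opx_adjoint[OF that(1,3,2)] by (simp add: inner_L2_commute)
  \<comment> \<open>With the trace kernel moved to the fixed factor, only convergence of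
    \<open>L (g n)\<close> against a fixed function is needed.\<close>
  have t: "(\<lambda>n. inner_L2 M h (opx X m (L (g n)))) \<longlonglongrightarrow> inner_L2 M h (opx X m f)"
    if "kernel X m c" "h \<in> sqi M" for m c h
    unfolding adj[OF that sq(2)] adj[OF that sq(4)]
    by (rule tendsto_inner_L2[OF sq(2,4) opx_sqi[OF kernel_transpose[OF that(1)] that(2)] l(2)])
  have "(\<lambda>n. inner_L2 M p (opx X n0 (L (g n))) + inner_L2 M q (opx X nl (L (g n))))
      \<longlonglongrightarrow> inner_L2 M p (opx X n0 f) + inner_L2 M q (opx X nl f)"
    by (intro tendsto_intros t[OF n(1) sqa(1)] t[OF n(2) sqa(2)])
  moreover have "(\<lambda>n. inner_L2 M (L (G n)) (k \<psi>)) \<longlonglongrightarrow> inner_L2 M F (k \<psi>)"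
    by (rule tendsto_inner_L2[OF sq(1,3) K_sqi[OF sqa(3)] l(1)])
  ultimately show ?thesis
    unfolding duality_integrated[OF g A n] by (rule LIMSEQ_unique[symmetric])
qed

end


subsection \<open>Bump functions and the lemma of du Bois-Reymond\<close>

text \<open>Any class of functions that contains a derivative of each of its members consists of
  smooth functions, so no formula for iterated derivatives is required.\<close>

lemma smooth_coinduct:
  assumes "P f" "\<And>g. P g \<Longrightarrow> \<exists>g'. P g' \<and> (\<forall>x. (g has_real_derivative g' x) (at x))"
  shows "(deriv ^^ n) f differentiable_on UNIV"
proof -
  have "P ((deriv ^^ n) f)"
  proof (induction n)
    case (Suc n)
    from assms(2)[OF this] obtain g' where "P g'" "\<And>x. ((deriv ^^ n) f has_real_derivative g' x) (at x)"
      by auto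
    moreover from this(2) have "deriv ((deriv ^^ n) f) = g'" by (intro ext DERIV_imp_deriv)
    ultimately show ?case by simp
  qed (use assms(1) in simp)
  from assms(2)[OF this] show ?thesis
    by (auto simp: differentiable_on_def real_differentiable_def intro: has_field_derivative_at_within)
qed

text \<open>The derivatives of the flat function \<open>exp (-1/x)\<close> are combinations of the \<open>flat n\<close>.\<close>

definition flat :: "nat \<Rightarrow> real \<Rightarrow> real" where
  "flat n x = (if x > 0 then exp (- 1 / x) / x ^ n else 0)"

text \<open>From the right, substitute the reciprocal: a power divided by the exponential tends to 0
  at infinity.\<close>

lemma flat_tendsto_0: "((\<lambda>x. flat n x) \<longlongrightarrow> 0) (at 0)"
  unfolding filterlim_at_split
proof
  have "((\<lambda>x::real. 0::real) \<longlongrightarrow> 0) (at_left 0)" by simp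
  then show "(flat n \<longlongrightarrow> 0) (at_left 0)"
    by (rule Lim_transform_eventually) (auto simp: flat_def eventually_at_left_field intro!: exI[of _ "-1"])
  have "((\<lambda>y::real. y ^ n / exp y) \<longlongrightarrow> 0) at_top" by (rule tendsto_power_div_exp_0)
  from filterlim_compose[OF this filterlim_inverse_at_top_right]
  have "((\<lambda>x::real. inverse x ^ n / exp (inverse x)) \<longlongrightarrow> 0) (at_right 0)" .
  then show "(flat n \<longlongrightarrow> 0) (at_right 0)"
    by (rule Lim_transform_eventually)
      (auto simp: flat_def eventually_at_right_field exp_minus field_simps intro!: exI[of _ "1"])
qed

lemma flat_has_derivative:
  "(flat n has_real_derivative flat (n + 2) x - real n * flat (n + 1) x) (at x)"
proof -
  consider "x < 0" | "x = 0" | "x > 0" by linarith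
  then show ?thesis
  proof cases
    case 1
    have "((\<lambda>_. 0) has_real_derivative 0) (at x)" by simp
    then have "(flat n has_real_derivative 0) (at x)"
      by (rule DERIV_cong_ev[THEN iffD1, rotated -1])
        (use 1 in \<open>auto simp: flat_def eventually_nhds intro!: exI[of _ "{..<0}"]\<close>)
    then show ?thesis using 1 by (simp add: flat_def)
  next
    case 2
    \<comment> \<open>The difference quotient of \<open>flat n\<close> at 0 is
      \<open>flat (Suc n)\<close>.\<close>
    have "((\<lambda>h. (flat n (0 + h) - flat n 0) / h) \<longlongrightarrow> 0) (at 0)"
      using flat_tendsto_0[of "Suc n"]
      by (rule Lim_transform_eventually) (auto simp: flat_def intro!: always_eventually)
    then have "(flat n has_real_derivative 0) (at 0)" by (simp add: DERIV_def)
    then show ?thesis using 2 by (simp add: flat_def)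
  next
    case 3
    have "((\<lambda>x. exp (- 1 / x) / x ^ n) has_real_derivative flat (n + 2) x - real n * flat (n + 1) x) (at x)"
    proof (cases n)
      case 0
      then show ?thesis using 3
        by (auto intro!: derivative_eq_intros simp: flat_def power2_eq_square)
    next
      case (Suc m)
      have "((\<lambda>x. exp (- 1 / x) / x ^ n) has_real_derivative
        (exp (- 1 / x) * (1 / x^2) * x ^ n - exp (-1/x) * (real n * x ^ (n - 1))) / (x ^ n * x ^ n)) (at x)"
        using 3 by (auto intro!: derivative_eq_intros simp: power2_eq_square)
      moreover have "(exp (- 1 / x) * (1 / x^2) * x ^ n - exp (-1/x) * (real n * x ^ (n - 1))) / (x ^ n * x ^ n)
        = flat (n + 2) x - real n * flat (n + 1) x"
        using 3 Suc by (simp add: flat_def power2_eq_square field_simps)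
      ultimately show ?thesis by simp
    qed
    then show ?thesis
      by (rule DERIV_cong_ev[THEN iffD1, rotated -1])
        (use 3 in \<open>auto simp: flat_def eventually_nhds intro!: exI[of _ "{0<..}"]\<close>)
  qed
qed

text \<open>The algebra generated by affine reparametrisations of the \<open>flat n\<close>. Closure
  under products is what makes room for bumps, and \<open>flats_deriv\<close> for
  \<open>smooth_coinduct\<close>.\<close>

inductive_set flats :: "(real \<Rightarrow> real) set" where
  flat: "(\<lambda>x. flat n (c * x + d)) \<in> flats"
| cmult: "f \<in> flats \<Longrightarrow> (\<lambda>x. c * f x) \<in> flats"
| add: "f \<in> flats \<Longrightarrow> g \<in> flats \<Longrightarrow> (\<lambda>x. f x + g x) \<in> flats"
| mult: "f \<in> flats \<Longrightarrow> g \<in> flats \<Longrightarrow> (\<lambda>x. f x * g x) \<in> flats"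

lemma flats_deriv:
  assumes "f \<in> flats"
  shows "\<exists>f'\<in>flats. \<forall>x. (f has_real_derivative f' x) (at x)"
  using assms
proof induction
  case (flat n c d)
  have "(\<lambda>x. c * (flat (n+2) (c * x + d) + (- real n) * flat (n + 1) (c * x + d))) \<in> flats"
    by (intro flats.intros)
  moreover have "((\<lambda>x. flat n (c * x + d)) has_real_derivative
      c * (flat (n+2) (c * x + d) + (- real n) * flat (n + 1) (c * x + d))) (at x)" for x
  proof -
    have "((\<lambda>x. c * x + d) has_real_derivative c) (at x)"
      by (auto intro!: derivative_eq_intros)
    from DERIV_chain2[OF flat_has_derivative this] show ?thesis
      by (simp add: mult.commute)
  qed
  ultimately show ?case
    by (intro bexI[of _ "\<lambda>x. c * (flat (n+2) (c * x + d) + (- real n) * flat (n + 1) (c * x + d))"]) auto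
next
  case (cmult f c)
  then obtain f' where f': "f' \<in> flats" "\<And>x. (f has_real_derivative f' x) (at x)" by auto
  have "((\<lambda>x. c * f x) has_real_derivative c * f' x) (at x)" for x
    by (rule DERIV_cmult[OF f'(2)])
  then show ?case using flats.cmult[OF f'(1), of c] by (intro bexI[of _ "\<lambda>x. c * f' x"]) auto
next
  case (add f g)
  then obtain f' g' where d: "f' \<in> flats" "\<And>x. (f has_real_derivative f' x) (at x)"
    "g' \<in> flats" "\<And>x. (g has_real_derivative g' x) (at x)" by auto
  have "((\<lambda>x. f x + g x) has_real_derivative f' x + g' x) (at x)" for x
    by (rule DERIV_add[OF d(2,4)])
  then show ?case using flats.add[OF d(1,3)] by (intro bexI[of _ "\<lambda>x. f' x + g' x"]) auto
next
  case (mult f g)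
  then obtain f' g' where d: "f' \<in> flats" "\<And>x. (f has_real_derivative f' x) (at x)"
    "g' \<in> flats" "\<And>x. (g has_real_derivative g' x) (at x)" by auto
  have "((\<lambda>x. f x * g x) has_real_derivative f' x * g x + g' x * f x) (at x)" for x
    by (rule DERIV_mult[OF d(2,4)])
  moreover have "(\<lambda>x. f' x * g x + g' x * f x) \<in> flats"
    by (intro flats.add flats.mult d mult.hyps)
  ultimately show ?case by (intro bexI[of _ "\<lambda>x. f' x * g x + g' x * f x"]) auto
qed

lemma flats_continuous: "f \<in> flats \<Longrightarrow> continuous_on S f"
  using flats_deriv[of f] by (auto intro!: continuous_at_imp_continuous_on DERIV_isCont)

lemma primitive:
  fixes b :: "real \<Rightarrow> real"
  assumes b: "continuous_on UNIV b" "\<And>x. x \<le> m \<Longrightarrow> b x = 0" "\<And>x. x \<ge> m' \<Longrightarrow> b x = 0"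
  shows "\<exists>B. (\<forall>x. (B has_real_derivative b x) (at x)) \<and> (\<forall>x\<le>m. B x = 0) \<and> (\<forall>x\<ge>m'. B x = B m')"
proof -
  \<comment> \<open>Starting one unit to the left of \<open>m\<close> makes every point from
    \<open>m\<close> on an interior point of the interval of integration.\<close>
  define B where "B x = integral {m - 1..x} b" for x
  have B0: "B x = 0" if "x \<le> m" for x
  proof -
    have "integral {m - 1..x} b = integral {m - 1..x} (\<lambda>_. 0)"
      by (intro Henstock_Kurzweil_Integration.integral_cong) (use that b(2) in auto)
    then show ?thesis by (simp add: B_def)
  qed
  have B': "(B has_real_derivative b x) (at x)" for x
  proof (cases "x < m")
    case True
    have "((\<lambda>_. 0) has_real_derivative 0) (at x)" by simp
    then have "(B has_real_derivative 0) (at x)"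
      by (rule DERIV_cong_ev[THEN iffD1, rotated -1])
        (use True in \<open>auto simp: B0 eventually_nhds intro!: exI[of _ "{..<m}"]\<close>)
    then show ?thesis using b True by simp
  next
    case False
    have "(B has_real_derivative b x) (at x within {m - 1..x + 1})"
      unfolding B_def by (rule integral_has_real_derivative) (use False in \<open>auto intro: continuous_on_subset[OF b(1)]\<close>)
    then show ?thesis using False at_within_Icc_at[of "m - 1" x "x + 1"] by simp
  qed
  have "\<exists>c. \<forall>x\<in>{m'..}. B x = c"
    by (rule has_field_derivative_zero_constant) (use B' b(3) in \<open>auto intro: has_field_derivative_at_within\<close>, metis has_field_derivative_at_within)
  then have "B x = B m'" if "x \<ge> m'" for x using that by fastforce
  with B' B0 show ?thesis by blast
qed

text \<open>Membership in \<open>flats\<close> is asked of the derivative only: the test functions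
  will be primitives of combinations of bumps, which are not given as elements of
  \<open>flats\<close>.\<close>

lemma flats_test_function:
  assumes d: "\<And>x. (\<eta> has_real_derivative h x) (at x)" and h: "h \<in> flats"
    and z: "\<And>x. x \<le> m \<Longrightarrow> \<eta> x = 0" "\<And>x. x \<ge> m' \<Longrightarrow> \<eta> x = 0" and m: "a < m" "m' < b"
  shows "test_function a b \<eta>"
proof -
  have "(deriv ^^ n) \<eta> differentiable_on UNIV" for n
  proof (rule smooth_coinduct[where P = "\<lambda>f. \<exists>f'\<in>flats. \<forall>x. (f has_real_derivative f' x) (at x)"])
    fix g assume "\<exists>f'\<in>flats. \<forall>x. (g has_real_derivative f' x) (at x)"
    then show "\<exists>g'. (\<exists>f'\<in>flats. \<forall>x. (g' has_real_derivative f' x) (at x)) \<and> (\<forall>x. (g has_real_derivative g' x) (at x))"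
      using flats_deriv by blast
  qed (use d h in blast)
  moreover have "closure {x. \<eta> x \<noteq> 0} \<subseteq> {m..m'}"
    using z by (intro closure_minimal) (auto, (metis linear)+)
  then have "closure {x. \<eta> x \<noteq> 0} \<subseteq> {a<..<b}" using m by auto
  ultimately show ?thesis by (simp add: test_function_def)
qed

lemma test_function_zero:
  assumes "test_function a b \<eta>" "x \<notin> {a<..<b}" shows "\<eta> x = 0"
proof (rule ccontr)
  assume "\<eta> x \<noteq> 0"
  then have "x \<in> closure {x. \<eta> x \<noteq> 0}" using closure_subset[of "{x. \<eta> x \<noteq> 0}"] by auto
  with assms show False by (auto simp: test_function_def)
qed

lemma test_function_deriv:
  assumes "test_function a b \<eta>"
  shows "(\<eta> has_real_derivative deriv \<eta> x) (at x)" "isCont (deriv \<eta>) x" "isCont \<eta> x"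
proof -
  have "(deriv ^^ 0) \<eta> differentiable_on UNIV" "(deriv ^^ 1) \<eta> differentiable_on UNIV"
    using assms unfolding test_function_def by blast+
  then have *: "\<eta> differentiable at x" "deriv \<eta> differentiable at x"
    by (auto simp: differentiable_on_def)
  from *(1) show "(\<eta> has_real_derivative deriv \<eta> x) (at x)"
    using DERIV_deriv_iff_real_differentiable by blast
  then show "isCont \<eta> x" by (rule DERIV_isCont)
  from *(2) show "isCont (deriv \<eta>) x"
    using differentiable_imp_continuous_within by blast
qed

text \<open>The shift by 1 confines the support to the closed interval from
  \<open>\<alpha> + 1/n\<close> to \<open>\<beta> - 1/n\<close>. The bumps stay below 1 and tend to
  the indicator of the open interval, so dominated convergence applies.\<close>

definition bump :: "real \<Rightarrow> real \<Rightarrow> nat \<Rightarrow> real \<Rightarrow> real" where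
  "bump \<alpha> \<beta> n x = flat 0 (n * (x - \<alpha>) - 1) * flat 0 (n * (\<beta> - x) - 1)"

lemma flat0_bounds: "0 \<le> flat 0 x" "flat 0 x \<le> 1"
  by (auto simp: flat_def)

lemma bump_bounds: "0 \<le> bump \<alpha> \<beta> n x" "bump \<alpha> \<beta> n x \<le> 1"
  unfolding bump_def using flat0_bounds mult_le_one by (auto simp: mult_le_one)

lemma bump_flats: "bump \<alpha> \<beta> n \<in> flats"
proof -
  have "(\<lambda>x. flat 0 (real n * x + (- real n * \<alpha> - 1)) * flat 0 (- real n * x + (real n * \<beta> - 1))) \<in> flats"
    by (intro flats.intros)
  moreover have "bump \<alpha> \<beta> n = (\<lambda>x. flat 0 (real n * x + (- real n * \<alpha> - 1)) * flat 0 (- real n * x + (real n * \<beta> - 1)))"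
    by (auto simp: bump_def algebra_simps intro!: ext)
  ultimately show ?thesis by simp
qed

lemma bump_zero:
  assumes "n > 0" shows "x \<le> \<alpha> + 1 / n \<Longrightarrow> bump \<alpha> \<beta> n x = 0" "x \<ge> \<beta> - 1 / n \<Longrightarrow> bump \<alpha> \<beta> n x = 0"
  using assms by (auto simp: bump_def flat_def field_simps)

lemma bump_tendsto: "(\<lambda>n. bump \<alpha> \<beta> n x) \<longlonglongrightarrow> indicator {\<alpha><..<\<beta>} x"
proof -
  have f: "(\<lambda>n. flat 0 (real n * y - 1)) \<longlonglongrightarrow> (if y > 0 then 1 else 0)" for y
  proof (cases "y > 0")
    case True
    have lim: "filterlim (\<lambda>n. real n * y - 1) at_top sequentially"
      using True by (intro filterlim_tendsto_add_at_top[of "\<lambda>_. -1", simplified add.commute[of "-1"], simplified]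
        filterlim_at_top_mult_tendsto_pos filterlim_real_sequentially tendsto_const) auto
    then have "(\<lambda>n. exp (- 1 / (real n * y - 1))) \<longlonglongrightarrow> exp 0"
      by (intro tendsto_exp tendsto_divide_0[OF tendsto_const] filterlim_at_top_imp_at_infinity)
    then have "(\<lambda>n. flat 0 (real n * y - 1)) \<longlonglongrightarrow> exp 0"
    proof (rule Lim_transform_eventually)
      show "\<forall>\<^sub>F n in sequentially. exp (- 1 / (real n * y - 1)) = flat 0 (real n * y - 1)"
        using lim[unfolded filterlim_at_top_dense, rule_format, of 0]
        by eventually_elim (simp add: flat_def)
    qed
    then show ?thesis using True by simp
  next
    case False
    then have "flat 0 (real n * y - 1) = 0" for n
      using mult_nonneg_nonpos[of "real n" y] by (auto simp: flat_def)
    then show ?thesis using False by simp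
  qed
  have "(\<lambda>n. bump \<alpha> \<beta> n x) \<longlonglongrightarrow> (if x - \<alpha> > 0 then 1 else 0) * (if \<beta> - x > 0 then 1 else 0)"
    unfolding bump_def by (intro tendsto_mult f)
  then show ?thesis by (auto simp: indicator_def split: if_splits)
qed


text \<open>Positive and negative part are densities of two finite measures that agree on all
  half-lines. Such measures are equal, and densities are unique up to null sets.\<close>

lemma AE_zero_if_integrals_zero:
  fixes h :: "real \<Rightarrow> real"
  assumes h: "integrable lborel h" and z: "\<And>x. (\<integral>y. h y * indicator {x<..} y \<partial>lborel) = 0"
  shows "AE x in lborel. h x = 0"
proof -
  note [measurable] = borel_measurable_integrable[OF h]
  define p q where "p x = max (h x) 0" and "q x = max (- h x) 0" for x
  have [measurable]: "p \<in> borel_measurable borel" "q \<in> borel_measurable borel"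
    unfolding p_def q_def by measurable
  have nn: "0 \<le> p x" "0 \<le> q x" for x by (auto simp: p_def q_def)
  have i: "integrable lborel p" "integrable lborel q"
    unfolding p_def q_def using h by auto
  have st: "{x<..} \<in> sets lborel" for x :: real
    unfolding sets_lborel by (rule borel_open) (rule open_greaterThan)
  have ii: "integrable lborel (\<lambda>y. p y * indicator {x<..} y)" "integrable lborel (\<lambda>y. q y * indicator {x<..} y)" for x
    by (rule integrable_real_mult_indicator[OF st i(1)], rule integrable_real_mult_indicator[OF st i(2)])
  have em: "emeasure (density lborel (\<lambda>x. ennreal (f x))) {x<..} = ennreal (\<integral>y. f y * indicator {x<..} y \<partial>lborel)"
    if [measurable]: "f \<in> borel_measurable borel" and "\<And>x. 0 \<le> f x" "integrable lborel (\<lambda>y. f y * indicator {x<..} y)" for f and x :: real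
  proof -
    have "emeasure (density lborel (\<lambda>x. ennreal (f x))) {x<..} = (\<integral>\<^sup>+y. ennreal (f y * indicator {x<..} y) \<partial>lborel)"
      by (subst emeasure_density) (auto intro!: nn_integral_cong split: split_indicator)
    also have "\<dots> = ennreal (\<integral>y. f y * indicator {x<..} y \<partial>lborel)"
      by (rule nn_integral_eq_integral) (use that in auto)
    finally show ?thesis .
  qed
  have "density lborel (\<lambda>x. ennreal (p x)) = density lborel (\<lambda>x. ennreal (q x))"
  proof (rule measure_eqI_lessThan)
    fix x
    have "(\<integral>y. p y * indicator {x<..} y - q y * indicator {x<..} y \<partial>lborel) = (\<integral>y. h y * indicator {x<..} y \<partial>lborel)"
      by (intro Bochner_Integration.integral_cong) (auto simp: p_def q_def max_def split: split_indicator)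
    then have "(\<integral>y. p y * indicator {x<..} y \<partial>lborel) = (\<integral>y. q y * indicator {x<..} y \<partial>lborel)"
      using z ii by simp
    then show "emeasure (density lborel (\<lambda>x. ennreal (p x))) {x<..} = emeasure (density lborel (\<lambda>x. ennreal (q x))) {x<..}"
      using em nn ii by simp
    show "emeasure (density lborel (\<lambda>x. ennreal (p x))) {x<..} < \<infinity>"
      using em nn ii by simp
  qed auto
  then have "AE x in lborel. ennreal (p x) = ennreal (q x)"
    by (intro sigma_finite_measure.density_unique[OF sigma_finite_lborel]) auto
  then show ?thesis
    by eventually_elim (use nn in \<open>auto simp: p_def q_def max_def split: if_splits\<close>)
qed

lemma integrable_ival_iff:
  "integrable (ival a b) f \<longleftrightarrow> integrable lborel (\<lambda>x. indicator {a<..<b} x * f x)" for f :: "real \<Rightarrow> real"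
  unfolding ival_def by (subst integrable_restrict_space) auto

lemma integral_ival:
  "(\<integral>x. f x \<partial>ival a b) = (\<integral>x. indicator {a<..<b} x * f x \<partial>lborel)" for f :: "real \<Rightarrow> real"
  unfolding ival_def by (subst integral_restrict_space) auto

lemma AE_ival_zero:
  fixes h :: "real \<Rightarrow> real"
  assumes h: "integrable (ival a b) h"
    and z: "\<And>\<alpha> \<beta>. a \<le> \<alpha> \<Longrightarrow> \<alpha> < \<beta> \<Longrightarrow> \<beta> \<le> b \<Longrightarrow> (\<integral>y. indicator {\<alpha><..<\<beta>} y * h y \<partial>ival a b) = 0"
  shows "AE x in ival a b. h x = 0"
proof -
  let ?h = "\<lambda>x. indicator {a<..<b} x * h x"
  have "AE x in lborel. ?h x = 0"
  proof (rule AE_zero_if_integrals_zero)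
    show "integrable lborel ?h" using h by (simp add: integrable_ival_iff)
    fix x
    show "(\<integral>y. ?h y * indicator {x<..} y \<partial>lborel) = 0"
    proof (cases "max x a < b")
      case True
      have "(\<integral>y. ?h y * indicator {x<..} y \<partial>lborel) = (\<integral>y. indicator {max x a<..<b} y * h y \<partial>ival a b)"
        unfolding integral_ival by (intro Bochner_Integration.integral_cong) (auto split: split_indicator)
      then show ?thesis using z[of "max x a" b] True by simp
    next
      case False
      then have "(\<lambda>y. ?h y * indicator {x<..} y) = (\<lambda>_. 0)" by (auto split: split_indicator)
      then show ?thesis by (simp only: Bochner_Integration.integral_zero)
    qed
  qed
  then show ?thesis unfolding AE_ival_iff by eventually_elim auto
qed

lemma integral_FTC_ival:
  assumes "\<And>x. (F has_real_derivative f x) (at x)" "\<And>x. isCont f x" "a \<le> \<alpha>" "\<alpha> \<le> \<beta>" "\<beta> \<le> b"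
  shows "(\<integral>x. indicator {\<alpha><..<\<beta>} x * f x \<partial>ival a b) = F \<beta> - F \<alpha>"
proof -
  have "(\<integral>x. indicator {\<alpha><..<\<beta>} x * f x \<partial>ival a b) = (\<integral>x. f x * indicator {\<alpha>..\<beta>} x \<partial>lborel)"
    unfolding integral_ival
  proof (rule integral_cong_AE)
    show "AE x in lborel. indicator {a<..<b} x * (indicator {\<alpha><..<\<beta>} x * f x) = f x * indicator {\<alpha>..\<beta>} x"
      using AE_lborel_singleton[of \<alpha>] AE_lborel_singleton[of \<beta>]
      by eventually_elim (use assms in \<open>auto split: split_indicator\<close>)
    have [measurable]: "f \<in> borel_measurable borel"
      using assms(2) by (intro borel_measurable_continuous_onI continuous_at_imp_continuous_on) auto
    show "(\<lambda>x. indicator {a<..<b} x * (indicator {\<alpha><..<\<beta>} x * f x)) \<in> borel_measurable lborel"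
      "(\<lambda>x. f x * indicator {\<alpha>..\<beta>} x) \<in> borel_measurable lborel" by measurable
  qed
  also have "\<dots> = F \<beta> - F \<alpha>"
    by (rule integral_FTC_Icc_real) (use assms in auto)
  finally show ?thesis .
qed

text \<open>A combination of bumps with integral 0 is the derivative of a test function. Subtracting
  a multiple of one fixed bump gives any bump integral 0; hence \<open>k\<close> integrates against
  every bump like the constant \<open>C\<close>, its mean against the fixed bump. In the limit bumps
  become indicators of intervals.\<close>

lemma du_Bois_Reymond:
  fixes k :: "real \<Rightarrow> real"
  assumes ab: "a < b" and k: "integrable (ival a b) k"
    and z: "\<And>\<eta>. test_function a b \<eta> \<Longrightarrow> (\<integral>x. k x * deriv \<eta> x \<partial>ival a b) = 0"
  obtains C where "AE x in ival a b. k x = C"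
proof -
  interpret finite_measure "ival a b" by (rule finite_measure_ival)
  let ?X = "ival a b"
  have cont: "continuous_on UNIV (bump \<alpha> \<beta> n)" for \<alpha> \<beta> n by (rule flats_continuous[OF bump_flats])
  have meas[measurable]: "bump \<alpha> \<beta> n \<in> borel_measurable ?X" for \<alpha> \<beta> n
    by (intro measurable_ival borel_measurable_continuous_onI cont)
  have ib: "integrable ?X (bump \<alpha> \<beta> n)" for \<alpha> \<beta> n
    by (rule integrable_const_bound[of _ 1]) (auto simp: bump_bounds)
  have ikb: "integrable ?X (\<lambda>x. k x * bump \<alpha> \<beta> n x)" for \<alpha> \<beta> n
    using borel_measurable_integrable[OF k]
    by (intro Bochner_Integration.integrable_bound[OF k] AE_I2)
      (auto simp: abs_mult bump_bounds intro!: mult_right_le_one_le)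
  have lim1: "(\<lambda>n. \<integral>x. bump \<alpha> \<beta> n x \<partial>?X) \<longlonglongrightarrow> (\<integral>x. indicator {\<alpha><..<\<beta>} x \<partial>?X)" for \<alpha> \<beta>
    by (rule integral_dominated_convergence[where w = "\<lambda>_. 1"])
      (auto simp: bump_bounds intro!: bump_tendsto measurable_ival)
  have lim2: "(\<lambda>n. \<integral>x. k x * bump \<alpha> \<beta> n x \<partial>?X) \<longlonglongrightarrow> (\<integral>x. k x * indicator {\<alpha><..<\<beta>} x \<partial>?X)" for \<alpha> \<beta>
  proof (rule integral_dominated_convergence[where w = "\<lambda>x. \<bar>k x\<bar>"])
    show "(\<lambda>x. k x * indicator {\<alpha><..<\<beta>} x) \<in> borel_measurable ?X"
      using borel_measurable_integrable[OF k] by (intro borel_measurable_times) (auto intro!: measurable_ival)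
    show "(\<lambda>x. k x * bump \<alpha> \<beta> n x) \<in> borel_measurable ?X" for n
      using borel_measurable_integrable[OF k] by measurable
    show "integrable ?X (\<lambda>x. \<bar>k x\<bar>)" using k by simp
    show "AE x in ?X. (\<lambda>n. k x * bump \<alpha> \<beta> n x) \<longlonglongrightarrow> k x * indicator {\<alpha><..<\<beta>} x"
      by (intro AE_I2 tendsto_intros bump_tendsto)
    show "AE x in ?X. norm (k x * bump \<alpha> \<beta> n x) \<le> \<bar>k x\<bar>" for n
      by (auto simp: abs_mult bump_bounds intro!: mult_right_le_one_le)
  qed
  \<comment> \<open>The primitive is constant on both sides of the support: 0 on the left and the
    total integral on the right.\<close>
  have prim: "\<exists>B. (\<forall>x. (B has_real_derivative bump \<alpha> \<beta> n x) (at x)) \<and> (\<forall>x \<le> \<alpha> + 1/n. B x = 0) \<and>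
      (\<forall>x \<ge> \<beta> - 1/n. B x = (\<integral>x. bump \<alpha> \<beta> n x \<partial>?X))"
    if \<alpha>: "a \<le> \<alpha>" "\<beta> \<le> b" "n > 0" "\<alpha> + 1/n < \<beta> - 1/n" for \<alpha> \<beta> n
  proof -
    obtain B where B: "\<And>x. (B has_real_derivative bump \<alpha> \<beta> n x) (at x)" "\<And>x. x \<le> \<alpha> + 1/n \<Longrightarrow> B x = 0"
      "\<And>x. x \<ge> \<beta> - 1/n \<Longrightarrow> B x = B (\<beta> - 1/n)"
      using primitive[of "bump \<alpha> \<beta> n" "\<alpha> + 1/n" "\<beta> - 1/n"] cont bump_zero[OF \<alpha>(3)] by blast
    have "(\<integral>x. indicator {a<..<b} x * bump \<alpha> \<beta> n x \<partial>?X) = B b - B a"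
      by (rule integral_FTC_ival) (use B(1) ab cont[of \<alpha> \<beta> n] in \<open>auto simp: continuous_on_eq_continuous_at\<close>)
    moreover have "(\<integral>x. indicator {a<..<b} x * bump \<alpha> \<beta> n x \<partial>?X) = (\<integral>x. bump \<alpha> \<beta> n x \<partial>?X)"
      by (intro Bochner_Integration.integral_cong) auto
    moreover have "B a = 0" using \<alpha> by (intro B(2)) (simp add: add_increasing2)
    moreover have "B b = B (\<beta> - 1/n)"
    proof (rule B(3))
      have "0 < 1 / real n" using \<alpha> by simp
      then show "\<beta> - 1/n \<le> b" using \<alpha>(2) by linarith
    qed
    ultimately have "B (\<beta> - 1/n) = (\<integral>x. bump \<alpha> \<beta> n x \<partial>?X)" by linarith
    then show ?thesis using B by (metis (no_types))
  qed
  \<comment> \<open>Makes the support of the fixed bump on \<open>(a,b)\<close> a nondegenerate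
    interval, so that its integral \<open>I0\<close> is positive.\<close>
  obtain N :: nat where N: "N > 0" "2 / N < b - a"
    using reals_Archimedean2[of "2 / (b - a)"] ab
    by (metis (no_types, opaque_lifting) diff_gt_0_iff_gt divide_less_eq divide_pos_pos mult.commute of_nat_0_less_iff order_less_trans zero_less_numeral)
  then have N': "a + 1/N < b - 1/N" by simp
  define I0 where "I0 = (\<integral>x. bump a b N x \<partial>?X)"
  define C where "C = (\<integral>x. k x * bump a b N x \<partial>?X) / I0"
  have "I0 > 0"
  proof -
    obtain B where B: "\<And>x. (B has_real_derivative bump a b N x) (at x)" "B (a + 1/N) = 0" "B (b - 1/N) = I0"
      using prim[of a b N] N N' unfolding I0_def by auto
    have "B (a + 1/N) < B (b - 1/N)"
    proof (rule DERIV_pos_imp_increasing_open[OF N'])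
      fix x assume "a + 1/N < x" "x < b - 1/N"
      then have "bump a b N x > 0" using N(1) by (auto simp: bump_def flat_def field_simps)
      then show "\<exists>y. (B has_real_derivative y) (at x) \<and> 0 < y" using B(1) by blast
    qed (use B(1) in \<open>auto intro!: DERIV_isCont continuous_at_imp_continuous_on\<close>)
    then show ?thesis using B by simp
  qed
  have key: "(\<integral>x. k x * bump \<alpha> \<beta> n x \<partial>?X) = C * (\<integral>x. bump \<alpha> \<beta> n x \<partial>?X)"
    if \<alpha>: "a \<le> \<alpha>" "\<beta> \<le> b" "n > 0" "\<alpha> + 1/n < \<beta> - 1/n" for \<alpha> \<beta> n
  proof -
    define I where "I = (\<integral>x. bump \<alpha> \<beta> n x \<partial>?X)"
    obtain B0 where B0: "\<And>x. (B0 has_real_derivative bump a b N x) (at x)" "\<And>x. x \<le> a + 1/N \<Longrightarrow> B0 x = 0"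
      "\<And>x. x \<ge> b - 1/N \<Longrightarrow> B0 x = I0"
      using prim[of a b N] N N' unfolding I0_def by auto
    obtain B where B: "\<And>x. (B has_real_derivative bump \<alpha> \<beta> n x) (at x)" "\<And>x. x \<le> \<alpha> + 1/n \<Longrightarrow> B x = 0"
      "\<And>x. x \<ge> \<beta> - 1/n \<Longrightarrow> B x = I"
      using prim[OF \<alpha>] unfolding I_def by auto
    \<comment> \<open>The multiple of \<open>B0\<close> is chosen to cancel the constant value of
      \<open>B\<close> to the right of both supports.\<close>
    let ?\<eta> = "\<lambda>x. B x + (- I / I0) * B0 x" and ?d = "\<lambda>x. bump \<alpha> \<beta> n x + (- I / I0) * bump a b N x"
    have d: "(?\<eta> has_real_derivative ?d x) (at x)" for x
      by (intro DERIV_add DERIV_cmult B B0)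
    have "test_function a b ?\<eta>"
    proof (rule flats_test_function[OF d, of "min (\<alpha> + 1/n) (a + 1/N)" "max (\<beta> - 1/n) (b - 1/N)"])
      show "?d \<in> flats" by (intro flats.intros bump_flats)
      show "a < min (\<alpha> + 1 / n) (a + 1 / N)" "max (\<beta> - 1 / n) (b - 1 / N) < b"
      proof -
        have "0 < 1 / real n" "0 < 1 / real N" using \<alpha> N by auto
        then show "a < min (\<alpha> + 1 / n) (a + 1 / N)" "max (\<beta> - 1 / n) (b - 1 / N) < b"
          using \<alpha>(1,2) by linarith+
      qed
    qed (use B B0 \<open>I0 > 0\<close> in auto)
    from z[OF this] have "(\<integral>x. k x * ?d x \<partial>?X) = 0"
      using DERIV_imp_deriv[OF d] by simp
    moreover have "(\<integral>x. k x * ?d x \<partial>?X) = (\<integral>x. k x * bump \<alpha> \<beta> n x + (- I / I0) * (k x * bump a b N x) \<partial>?X)"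
      by (intro Bochner_Integration.integral_cong) (auto simp: algebra_simps)
    moreover have "\<dots> = (\<integral>x. k x * bump \<alpha> \<beta> n x \<partial>?X) + (- I / I0) * (\<integral>x. k x * bump a b N x \<partial>?X)"
      using ikb by simp
    ultimately show ?thesis by (simp add: C_def I_def)
  qed
  have eq: "(\<integral>x. k x * indicator {\<alpha><..<\<beta>} x \<partial>?X) = C * (\<integral>x. indicator {\<alpha><..<\<beta>} x \<partial>?X)"
    if \<alpha>: "a \<le> \<alpha>" "\<beta> \<le> b" "\<alpha> < \<beta>" for \<alpha> \<beta>
  \<comment> \<open>As soon as \<open>2 / n\<close> is less than the length of the interval,
    \<open>key\<close> applies, and both integrals converge to those over the indicator.\<close>
  proof (rule LIMSEQ_unique[OF lim2])
    obtain m :: nat where m: "m > 0" "2 / m < \<beta> - \<alpha>"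
      using reals_Archimedean2[of "2 / (\<beta> - \<alpha>)"] \<alpha>(3)
      by (metis (no_types, opaque_lifting) diff_gt_0_iff_gt divide_less_eq divide_pos_pos mult.commute of_nat_0_less_iff order_less_trans zero_less_numeral)
    have ev: "\<forall>\<^sub>F n in sequentially. C * (\<integral>x. bump \<alpha> \<beta> n x \<partial>?X) = (\<integral>x. k x * bump \<alpha> \<beta> n x \<partial>?X)"
      using eventually_ge_at_top[of m]
    proof eventually_elim
      case (elim n)
      then have n: "n > 0" "1 / real n \<le> 1 / real m" using m by (auto simp: field_simps)
      then have "2 / real n < \<beta> - \<alpha>" using m by linarith
      then show ?case using key[OF \<alpha>(1,2) n(1)] by simp
    qed
    show "(\<lambda>n. \<integral>x. k x * bump \<alpha> \<beta> n x \<partial>?X) \<longlonglongrightarrow> C * (\<integral>x. indicator {\<alpha><..<\<beta>} x \<partial>?X)"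
      using Lim_transform_eventually[OF tendsto_mult[OF tendsto_const lim1] ev] .
  qed
  have "AE x in ?X. k x - C = 0"
  proof (rule AE_ival_zero)
    show "integrable ?X (\<lambda>x. k x - C)" using k by simp
    fix \<alpha> \<beta> :: real assume \<alpha>: "a \<le> \<alpha>" "\<alpha> < \<beta>" "\<beta> \<le> b"
    have [measurable]: "(indicator {\<alpha><..<\<beta>} :: real \<Rightarrow> real) \<in> borel_measurable ?X" by (rule measurable_ival) auto
    have "integrable ?X (indicator {\<alpha><..<\<beta>} :: real \<Rightarrow> real)"
      by (rule integrable_const_bound[of _ 1]) auto
    moreover have "integrable ?X (\<lambda>x. k x * indicator {\<alpha><..<\<beta>} x)"
    proof (rule Bochner_Integration.integrable_bound[OF k])
      show "(\<lambda>x. k x * indicator {\<alpha><..<\<beta>} x) \<in> borel_measurable ?X"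
        using borel_measurable_integrable[OF k] by measurable
    qed (auto simp: abs_mult split: split_indicator)
    moreover have "(\<integral>y. indicator {\<alpha><..<\<beta>} y * (k y - C) \<partial>?X) = (\<integral>y. k y * indicator {\<alpha><..<\<beta>} y - C * indicator {\<alpha><..<\<beta>} y \<partial>?X)"
      by (intro Bochner_Integration.integral_cong) (auto simp: algebra_simps)
    ultimately show "(\<integral>y. indicator {\<alpha><..<\<beta>} y * (k y - C) \<partial>?X) = 0"
      using eq[OF \<alpha>(1,3,2)] by simp
  qed
  then have "AE x in ?X. k x = C" by eventually_elim simp
  with that show ?thesis by blast
qed


subsection \<open>Weak derivatives in one variable\<close>

abbreviation borel_on :: "'a::euclidean_space set \<Rightarrow> 'a measure" where
  "borel_on S \<equiv> restrict_space lborel S"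

text \<open>Completion adds sets but does not change the measure of Borel sets, hence integrals of
  Borel functions agree for both measures.\<close>

lemma borel_on_subalgebra:
  assumes "S \<in> sets borel"
  shows "sets (borel_on S) \<subseteq> sets (lebesgue_on S)" "space (borel_on S) = space (lebesgue_on S)"
    "A \<in> sets (borel_on S) \<Longrightarrow> emeasure (borel_on S) A = emeasure (lebesgue_on S) A"
proof -
  show "sets (borel_on S) \<subseteq> sets (lebesgue_on S)"
    by (rule mono_restrict_space) (blast intro: sets_completionI_sets)
  show "space (borel_on S) = space (lebesgue_on S)" by (simp add: space_restrict_space)
  assume "A \<in> sets (borel_on S)"
  then have "A \<subseteq> S" "A \<in> sets borel" using assms by (auto simp: sets_restrict_space)
  then show "emeasure (borel_on S) A = emeasure (lebesgue_on S) A"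
    using assms by (simp add: emeasure_restrict_space)
qed

lemma measurable_lebesgue_onI:
  "S \<in> sets borel \<Longrightarrow> f \<in> borel_measurable (borel_on S) \<Longrightarrow> f \<in> borel_measurable (lebesgue_on S)"
  by (rule borel_measurable_subalgebra[OF borel_on_subalgebra(1,2)])

lemma integral_lebesgue_on_borel:
  "S \<in> sets borel \<Longrightarrow> f \<in> borel_measurable (borel_on S) \<Longrightarrow> integral\<^sup>L (lebesgue_on S) f = integral\<^sup>L (borel_on S) f"
  for f :: "'a::euclidean_space \<Rightarrow> real"
  by (rule integral_subalgebra[OF _ borel_on_subalgebra, symmetric])

lemma integrable_lebesgue_on_borel:
  "S \<in> sets borel \<Longrightarrow> f \<in> borel_measurable (borel_on S) \<Longrightarrow> integrable (lebesgue_on S) f \<longleftrightarrow> integrable (borel_on S) f"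
  for f :: "'a::euclidean_space \<Rightarrow> real"
  by (rule integrable_subalgebra[OF _ borel_on_subalgebra, symmetric])

lemma AE_lebesgue_on_borel:
  assumes "S \<in> sets borel"
  shows "(AE x in lebesgue_on S. P x) \<longleftrightarrow> (AE x in borel_on S. P x)"
  using assms by (simp add: AE_restrict_space_iff AE_completion_iff)

lemma AE_lebesgue_ival: "(AE x in lebesgue_on {a<..<b}. P x) \<longleftrightarrow> (AE x in ival a b. P x)"
  unfolding ival_def by (rule AE_lebesgue_on_borel) simp

lemma borel_representative:
  fixes f :: "'a::euclidean_space \<Rightarrow> real"
  assumes S: "S \<in> sets borel" and f: "f \<in> borel_measurable (lebesgue_on S)"
  obtains f' where "f' \<in> borel_measurable (borel_on S)" "AE x in lebesgue_on S. f x = f' x"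
proof -
  have "(\<lambda>x. indicator S x * f x) \<in> borel_measurable (completion lborel)"
    using f borel_measurable_restrict_space_iff[of S "completion lborel" f] S by simp
  from completion_ex_borel_measurable_real[OF this]
  obtain f' where f': "f' \<in> borel_measurable lborel" "AE x in lborel. indicator S x * f x = f' x" by auto
  have "AE x in lborel. x \<in> S \<longrightarrow> f x = f' x"
    using f'(2) by eventually_elim auto
  then have "AE x in lebesgue_on S. f x = f' x"
    unfolding AE_lebesgue_on_borel[OF S] using S by (simp add: AE_restrict_space_iff)
  moreover have "f' \<in> borel_measurable (borel_on S)"
    using f'(1) by (intro measurable_restrict_space1) simp
  ultimately show ?thesis using that by blast
qed

lemma L2_iff_borel:
  "S \<in> sets borel \<Longrightarrow> f \<in> borel_measurable (borel_on S) \<Longrightarrow> f \<in> L2 S \<longleftrightarrow> f \<in> sqi (borel_on S)"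
  by (auto simp: L2_eq_sqi sqi_def integrable_lebesgue_on_borel measurable_lebesgue_onI)

lemma L2_borel_representative:
  fixes f :: "'a::euclidean_space \<Rightarrow> real"
  assumes S: "S \<in> sets borel" and f: "f \<in> L2 S"
  obtains f' where "f' \<in> sqi (borel_on S)" "AE x in lebesgue_on S. f x = f' x"
proof -
  obtain f' where f': "f' \<in> borel_measurable (borel_on S)" "AE x in lebesgue_on S. f x = f' x"
    by (rule borel_representative[OF S]) (use f in \<open>auto simp: L2_def\<close>)
  have "f' \<in> L2 S"
    unfolding L2_eq_sqi using f[unfolded L2_eq_sqi] measurable_lebesgue_onI[OF S f'(1)] f'(2)
    by (rule sqi_cong_AE)
  then have "f' \<in> sqi (borel_on S)" using L2_iff_borel[OF S f'(1)] by simp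
  then show ?thesis using f'(2) by (rule that)
qed

lemma sqi_L2: "S \<in> sets borel \<Longrightarrow> f \<in> sqi (borel_on S) \<Longrightarrow> f \<in> L2 S"
  using L2_iff_borel[of S f] by (auto simp: sqi_def)

lemma inner_lebesgue_on_borel:
  assumes S: "S \<in> sets borel" and "f \<in> L2 S" "g \<in> L2 S" "f' \<in> sqi (borel_on S)" "g' \<in> sqi (borel_on S)"
    and "AE x in lebesgue_on S. f x = f' x" "AE x in lebesgue_on S. g x = g' x"
  shows "inner_L2 (lebesgue_on S) f g = inner_L2 (borel_on S) f' g'"
proof -
  have "inner_L2 (lebesgue_on S) f g = inner_L2 (lebesgue_on S) f' g'"
    using assms sqi_L2[OF S] by (intro inner_L2_cong_AE) (auto simp: L2_def)
  also have "\<dots> = inner_L2 (borel_on S) f' g'"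
    unfolding inner_L2_def using assms sqi_measurable by (intro integral_lebesgue_on_borel) auto
  finally show ?thesis .
qed

lemma test_function_sqi:
  assumes "test_function a b \<eta>"
  shows "\<eta> \<in> sqi (ival a b)" "deriv \<eta> \<in> sqi (ival a b)"
proof -
  interpret finite_measure "ival a b" by (rule finite_measure_ival)
  have c: "continuous_on S \<eta>" "continuous_on S (deriv \<eta>)" for S
    using test_function_deriv[OF assms] by (auto intro!: continuous_at_imp_continuous_on)
  have *: "f \<in> sqi (ival a b)" if f: "continuous_on UNIV f" for f :: "real \<Rightarrow> real"
  proof -
    have "compact (f ` {a..b})"
      by (rule compact_continuous_image[OF continuous_on_subset[OF f]]) auto
    then obtain c where "\<forall>y\<in>f ` {a..b}. norm y \<le> c"
      using compact_imp_bounded bounded_iff by metis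
    then show ?thesis
      by (intro sqi_bounded[of _ c]) (auto intro!: measurable_ival borel_measurable_continuous_onI f)
  qed
  show "\<eta> \<in> sqi (ival a b)" "deriv \<eta> \<in> sqi (ival a b)" by (intro * c)+
qed

lemma kop_future_deriv:
  assumes "test_function a b \<eta>" "t \<in> {a<..<b}"
  shows "kop (ival a b) future (deriv \<eta>) t = - \<eta> t"
proof -
  have "kop (ival a b) future (deriv \<eta>) t = (\<integral>x. indicator {t<..<b} x * deriv \<eta> x \<partial>ival a b)"
    unfolding kop_def by (rule Bochner_Integration.integral_cong) (auto simp: past_def)
  also have "\<dots> = \<eta> b - \<eta> t"
    by (rule integral_FTC_ival) (use test_function_deriv[OF assms(1)] assms in auto)
  finally show ?thesis using test_function_zero[OF assms(1), of b] by simp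
qed

text \<open>Integration by parts as an adjointness: the adjoint of the primitive is the integral up
  to \<open>b\<close>, which sends \<open>deriv \<eta>\<close> to \<open>-\<eta>\<close> because
  \<eta> vanishes at \<open>b\<close>.\<close>

lemma inner_kop_past_test:
  assumes "test_function a b \<eta>" "g \<in> sqi (ival a b)"
  shows "inner_L2 (ival a b) (kop (ival a b) past g) (deriv \<eta>) = - inner_L2 (ival a b) g \<eta>"
proof -
  interpret finite_measure "ival a b" by (rule finite_measure_ival)
  have "inner_L2 (ival a b) (kop (ival a b) past g) (deriv \<eta>) = inner_L2 (ival a b) g (kop (ival a b) future (deriv \<eta>))"
    by (rule kop_adjoint[OF kernel_past assms(2) test_function_sqi(2)[OF assms(1)]])
  also have "\<dots> = inner_L2 (ival a b) g (\<lambda>t. - \<eta> t)"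
    unfolding inner_L2_def
    by (rule Bochner_Integration.integral_cong) (auto simp: kop_future_deriv[OF assms(1)])
  finally show ?thesis by (simp add: inner_L2_uminus)
qed

lemma integral_deriv_test:
  assumes "test_function a b \<eta>" "a < b"
  shows "(\<integral>x. deriv \<eta> x \<partial>ival a b) = 0"
proof -
  have "(\<integral>x. deriv \<eta> x \<partial>ival a b) = (\<integral>x. indicator {a<..<b} x * deriv \<eta> x \<partial>ival a b)"
    by (rule Bochner_Integration.integral_cong) auto
  also have "\<dots> = \<eta> b - \<eta> a"
    by (rule integral_FTC_ival) (use test_function_deriv[OF assms(1)] assms in auto)
  finally show ?thesis using test_function_zero[OF assms(1), of b] test_function_zero[OF assms(1), of a] by simp
qed

lemma weak_deriv_borel:
  assumes "f \<in> L2 {a<..<b}" "g \<in> L2 {a<..<b}" "f' \<in> sqi (ival a b)" "g' \<in> sqi (ival a b)"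
    "AE x in lebesgue_on {a<..<b}. f x = f' x" "AE x in lebesgue_on {a<..<b}. g x = g' x"
  shows "weak_deriv a b f g \<longleftrightarrow>
    (\<forall>\<eta>. test_function a b \<eta> \<longrightarrow> inner_L2 (ival a b) f' (deriv \<eta>) = - inner_L2 (ival a b) g' \<eta>)"
proof -
  have "(\<integral>x. f x * deriv \<eta> x \<partial>lebesgue_on {a<..<b}) = inner_L2 (ival a b) f' (deriv \<eta>)"
    "(\<integral>x. g x * \<eta> x \<partial>lebesgue_on {a<..<b}) = inner_L2 (ival a b) g' \<eta>" if "test_function a b \<eta>" for \<eta>
  proof -
    note t = test_function_sqi[OF that, unfolded ival_def]
    note t' = sqi_L2[OF _ t(1)] sqi_L2[OF _ t(2)]
    show "(\<integral>x. f x * deriv \<eta> x \<partial>lebesgue_on {a<..<b}) = inner_L2 (ival a b) f' (deriv \<eta>)"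
      using inner_lebesgue_on_borel[OF _ assms(1) t'(2) assms(3)[unfolded ival_def] t(2) assms(5)]
      by (simp add: inner_L2_def ival_def)
    show "(\<integral>x. g x * \<eta> x \<partial>lebesgue_on {a<..<b}) = inner_L2 (ival a b) g' \<eta>"
      using inner_lebesgue_on_borel[OF _ assms(2) t'(1) assms(4)[unfolded ival_def] t(1) assms(6)]
      by (simp add: inner_L2_def ival_def)
  qed
  then show ?thesis using assms by (auto simp: weak_deriv_def)
qed

text \<open>\<open>f\<close> minus the primitive of its weak derivative has integral 0 against the
  derivative of every test function, so du Bois-Reymond makes it constant.\<close>

lemma weak_deriv_imp_primitive:
  assumes ab: "a < b" and w: "weak_deriv a b f g"
    and g': "g' \<in> sqi (ival a b)" "AE x in lebesgue_on {a<..<b}. g x = g' x"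
  obtains c where "AE x in lebesgue_on {a<..<b}. f x = c + kop (ival a b) past g' x"
proof -
  interpret finite_measure "ival a b" by (rule finite_measure_ival)
  let ?X = "ival a b" and ?P = "kop (ival a b) past g'"
  have L2: "f \<in> L2 {a<..<b}" "g \<in> L2 {a<..<b}" using w by (auto simp: weak_deriv_def)
  obtain f' where f': "f' \<in> sqi ?X" "AE x in lebesgue_on {a<..<b}. f x = f' x"
    using L2_borel_representative[OF _ L2(1)] unfolding ival_def by auto
  have P: "?P \<in> sqi ?X" by (rule kop_sqi[OF kernel_past g'(1)])
  obtain c where "AE x in ?X. f' x - ?P x = c"
  proof (rule du_Bois_Reymond[OF ab sqi_integrable[OF sqi_diff[OF f'(1) P]]])
    fix \<eta> assume t: "test_function a b \<eta>"
    have "inner_L2 ?X f' (deriv \<eta>) = - inner_L2 ?X g' \<eta>"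
      using w weak_deriv_borel[OF L2 f'(1) g'(1) f'(2) g'(2)] t by auto
    then have "inner_L2 ?X (\<lambda>x. f' x - ?P x) (deriv \<eta>) = 0"
      using inner_kop_past_test[OF t g'(1)] f' P test_function_sqi[OF t] by (simp add: inner_L2_diff)
    then show "(\<integral>x. (f' x - ?P x) * deriv \<eta> x \<partial>?X) = 0" by (simp add: inner_L2_def)
  qed
  then have "AE x in lebesgue_on {a<..<b}. f' x - ?P x = c"
    by (simp add: AE_lebesgue_ival)
  then have "AE x in lebesgue_on {a<..<b}. f x = c + ?P x"
    using f'(2) by eventually_elim simp
  then show ?thesis by (rule that)
qed

lemma primitive_imp_weak_deriv:
  assumes ab: "a < b" and g: "g \<in> sqi (ival a b)" and f: "\<And>x. x \<in> {a<..<b} \<Longrightarrow> f x = c + kop (ival a b) past g x"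
  shows "weak_deriv a b f g"
proof -
  interpret finite_measure "ival a b" by (rule finite_measure_ival)
  let ?X = "ival a b" and ?P = "kop (ival a b) past g"
  have P: "?P \<in> sqi ?X" by (rule kop_sqi[OF kernel_past g])
  have c: "(\<lambda>_. c) \<in> sqi ?X" by (rule sqi_bounded[of _ "\<bar>c\<bar>"]) auto
  have cP: "(\<lambda>x. c + ?P x) \<in> sqi ?X" by (rule sqi_add[OF c P])
  have f': "f \<in> sqi ?X"
  proof (rule sqi_cong_AE[OF cP])
    show "f \<in> borel_measurable ?X"
      using sqi_measurable[OF cP] measurable_cong[of ?X f "\<lambda>x. c + ?P x" borel] f by simp
  qed (use f in \<open>auto intro!: AE_I2\<close>)
  have "inner_L2 ?X f (deriv \<eta>) = - inner_L2 ?X g \<eta>" if t: "test_function a b \<eta>" for \<eta>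
  proof -
    have "inner_L2 ?X f (deriv \<eta>) = inner_L2 ?X (\<lambda>x. c + ?P x) (deriv \<eta>)"
      unfolding inner_L2_def by (rule Bochner_Integration.integral_cong) (auto simp: f)
    also have "\<dots> = c * (\<integral>x. deriv \<eta> x \<partial>?X) - inner_L2 ?X g \<eta>"
      using inner_kop_past_test[OF t g] c P test_function_sqi[OF t]
      by (simp add: inner_L2_add) (simp add: inner_L2_def)
    finally show ?thesis using integral_deriv_test[OF t ab] by simp
  qed
  moreover have "f \<in> L2 {a<..<b}" "g \<in> L2 {a<..<b}"
    using f' g by (auto intro: sqi_L2 simp: ival_def)
  ultimately show ?thesis using weak_deriv_borel[of f a b g f g] f' g by auto
qed

text \<open>Dominated convergence: \<open>past (x n) s\<close> is eventually equal to
  \<open>past y s\<close> for all \<open>s\<close> other than \<open>y\<close>. Nothing confines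
  \<open>S\<close> to the interval, which gives continuity at its end points too.\<close>

lemma kop_past_continuous:
  assumes g: "g \<in> sqi (ival a b)"
  shows "continuous_on S (kop (ival a b) past g)"
  unfolding continuous_on_sequentially
proof (intro allI ballI impI)
  interpret finite_measure "ival a b" by (rule finite_measure_ival)
  fix x :: "nat \<Rightarrow> real" and y assume x: "(\<forall>n. x n \<in> S) \<and> x \<longlonglongrightarrow> y"
  show "(kop (ival a b) past g \<circ> x) \<longlonglongrightarrow> kop (ival a b) past g y"
    unfolding o_def kop_def
  proof (rule integral_dominated_convergence[where w = "\<lambda>s. \<bar>g s\<bar>"])
    show "AE s in ival a b. (\<lambda>n. past (x n) s * g s) \<longlonglongrightarrow> past y s * g s"
      using AE_ival_neq[of y]
    proof eventually_elim
      case (elim s)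
      have "\<forall>\<^sub>F n in sequentially. past (x n) s = past y s"
      proof (cases "s < y")
        case True
        then have "\<forall>\<^sub>F n in sequentially. s < x n" using x order_tendstoD(1) by blast
        then show ?thesis by eventually_elim (use True in \<open>simp add: past_def\<close>)
      next
        case False
        then have "\<forall>\<^sub>F n in sequentially. x n < s" using x order_tendstoD(2)[of x y _ s] elim by auto
        then show ?thesis by eventually_elim (use False in \<open>simp add: past_def\<close>)
      qed
      then have "(\<lambda>n. past (x n) s) \<longlonglongrightarrow> past y s" by (rule tendsto_eventually)
      then show ?case by (intro tendsto_intros)
    qed
    show "AE s in ival a b. norm (past (x n) s * g s) \<le> \<bar>g s\<bar>" for n
      by (auto simp: past_def)
    show "integrable (ival a b) (\<lambda>s. \<bar>g s\<bar>)" using sqi_integrable[OF g] by simp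
  qed (use g in measurable)
qed

lemma kop_past_has_derivative:
  assumes h: "continuous_on {a..b} h" and x: "x \<in> {a..b}"
  shows "(kop (ival a b) past h has_vector_derivative h x) (at x within {a..b})"
proof -
  have e: "kop (ival a b) past h y = integral {a..y} h" if y: "y \<in> {a..b}" for y
  proof -
    have i: "set_integrable lborel {a..y} h"
      by (rule borel_integrable_atLeastAtMost') (use h y in \<open>auto intro: continuous_on_subset\<close>)
    have "kop (ival a b) past h y = (\<integral>s. indicator {a<..<b} s * (past y s * h s) \<partial>lborel)"
      by (simp add: kop_def integral_ival)
    also have "\<dots> = (LBINT s:{a..y}. h s)"
      unfolding set_lebesgue_integral_def
    proof (rule integral_cong_AE)
      show "AE s in lborel. indicator {a<..<b} s * (past y s * h s) = indicator {a..y} s *\<^sub>R h s"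
        using AE_lborel_singleton[of a] AE_lborel_singleton[of y]
        by eventually_elim (use y in \<open>auto simp: past_def split: split_indicator\<close>)
      show m: "(\<lambda>s. indicator {a..y} s *\<^sub>R h s) \<in> borel_measurable lborel"
        using borel_measurable_integrable[OF i[unfolded set_integrable_def]] .
      have "(\<lambda>s. indicator {a<..<y} s * (indicator {a..y} s *\<^sub>R h s)) \<in> borel_measurable lborel"
        using m by measurable
      moreover have "(\<lambda>s. indicator {a<..<y} s * (indicator {a..y} s *\<^sub>R h s)) = (\<lambda>s. indicator {a<..<b} s * (past y s * h s))"
        using y by (auto simp: past_def split: split_indicator intro!: ext)
      ultimately show "(\<lambda>s. indicator {a<..<b} s * (past y s * h s)) \<in> borel_measurable lborel" by simp
    qed
    also have "\<dots> = integral {a..y} h" by (rule set_borel_integral_eq_integral(2)[OF i])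
    finally show ?thesis .
  qed
  have "((\<lambda>y. integral {a..y} h) has_vector_derivative h x) (at x within {a..b})"
    by (rule integral_has_vector_derivative[OF h x])
  then show ?thesis
    by (rule has_vector_derivative_transform[OF x, rotated]) (simp add: e)
qed

text \<open>The set where they differ inside is open and negligible, hence empty; continuity extends
  equality to the end points.\<close>

lemma AE_ival_eq_imp_eq:
  fixes f g :: "real \<Rightarrow> real"
  assumes ab: "a < b" and f: "continuous_on {a..b} f" "continuous_on {a..b} g"
    and e: "AE x in lebesgue_on {a<..<b}. f x = g x" and x: "x \<in> {a..b}"
  shows "f x = g x"
proof -
  let ?U = "{x \<in> {a<..<b}. f x - g x \<in> - {0}}"
  have "continuous_on {a<..<b} (\<lambda>x. f x - g x)"
    by (intro continuous_intros continuous_on_subset[OF f(1)] continuous_on_subset[OF f(2)]) auto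
  then have "open ({a<..<b} \<inter> (\<lambda>x. f x - g x) -` (- {0}))"
    by (intro continuous_open_preimage) auto
  then have U: "open ?U" by (simp add: vimage_def Int_def)
  have "AE x in lebesgue. x \<notin> ?U"
    using e unfolding AE_lebesgue_ival AE_ival_iff AE_completion_iff by eventually_elim auto
  then have "negligible ?U"
    unfolding eventually_ae_filter_negligible by (auto intro: negligible_subset)
  with U have "?U = {}" using open_not_negligible by blast
  then have "{a<..<b} \<subseteq> {x\<in>{a..b}. f x - g x = 0}" by auto
  then have "closure {a<..<b} \<subseteq> {x\<in>{a..b}. f x - g x = 0}"
    by (rule closure_minimal)
      (intro continuous_closed_preimage_constant continuous_intros f closed_real_atLeastAtMost)
  then show ?thesis using ab x by auto
qed


subsection \<open>The Green operator\<close>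

text \<open>
  The Green kernel of \<open>v'' = f\<close>, \<open>v(0) = v(l) = 0\<close>, its \<open>x\<close>-derivative, and the kernels of the
  functionals \<open>v'(0)\<close> and \<open>v'(l)\<close>.
\<close>

definition green0 :: "real \<Rightarrow> real \<Rightarrow> real" where "green0 l y = y / l - 1"
definition greenl :: "real \<Rightarrow> real \<Rightarrow> real" where "greenl l y = y / l"
definition green' :: "real \<Rightarrow> real \<Rightarrow> real \<Rightarrow> real" where "green' l x y = green0 l y + past x y"
definition green :: "real \<Rightarrow> real \<Rightarrow> real \<Rightarrow> real" where "green l x y = x * green0 l y + past x y * (x - y)"

lemma green_measurable [measurable]:
  "(\<lambda>(x,y). green l x y) \<in> borel_measurable borel" "(\<lambda>(x,y). green' l x y) \<in> borel_measurable borel"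
  "green0 l \<in> borel_measurable borel" "greenl l \<in> borel_measurable borel"
  "green l x \<in> borel_measurable borel" "green' l x \<in> borel_measurable borel"
proof -
  have "(\<lambda>(x,y). green l x y) \<in> borel_measurable (borel \<Otimes>\<^sub>M borel)"
    "(\<lambda>(x,y). green' l x y) \<in> borel_measurable (borel \<Otimes>\<^sub>M borel)"
    unfolding green_def green'_def green0_def past_def by measurable
  then show "(\<lambda>(x,y). green l x y) \<in> borel_measurable borel" "(\<lambda>(x,y). green' l x y) \<in> borel_measurable borel"
    by (simp_all add: borel_prod)
  show "green0 l \<in> borel_measurable borel" "greenl l \<in> borel_measurable borel"
    "green l x \<in> borel_measurable borel" "green' l x \<in> borel_measurable borel"
    unfolding green_def green'_def green0_def greenl_def past_def by measurable
qed

lemma green_bounds: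
  assumes "l > 0" "y \<in> {0<..<l}"
  shows "x \<in> {0..l} \<Longrightarrow> \<bar>green l x y\<bar> \<le> l / 4" "\<bar>green' l x y\<bar> \<le> 1" "\<bar>green0 l y\<bar> \<le> 1" "\<bar>greenl l y\<bar> \<le> 1"
proof -
  have y: "0 \<le> y / l" "y / l \<le> 1" using assms by auto
  then show "\<bar>green' l x y\<bar> \<le> 1" "\<bar>green0 l y\<bar> \<le> 1" "\<bar>greenl l y\<bar> \<le> 1"
    by (auto simp: green'_def green0_def greenl_def past_def)
  \<comment> \<open>The maximum at the midpoint; it is the source of the bound \<open>l / 4\<close>
    for the Green kernel.\<close>
  have q: "z * (l - z) \<le> l * l / 4" for z
    using zero_le_power2[of "z - l / 2"] by (simp add: power2_eq_square algebra_simps)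
  assume x: "x \<in> {0..l}"
  show "\<bar>green l x y\<bar> \<le> l / 4"
  proof (cases "y < x")
    case True
    have e: "green l x y = - (y * (l - x) / l)" using True assms by (simp add: green_def green0_def past_def field_simps)
    have "y * (l - x) \<le> x * (l - x)" using True x by (intro mult_right_mono) auto
    with q[of x] have "y * (l - x) \<le> l * l / 4" by linarith
    then have "y * (l - x) / l \<le> l / 4" using assms by (simp add: field_simps)
    moreover have "0 \<le> y * (l - x) / l" using x assms by auto
    ultimately show ?thesis unfolding e by linarith
  next
    case False
    have e: "green l x y = - (x * (l - y) / l)" using False assms by (simp add: green_def green0_def past_def field_simps)
    have "x * (l - y) \<le> y * (l - y)" using False assms by (intro mult_right_mono) auto
    with q[of y] have "x * (l - y) \<le> l * l / 4" by linarith
    then have "x * (l - y) / l \<le> l / 4" using assms by (simp add: field_simps)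
    moreover have "0 \<le> x * (l - y) / l" using x assms by auto
    ultimately show ?thesis unfolding e by linarith
  qed
qed

lemma kernel_green:
  assumes "l > 0"
  shows "kernel (ival 0 l) (green l) (l / 4)" "kernel (ival 0 l) (green' l) 1"
    "kernel (ival 0 l) (\<lambda>x. green0 l) 1" "kernel (ival 0 l) (\<lambda>x. greenl l) 1"
proof -
  have "(\<lambda>(x::real,y). green0 l y) \<in> borel_measurable borel" "(\<lambda>(x::real,y). greenl l y) \<in> borel_measurable borel"
    by (auto simp: split_def borel_prod[symmetric])
  then show "kernel (ival 0 l) (green l) (l / 4)" "kernel (ival 0 l) (green' l) 1"
    "kernel (ival 0 l) (\<lambda>x. green0 l) 1" "kernel (ival 0 l) (\<lambda>x. greenl l) 1"
    using green_bounds[OF assms] green_measurable(1,2)[of l] assms by (auto intro!: kernel_ival)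
qed

lemma integral_past:
  assumes "x \<in> {a..b}"
  shows "(\<integral>s. past x s \<partial>ival a b) = x - a"
proof -
  have "(\<integral>s. past x s \<partial>ival a b) = (\<integral>s. indicator {a<..<x} s \<partial>lborel)"
    unfolding integral_ival using assms
    by (intro Bochner_Integration.integral_cong) (auto simp: past_def split: split_indicator)
  then show ?thesis using assms by simp
qed

lemma integral_past_past:
  assumes "x \<in> {a..b}" "y \<in> {a<..<b}"
  shows "(\<integral>s. past s y * past x s \<partial>ival a b) = past x y * (x - y)"
proof -
  have "(\<integral>s. past s y * past x s \<partial>ival a b) = (\<integral>s. indicator {y<..<x} s \<partial>lborel)"
    unfolding integral_ival using assms
    by (intro Bochner_Integration.integral_cong) (auto simp: past_def split: split_indicator)
  then show ?thesis using assms by (simp add: past_def)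
qed

context
  fixes l :: real and f :: "real \<Rightarrow> real"
  assumes l: "l > 0" and f: "f \<in> sqi (ival 0 l)"
begin

interpretation X: finite_measure "ival 0 l" by (rule finite_measure_ival)

lemma kop_green': "kop (ival 0 l) (green' l) f x = (\<integral>y. green0 l y * f y \<partial>ival 0 l) + kop (ival 0 l) past f x"
proof -
  have "integrable (ival 0 l) (\<lambda>y. green0 l y * f y)" "integrable (ival 0 l) (\<lambda>y. past x y * f y)"
    using green_bounds(3)[OF l] green_measurable(3)[of l] past_section(1)[of x 0 l]
    by (auto intro!: X.integrable_bounded_mult[OF f, where c = 1] intro: measurable_ival simp: past_bounds)
  then show ?thesis by (simp add: kop_def green'_def distrib_right)
qed

text \<open>The value at \<open>x\<close> of the primitive is an inner product with
  \<open>past x\<close>. Moving \<open>green'\<close> to that factor by adjointness and computing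
  its action on \<open>past x\<close> produces \<open>green l x\<close>.\<close>

lemma kop_green:
  assumes x: "x \<in> {0..l}"
  shows "kop (ival 0 l) (green l) f x = kop (ival 0 l) past (kop (ival 0 l) (green' l) f) x"
proof -
  let ?X = "ival 0 l"
  have p: "past x \<in> sqi ?X" by (rule X.sqi_bounded[of _ 1]) (auto simp: past_bounds)
  have e: "kop ?X (\<lambda>s y. green' l y s) (past x) y = green l x y" if y: "y \<in> {0<..<l}" for y
  proof -
    have "kop ?X (\<lambda>s y. green' l y s) (past x) y = (\<integral>s. green0 l y * past x s + past s y * past x s \<partial>?X)"
      by (simp add: kop_def green'_def distrib_right)
    also have "\<dots> = (\<integral>s. green0 l y * past x s \<partial>?X) + (\<integral>s. past s y * past x s \<partial>?X)"
      by (intro Bochner_Integration.integral_add X.integrable_bounded_mult[OF p, where c = 1] integrable_mult_right X.sqi_integrable[OF p])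
        (auto simp: past_bounds)
    also have "\<dots> = green l x y"
      using x y by (simp add: integral_past integral_past_past green_def)
    finally show ?thesis .
  qed
  have "kop ?X past (kop ?X (green' l) f) x = inner_L2 ?X (kop ?X (green' l) f) (past x)"
    by (simp add: kop_def inner_L2_def mult.commute)
  also have "\<dots> = inner_L2 ?X f (kop ?X (\<lambda>s y. green' l y s) (past x))"
    by (rule X.kop_adjoint[OF kernel_green(2)[OF l] f p])
  also have "\<dots> = inner_L2 ?X f (green l x)"
    unfolding inner_L2_def by (rule Bochner_Integration.integral_cong) (auto simp: e)
  finally show ?thesis by (simp add: kop_def inner_L2_def mult.commute)
qed

lemma kop_green'_sqi: "kop (ival 0 l) (green' l) f \<in> sqi (ival 0 l)"
  by (rule X.kop_sqi[OF kernel_green(2)[OF l] f])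

lemma kop_green'_continuous: "continuous_on S (kop (ival 0 l) (green' l) f)"
  unfolding kop_green'[abs_def] by (intro continuous_intros kop_past_continuous f)

lemma kop_green_continuous: "continuous_on {0..l} (kop (ival 0 l) (green l) f)"
  using kop_past_continuous[OF kop_green'_sqi, of "{0..l}"]
  by (rule continuous_on_eq) (simp add: kop_green)

lemma kop_green_boundary: "kop (ival 0 l) (green l) f 0 = 0" "kop (ival 0 l) (green l) f l = 0"
proof -
  have "green l 0 y = 0" "green l l y = 0" if "y \<in> {0<..<l}" for y
    using that l by (auto simp: green_def green0_def past_def field_simps)
  then show "kop (ival 0 l) (green l) f 0 = 0" "kop (ival 0 l) (green l) f l = 0"
    unfolding kop_def by (auto intro!: integral_eq_zero_AE AE_I2)
qed

lemma green_derivative: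
  assumes x: "x \<in> {0..l}"
  shows "vector_derivative (kop (ival 0 l) (green l) f) (at x within {0..l}) = kop (ival 0 l) (green' l) f x"
proof -
  have "(kop (ival 0 l) past (kop (ival 0 l) (green' l) f) has_vector_derivative kop (ival 0 l) (green' l) f x) (at x within {0..l})"
    by (rule kop_past_has_derivative[OF kop_green'_continuous x])
  then have "(kop (ival 0 l) (green l) f has_vector_derivative kop (ival 0 l) (green' l) f x) (at x within {0..l})"
    by (rule has_vector_derivative_transform[OF x, rotated]) (simp add: kop_green)
  then show ?thesis using vector_derivative_within_cbox[of 0 l x] l x by (simp add: cbox_interval)
qed

lemma kop_green'_ends:
  "kop (ival 0 l) (green' l) f 0 = (\<integral>y. green0 l y * f y \<partial>ival 0 l)"
  "kop (ival 0 l) (green' l) f l = (\<integral>y. greenl l y * f y \<partial>ival 0 l)"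
  unfolding kop_def
  by (rule Bochner_Integration.integral_cong; auto simp: green'_def past_def green0_def greenl_def)+

lemma green_weak_deriv:
  "weak_deriv 0 l (kop (ival 0 l) (green l) f) (kop (ival 0 l) (green' l) f)"
  "weak_deriv 0 l (kop (ival 0 l) (green' l) f) f"
  by (rule primitive_imp_weak_deriv[OF l kop_green'_sqi, of _ 0]; simp add: kop_green)
    (rule primitive_imp_weak_deriv[OF l f kop_green'])

lemma green_V2: "kop (ival 0 l) (green l) f \<in> V2 l"
  unfolding V2_def H2_def using green_weak_deriv kop_green_continuous kop_green_boundary by auto

text \<open>Passing twice from weak derivative to primitive leaves an undetermined affine function
  \<open>d + c' * x\<close>, which the two boundary values annihilate. For \<open>v\<close>, which
  is continuous, the equality holds at every point; for \<open>v1\<close> it holds almost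
  everywhere.\<close>

lemma V2_eq_green:
  assumes v: "v \<in> V2 l" and w: "weak_deriv 0 l v v1" "weak_deriv 0 l v1 v2"
    and e: "AE x in lebesgue_on {0<..<l}. v2 x = f x"
  shows "x \<in> {0..l} \<Longrightarrow> v x = kop (ival 0 l) (green l) f x"
    "AE x in lebesgue_on {0<..<l}. v1 x = kop (ival 0 l) (green' l) f x"
proof -
  let ?X = "ival 0 l"
  have vc: "continuous_on {0..l} v" "v 0 = 0" "v l = 0" using v by (auto simp: V2_def)
  let ?g = "kop ?X (green' l) f"
  obtain c where c: "AE x in lebesgue_on {0<..<l}. v1 x = c + kop ?X past f x"
    by (rule weak_deriv_imp_primitive[OF l w(2) f e])
  \<comment> \<open>\<open>kop ?X (green' l) f\<close> already contains the constant that
    corresponds to the slope at 0, so only the excess of \<open>c\<close> over it remains.\<close>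
  define c' where "c' = c - (\<integral>y. green0 l y * f y \<partial>?X)"
  have c': "AE x in lebesgue_on {0<..<l}. v1 x = c' + ?g x"
    using c by eventually_elim (simp add: c'_def kop_green')
  have c'_sqi: "(\<lambda>_. c') \<in> sqi ?X" by (rule X.sqi_bounded[of _ "\<bar>c'\<bar>"]) auto
  have s: "(\<lambda>x. c' + ?g x) \<in> sqi ?X" by (rule sqi_add[OF c'_sqi kop_green'_sqi])
  obtain d where d: "AE x in lebesgue_on {0<..<l}. v x = d + kop ?X past (\<lambda>x. c' + ?g x) x"
    by (rule weak_deriv_imp_primitive[OF l w(1) s c'])
  have v_eq: "v x = d + kop ?X past (\<lambda>x. c' + ?g x) x" if "x \<in> {0..l}" for x
    by (rule AE_ival_eq_imp_eq[OF l vc(1) _ d that]) (intro continuous_intros kop_past_continuous s)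
  have k: "kop ?X past (\<lambda>x. c' + ?g x) x = c' * x + kop ?X (green l) f x" if x: "x \<in> {0..l}" for x
  proof -
    have "integrable ?X (\<lambda>s. past x s * ?g s)"
      by (rule X.integrable_bounded_mult[OF kop_green'_sqi, where c = 1]) (auto simp: past_bounds)
    moreover have "integrable ?X (past x)"
      by (rule X.integrable_const_bound[of _ 1]) (auto simp: past_bounds)
    ultimately show ?thesis
      using x by (simp add: kop_green) (simp add: kop_def distrib_left integral_past)
  qed
  have "d = 0" using v_eq[of 0] k[of 0] vc l kop_green_boundary by simp
  moreover have "c' = 0" using v_eq[of l] k[of l] vc l kop_green_boundary \<open>d = 0\<close> by simp
  ultimately show "x \<in> {0..l} \<Longrightarrow> v x = kop ?X (green l) f x"
    "AE x in lebesgue_on {0<..<l}. v1 x = ?g x"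
    using v_eq k c' by auto
qed

end


subsection \<open>Functions on the rectangle\<close>

text \<open>The identification of the product with two-dimensional Lebesgue measure; it depends on
  working with Borel sets, since a product of completed measures is not complete.\<close>

lemma pair_ival: "ival a b \<Otimes>\<^sub>M ival c d = borel_on ({a<..<b} \<times> {c<..<d})"
proof (rule pair_measure_eqI)
  show "sigma_finite_measure (ival a b)" "sigma_finite_measure (ival c d)"
    using finite_measure_ival finite_measure.axioms by blast+
  let ?S = "{a<..<b} \<times> {c<..<d}"
  have S: "?S \<in> sets borel" by (intro borel_open open_Times) auto
  have AB: "A \<in> sets borel" "A \<subseteq> {a<..<b}" if "A \<in> sets (ival a b)" for A a b
    using that by (auto simp: ival_def sets_restrict_space)
  have times: "A \<times> B \<in> sets borel" if "A \<in> sets borel" "B \<in> sets borel" for A B :: "real set"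
    using that by (simp add: borel_prod[symmetric])
  show "sets (ival a b \<Otimes>\<^sub>M ival c d) = sets (borel_on ?S)"
  proof
    show "sets (ival a b \<Otimes>\<^sub>M ival c d) \<subseteq> sets (borel_on ?S)"
      unfolding sets_pair_measure
    proof (rule sets.sigma_sets_subset'[of _ "borel_on ?S", simplified space_restrict_space])
      show "{A \<times> B |A B. A \<in> sets (ival a b) \<and> B \<in> sets (ival c d)} \<subseteq> sets (borel_on ?S)"
      proof safe
        fix A B assume "A \<in> sets (ival a b)" "B \<in> sets (ival c d)"
        from AB[OF this(1)] AB[OF this(2)] show "A \<times> B \<in> sets (borel_on ?S)"
          using S times by (auto simp: sets_restrict_space_iff)
      qed
      show "space (ival a b) \<times> space (ival c d) \<in> sets (borel_on ?S)"
        using S by (simp add: sets_restrict_space_iff)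
    qed
    show "sets (borel_on ?S) \<subseteq> sets (ival a b \<Otimes>\<^sub>M ival c d)"
    proof
      fix A assume "A \<in> sets (borel_on ?S)"
      then have A: "A \<in> sets borel" "A \<subseteq> ?S" using S by (auto simp: sets_restrict_space)
      have "indicat_real A \<in> borel_measurable (ival a b \<Otimes>\<^sub>M ival c d)"
        using A by (intro measurable_ival_pair) auto
      then have "A \<inter> space (ival a b \<Otimes>\<^sub>M ival c d) \<in> sets (ival a b \<Otimes>\<^sub>M ival c d)"
        by (simp add: borel_measurable_indicator_iff)
      then show "A \<in> sets (ival a b \<Otimes>\<^sub>M ival c d)"
        using A by (simp add: space_pair_measure Int_absorb2)
    qed
  qed
  fix A B assume "A \<in> sets (ival a b)" "B \<in> sets (ival c d)"
  note AB' = AB[OF this(1)] AB[OF this(2)]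
  have "emeasure (borel_on ?S) (A \<times> B) = emeasure (lborel \<Otimes>\<^sub>M lborel) (A \<times> B)"
    using AB' S by (subst emeasure_restrict_space) (auto simp: lborel_prod)
  also have "\<dots> = emeasure lborel A * emeasure lborel B"
    using AB' by (intro lborel.emeasure_pair_measure_Times) auto
  also have "\<dots> = emeasure (ival a b) A * emeasure (ival c d) B"
    using AB' by (simp add: ival_def emeasure_restrict_space)
  finally show "emeasure (ival a b) A * emeasure (ival c d) B = emeasure (borel_on ?S) (A \<times> B)" by simp
qed

locale strip =
  fixes l T :: real
  assumes l_pos: "l > 0" and T_pos: "T > 0"

sublocale strip \<subseteq> space_time "ival 0 l" T
  by (intro space_time.intro space_time_axioms.intro finite_measure_ival T_pos)

context strip begin

abbreviation "X \<equiv> ival 0 l"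
abbreviation "k \<equiv> opx X (green l)"
abbreviation "k' \<equiv> opx X (green' l)"

lemma M_eq: "M = borel_on (Omega l T)"
  by (simp add: pair_ival Omega_def)

lemma Omega_borel [measurable]: "Omega l T \<in> sets borel"
  unfolding Omega_def by (intro borel_open open_Times) auto

lemma AE_Omega: "(AE z in lebesgue_on (Omega l T). P z) \<longleftrightarrow> (AE z in M. P z)"
  unfolding M_eq by (rule AE_lebesgue_on_borel[OF Omega_borel])

lemma representative:
  assumes "f \<in> L2 (Omega l T)"
  obtains f' where "f' \<in> sqi M" "AE z in M. f z = f' z"
proof -
  obtain f' where f': "f' \<in> sqi (borel_on (Omega l T))" "AE z in lebesgue_on (Omega l T). f z = f' z"
    by (rule L2_borel_representative[OF Omega_borel assms])
  from f'(1) have "f' \<in> sqi M" unfolding M_eq .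
  then show ?thesis by (rule that[OF _ f'(2)[unfolded AE_Omega]])
qed

lemma sqi_L2_Omega: "f \<in> sqi M \<Longrightarrow> f \<in> L2 (Omega l T)"
  unfolding M_eq by (rule sqi_L2[OF Omega_borel])

lemma inner_Omega:
  assumes "f \<in> L2 (Omega l T)" "g \<in> L2 (Omega l T)" "f' \<in> sqi M" "g' \<in> sqi M"
    "AE z in M. f z = f' z" "AE z in M. g z = g' z"
  shows "inner_L2 (lebesgue_on (Omega l T)) f g = inner_L2 M f' g'"
  unfolding M_eq
  by (rule inner_lebesgue_on_borel[OF Omega_borel])
    (use assms in \<open>simp_all add: AE_Omega M_eq[symmetric]\<close>)

text \<open>Null sections imply a null set only for measurable sets; measurability of both functions
  is what allows the order of the variables to be exchanged and the sections to be
  assembled.\<close>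

lemma AE_M_iff:
  assumes "f \<in> borel_measurable M" "g \<in> borel_measurable M"
    and "AE t in Y. AE x in X. f (x,t) = (g (x,t) :: real)"
  shows "AE z in M. f z = g z"
proof -
  have "AE t in Y. AE x in X. f (x,t) - g (x,t) = 0" using assms(3) by simp
  moreover have "{z \<in> space M. f z - g z = 0} \<in> sets M"
    using assms(1,2) by measurable
  ultimately have "AE x in X. AE t in Y. f (x,t) - g (x,t) = 0"
    using AE_commute[of "\<lambda>x t. f (x,t) - g (x,t) = 0"] by (simp add: case_prod_unfold)
  then have "AE z in M. f z - g z = 0"
    using AE_pair_iff[of "\<lambda>x t. f (x,t) - g (x,t) = 0"] \<open>{z \<in> space M. f z - g z = 0} \<in> sets M\<close> by simp
  then show ?thesis by simp
qed

lemma L2_V2_eq_green: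
  assumes w: "L2_V2 l T w wx wxx" and f: "f \<in> sqi M" "AE z in M. wxx z = f z"
  shows "AE z in M. w z = k f z" "AE z in M. wx z = k' f z"
    "AE t in Y. dx_at l w 0 t = (\<integral>y. green0 l y * f (y,t) \<partial>X)"
    "AE t in Y. dx_at l w l t = (\<integral>y. greenl l y * f (y,t) \<partial>X)"
proof -
  have w1: "w \<in> L2 (Omega l T)" "wx \<in> L2 (Omega l T)" "wxx \<in> L2 (Omega l T)"
    and w2: "AE t in Y. (\<lambda>x. w (x,t)) \<in> V2 l \<and>
        weak_deriv 0 l (\<lambda>x. w (x,t)) (\<lambda>x. wx (x,t)) \<and> weak_deriv 0 l (\<lambda>x. wx (x,t)) (\<lambda>x. wxx (x,t))"
    using w unfolding L2_V2_def AE_lebesgue_ival by auto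
  have s: "AE t in Y. (\<forall>x\<in>{0..l}. w (x,t) = k f (x,t)) \<and> (AE x in X. wx (x,t) = k' f (x,t)) \<and>
      (\<lambda>x. f (x,t)) \<in> sqi X"
    using w2 AE_section_snd[OF f(2)] sqi_section_snd[OF f(1)]
  proof eventually_elim
    case (elim t)
    then have e: "AE x in lebesgue_on {0<..<l}. wxx (x,t) = f (x,t)" by (simp only: AE_lebesgue_ival)
    note v = V2_eq_green[OF l_pos elim(3), of "\<lambda>x. w (x,t)" "\<lambda>x. wx (x,t)" "\<lambda>x. wxx (x,t)"]
    show ?case using v elim(1,3) e by (simp add: opx_apply AE_lebesgue_ival)
  qed
  \<comment> \<open>For almost every \<open>t\<close> the equality holds at all \<open>x\<close>, so
    a null set of times suffices and no measurability of \<open>w\<close> enters.\<close>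
  have "AE z in M. \<forall>x\<in>{0..l}. w (x,snd z) = k f (x,snd z)"
    using s by (intro AE_snd[of "\<lambda>t. \<forall>x\<in>{0..l}. w (x,t) = k f (x,t)"]) (auto elim: eventually_mono)
  with AE_space show "AE z in M. w z = k f z"
    by eventually_elim (auto simp: space_pair_measure)
  \<comment> \<open>The exceptional set of \<open>x\<close> may vary with \<open>t\<close>, so here
    a Borel representative is needed to assemble the sections.\<close>
  obtain wx' where wx': "wx' \<in> sqi M" "AE z in M. wx z = wx' z"
    by (rule representative[OF w1(2)])
  have "AE z in M. wx' z = k' f z"
  proof (rule AE_M_iff)
    show "AE t in Y. AE x in X. wx' (x,t) = k' f (x,t)"
      using s AE_section_snd[OF wx'(2)]
    proof eventually_elim
      case (elim t)
      then have "AE x in X. wx (x,t) = k' f (x,t)" by simp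
      with elim(2) show ?case by eventually_elim simp
    qed
  qed (use wx'(1) opx_sqi[OF kernel_green(2)[OF l_pos] f(1)] in measurable)
  with wx'(2) show "AE z in M. wx z = k' f z" by eventually_elim simp
  have d: "dx_at l w x t = kop X (green' l) (\<lambda>y. f (y,t)) x"
    if e: "\<forall>x\<in>{0..l}. w (x,t) = k f (x,t)" and f: "(\<lambda>x. f (x,t)) \<in> sqi X" and x: "x \<in> {0..l}" for x t
  proof -
    have "dx_at l w x t = vector_derivative (kop X (green l) (\<lambda>y. f (y,t))) (at x within {0..l})"
      unfolding dx_at_def using e x
      by (intro vector_derivative_cong_eq) (auto simp: opx_apply eventually_at_filter intro!: always_eventually)
    then show ?thesis using green_derivative[OF l_pos f x] by simp
  qed
  show "AE t in Y. dx_at l w 0 t = (\<integral>y. green0 l y * f (y,t) \<partial>X)"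
    using s by eventually_elim (use d[of _ 0] kop_green'_ends(1)[OF l_pos] l_pos in auto)
  show "AE t in Y. dx_at l w l t = (\<integral>y. greenl l y * f (y,t) \<partial>X)"
    using s by eventually_elim (use d[of _ l] kop_green'_ends(2)[OF l_pos] l_pos in auto)
qed

lemma L2_V2_green:
  assumes f: "f \<in> sqi M"
  shows "L2_V2 l T (k f) (k' f) f"
proof -
  have "AE t in Y. (\<lambda>x. k f (x,t)) \<in> V2 l \<and>
        weak_deriv 0 l (\<lambda>x. k f (x,t)) (\<lambda>x. k' f (x,t)) \<and> weak_deriv 0 l (\<lambda>x. k' f (x,t)) (\<lambda>x. f (x,t))"
    using sqi_section_snd[OF f]
  proof eventually_elim
    case (elim t)
    show ?case
      using green_V2[OF l_pos elim] green_weak_deriv[OF l_pos elim] by (simp add: opx_apply eta_contract_eq)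
  qed
  then show ?thesis
    unfolding L2_V2_def AE_lebesgue_ival
    using f by (auto intro!: sqi_L2_Omega opx_sqi kernel_green[OF l_pos])
qed

text \<open>Integration by parts on almost every line of constant \<open>x\<close>. For
  \<open>I\<close> the roles of the two Volterra kernels are exchanged, which produces the
  sign.\<close>

lemma time_primitive_weak_dt:
  assumes g: "g \<in> sqi M"
  shows "weak_dt l T (L g) g" "weak_dt l T (I g) (\<lambda>z. - g z)"
proof -
  have *: "inner_L2 Y (kop Y future h) (deriv \<eta>) = inner_L2 Y h \<eta>"
    if h: "h \<in> sqi Y" and t: "test_function 0 T \<eta>" for h \<eta>
  proof -
    have e: "kop Y past (deriv \<eta>) x = \<eta> x" if x: "x \<in> {0<..<T}" for x
    proof -
      have "kop Y past (deriv \<eta>) x = (\<integral>s. indicator {0<..<x} s * deriv \<eta> s \<partial>Y)"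
        unfolding kop_def by (rule Bochner_Integration.integral_cong) (auto simp: past_def)
      also have "\<dots> = \<eta> x - \<eta> 0"
        by (rule integral_FTC_ival) (use test_function_deriv[OF t] x in auto)
      finally show ?thesis using test_function_zero[OF t, of 0] by simp
    qed
    have "inner_L2 Y (kop Y future h) (deriv \<eta>) = inner_L2 Y h (kop Y past (deriv \<eta>))"
      by (rule Y.kop_adjoint[OF kernel_future h test_function_sqi(2)[OF t]])
    also have "\<dots> = inner_L2 Y h \<eta>"
      unfolding inner_L2_def by (rule Bochner_Integration.integral_cong) (auto simp: e)
    finally show ?thesis .
  qed
  have int: "(\<integral>t. h t * \<theta> t \<partial>lebesgue_on {0<..<T}) = inner_L2 Y h \<theta>" if "h \<in> sqi Y" "\<theta> \<in> sqi Y" for h \<theta>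
    unfolding inner_L2_def ival_def
    by (rule integral_lebesgue_on_borel) (use that[THEN sqi_measurable] in \<open>auto simp: ival_def\<close>)
  have ae: "AE x in lebesgue_on {0<..<l}. (\<lambda>t. g (x,t)) \<in> sqi Y"
    unfolding AE_lebesgue_ival by (rule sqi_section_fst[OF g])
  have k: "kop Y past h \<in> sqi Y" "kop Y future h \<in> sqi Y" if "h \<in> sqi Y" for h
    using that Y.kop_sqi kernel_past kernel_future by blast+
  show "weak_dt l T (L g) g"
    unfolding weak_dt_def
  proof (intro conjI allI impI)
    fix \<eta> assume t: "test_function 0 T \<eta>"
    show "AE x in lebesgue_on {0<..<l}. (\<integral>t. L g (x,t) * deriv \<eta> t \<partial>lebesgue_on {0<..<T}) = - (\<integral>t. g (x,t) * \<eta> t \<partial>lebesgue_on {0<..<T})"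
      using ae by eventually_elim
        (simp add: opt_apply int k inner_kop_past_test[OF t] test_function_sqi[OF t])
  qed (intro sqi_L2_Omega L_sqi g)+
  show "weak_dt l T (I g) (\<lambda>z. - g z)"
    unfolding weak_dt_def
  proof (intro conjI allI impI)
    fix \<eta> assume t: "test_function 0 T \<eta>"
    show "AE x in lebesgue_on {0<..<l}. (\<integral>t. I g (x,t) * deriv \<eta> t \<partial>lebesgue_on {0<..<T}) = - (\<integral>t. - g (x,t) * \<eta> t \<partial>lebesgue_on {0<..<T})"
      using ae by eventually_elim
        (simp add: opt_apply int k * t test_function_sqi[OF t])
  qed (intro sqi_L2_Omega I_sqi g sqi_uminus)+
qed

end


section \<open>Continuity in time and the test functions\<close>

lemma AE_ival_ex:
  assumes "AE t in ival a b. P t" "a \<le> \<alpha>" "\<alpha> < \<beta>" "\<beta> \<le> b"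
  shows "\<exists>t\<in>{\<alpha><..<\<beta>}. P t"
proof (rule ccontr)
  assume "\<not> (\<exists>t\<in>{\<alpha><..<\<beta>}. P t)"
  note n = this
  have "AE t in lborel. t \<notin> {\<alpha><..<\<beta>}"
    using assms(1)[unfolded AE_ival_iff] by (rule eventually_mono) (use n assms in auto)
  then have "{\<alpha><..<\<beta>} \<in> null_sets lborel"
    by (subst AE_iff_null_sets) auto
  then show False using assms by (simp add: null_sets_def)
qed

text \<open>The primitive is continuous and vanishes on a dense set, hence everywhere. Countably
  many conditions matter later, when each holds only outside its own null set of times.\<close>

lemma AE_ival_eq_0:
  fixes h :: "real \<Rightarrow> real"
  assumes ab: "a < b" and h: "h \<in> sqi (ival a b)"
    and z: "\<And>q. q \<in> \<rat> \<Longrightarrow> kop (ival a b) past h q = 0"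
  shows "AE x in ival a b. h x = 0"
proof -
  interpret finite_measure "ival a b" by (rule finite_measure_ival)
  have "closed {x \<in> UNIV. kop (ival a b) past h x = 0}"
    by (intro continuous_closed_preimage_constant kop_past_continuous h closed_UNIV)
  then have "closure (\<rat> :: real set) \<subseteq> {x \<in> UNIV. kop (ival a b) past h x = 0}"
    by (intro closure_minimal) (use z in auto)
  then have 0: "kop (ival a b) past h x = 0" for x by (auto simp: Rats_closure_real)
  show ?thesis
  proof (rule AE_ival_zero[OF sqi_integrable[OF h]])
    fix \<alpha> \<beta> assume \<alpha>: "a \<le> \<alpha>" "\<alpha> < \<beta>" "\<beta> \<le> b"
    have i: "integrable (ival a b) (\<lambda>y. past x y * h y)" for x
      by (rule integrable_bounded_mult[OF h, where c = 1]) (auto simp: past_bounds)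
    have "(\<integral>y. indicator {\<alpha><..<\<beta>} y * h y \<partial>ival a b) = (\<integral>y. past \<beta> y * h y - past \<alpha> y * h y \<partial>ival a b)"
    proof (rule integral_cong_AE)
      show "AE y in ival a b. indicator {\<alpha><..<\<beta>} y * h y = past \<beta> y * h y - past \<alpha> y * h y"
        using AE_ival_neq[of \<alpha>] by eventually_elim (use \<alpha> in \<open>auto simp: past_def split: split_indicator\<close>)
      have "(indicator {\<alpha><..<\<beta>} :: real \<Rightarrow> real) \<in> borel_measurable (ival a b)" by (rule measurable_ival) auto
      then show "(\<lambda>y. indicator {\<alpha><..<\<beta>} y * h y) \<in> borel_measurable (ival a b)" using h by measurable
    qed (use h in measurable)
    also have "\<dots> = kop (ival a b) past h \<beta> - kop (ival a b) past h \<alpha>"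
      using i by (simp add: kop_def)
    finally show "(\<integral>y. indicator {\<alpha><..<\<beta>} y * h y \<partial>ival a b) = 0" using 0 by simp
  qed
qed

context space_time begin

text \<open>Cauchy-Schwarz in time on almost every section, then integration in
  \<open>x\<close>.\<close>

lemma time_average:
  assumes h: "h \<in> sqi M" and a: "a \<in> borel_measurable Y" "\<And>s. s \<in> space Y \<Longrightarrow> \<bar>a s\<bar> \<le> 1"
  shows "(\<lambda>x. \<integral>s. a s * h (x,s) \<partial>Y) \<in> sqi X"
    "inner_L2 X (\<lambda>x. \<integral>s. a s * h (x,s) \<partial>Y) (\<lambda>x. \<integral>s. a s * h (x,s) \<partial>Y)
      \<le> inner_L2 Y a a * inner_L2 M h h"
proof -
  let ?G = "\<lambda>x. \<integral>s. a s * h (x,s) \<partial>Y"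
  note [measurable] = sqi_measurable[OF h] a(1)
  have m[measurable]: "?G \<in> borel_measurable X"
    by (rule Y.borel_measurable_lebesgue_integral) measurable
  have a2: "a \<in> sqi Y" by (rule Y.sqi_bounded[OF a])
  have b: "AE x in X. (?G x)\<^sup>2 \<le> inner_L2 Y a a * inner_L2 Y (\<lambda>s. h (x,s)) (\<lambda>s. h (x,s))"
    using sqi_section_fst[OF h]
    by eventually_elim (use Cauchy_Schwarz_L2_sq[OF a2] in \<open>simp add: inner_L2_def\<close>)
  have i: "integrable X (\<lambda>x. inner_L2 Y a a * inner_L2 Y (\<lambda>s. h (x,s)) (\<lambda>s. h (x,s)))"
    by (intro integrable_mult_right inner_sections_fst h)
  have i2: "integrable X (\<lambda>x. (?G x)\<^sup>2)"
    by (rule Bochner_Integration.integrable_bound[OF i])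
      (use b in \<open>auto intro: order_trans[OF _ abs_ge_self] elim: eventually_mono\<close>)
  then show "?G \<in> sqi X" by (simp add: sqi_def)
  have "inner_L2 X ?G ?G \<le> (\<integral>x. inner_L2 Y a a * inner_L2 Y (\<lambda>s. h (x,s)) (\<lambda>s. h (x,s)) \<partial>X)"
    using integral_mono_AE[OF i2 i b] by (simp add: inner_L2_def power2_eq_square)
  then show "inner_L2 X ?G ?G \<le> inner_L2 Y a a * inner_L2 M h h"
    using inner_sections_fst(1)[OF h h] by simp
qed

end

context strip begin

lemma inner_lebesgue_X:
  assumes "f \<in> L2 {0<..<l}" "g \<in> L2 {0<..<l}" "f' \<in> sqi X" "g' \<in> sqi X"
    "AE x in X. f x = f' x" "AE x in X. g x = g' x"
  shows "inner_L2 (lebesgue_on {0<..<l}) f g = inner_L2 X f' g'"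
  using inner_lebesgue_on_borel[OF _ assms(1,2), of f' g'] assms
  by (simp add: AE_lebesgue_ival ival_def[symmetric])

lemma sqi_L2_X: "f \<in> sqi X \<Longrightarrow> f \<in> L2 {0<..<l}"
  unfolding ival_def by (rule sqi_L2) auto

lemma norm_L2_X: "f \<in> sqi X \<Longrightarrow> norm_L2 {0<..<l} f = sqrt (inner_L2 X f f)"
  unfolding norm_L2_eq using inner_lebesgue_X[of f f f f] sqi_L2_X by simp

lemma const_tensor_sqi:
  assumes "a \<in> sqi X" "b \<in> sqi Y"
  shows "(\<lambda>z. a (fst z) * b (snd z)) \<in> sqi M"
proof -
  have "integrable M (\<lambda>(x,t). (a x)\<^sup>2 * (b t)\<^sup>2)"
    using assms by (intro integrable_prod_mult) (auto simp: sqi_def)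
  then show ?thesis using assms
    by (auto simp: sqi_def split_def power_mult_distrib)
qed

text \<open>The norm of the increment is at most the square root of \<open>\<bar>s - t\<bar>\<close>
  times the norm of \<open>h\<close>. Differences of \<open>m\<close> are compared with those of
  \<open>past\<close>, whose absolute value is the indicator of the interval between the two times
  up to an end point; this form covers \<open>past\<close> and \<open>future\<close> alike.\<close>

lemma time_integral_continuous:
  assumes h: "h \<in> sqi M" and m: "\<And>t. m t \<in> borel_measurable Y" "\<And>t s. \<bar>m t s\<bar> \<le> 1"
    and b1: "\<And>t t' s. \<bar>m t s - m t' s\<bar> \<le> 1"
    and d: "\<And>t t'. AE s in Y. \<bar>m t s - m t' s\<bar> \<le> \<bar>past t s - past t' s\<bar>"
  shows "time_continuous l T (opt Y m h)"
  unfolding time_continuous_def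
proof (intro ballI conjI)
  fix t assume t: "t \<in> {0..T}"
  have e: "opt Y m h (x,t) = (\<integral>s. m t s * h (x,s) \<partial>Y)" for x t
    by (simp add: opt_apply kop_def)
  have s: "(\<lambda>x. opt Y m h (x,t)) \<in> sqi X" for t
    unfolding e by (rule time_average(1)[OF h m(1)]) (simp add: m)
  then show "(\<lambda>x. opt Y m h (x,t)) \<in> L2 {0<..<l}" by (rule sqi_L2_X)
  have diff: "AE x in X. opt Y m h (x,s) - opt Y m h (x,t) = (\<integral>s'. (m s s' - m t s') * h (x,s') \<partial>Y)" for s
    using sqi_section_fst[OF h]
  proof eventually_elim
    case (elim x)
    have "integrable Y (\<lambda>s'. m t s' * h (x,s'))" for t
      by (rule Y.integrable_bounded_mult[OF elim m(1)]) (rule m)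
    then show ?case unfolding e by (simp add: left_diff_distrib)
  qed
  have bound: "norm_L2 {0<..<l} (\<lambda>x. opt Y m h (x,s) - opt Y m h (x,t)) \<le> sqrt (\<bar>s - t\<bar> * inner_L2 M h h)"
    if s': "s \<in> {0..T}" for s
  proof -
    note ta = time_average[OF h borel_measurable_diff[OF m(1)[of s] m(1)[of t]] b1]
    have "norm_L2 {0<..<l} (\<lambda>x. opt Y m h (x,s) - opt Y m h (x,t))
      = sqrt (inner_L2 X (\<lambda>x. opt Y m h (x,s) - opt Y m h (x,t)) (\<lambda>x. opt Y m h (x,s) - opt Y m h (x,t)))"
      by (rule norm_L2_X[OF sqi_diff[OF s s]])
    also have "\<dots> \<le> sqrt (inner_L2 Y (\<lambda>s'. m s s' - m t s') (\<lambda>s'. m s s' - m t s') * inner_L2 M h h)"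
      using ta(2) inner_L2_cong_AE[OF diff diff sqi_measurable[OF sqi_diff[OF s s]] sqi_measurable[OF ta(1)]
        sqi_measurable[OF sqi_diff[OF s s]] sqi_measurable[OF ta(1)]] by simp
    also have "\<dots> \<le> sqrt (\<bar>s - t\<bar> * inner_L2 M h h)"
    proof (intro real_sqrt_le_mono mult_right_mono inner_L2_nonneg)
      have "inner_L2 Y (\<lambda>s'. m s s' - m t s') (\<lambda>s'. m s s' - m t s') \<le> (\<integral>s'. \<bar>past s s' - past t s'\<bar> \<partial>Y)"
        unfolding inner_L2_def
      proof (rule integral_mono_AE)
        show "integrable Y (\<lambda>s'. (m s s' - m t s') * (m s s' - m t s'))"
          by (intro sqi_integrable_mult Y.sqi_bounded[of _ 1] borel_measurable_diff m b1)
        show "integrable Y (\<lambda>s'. \<bar>past s s' - past t s'\<bar>)"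
        proof (rule Y.integrable_const_bound[of _ 1])
          show "AE s' in Y. norm \<bar>past s s' - past t s'\<bar> \<le> 1" by (auto simp: past_def)
        qed measurable
        show "AE s' in Y. (m s s' - m t s') * (m s s' - m t s') \<le> \<bar>past s s' - past t s'\<bar>"
          using d[of s t]
        proof eventually_elim
          case (elim s')
          have "(m s s' - m t s') * (m s s' - m t s') = \<bar>m s s' - m t s'\<bar> * \<bar>m s s' - m t s'\<bar>" by simp
          also have "\<dots> \<le> \<bar>past s s' - past t s'\<bar> * 1"
            by (intro mult_mono elim b1) auto
          finally show ?case by simp
        qed
      qed
      also have "\<dots> = \<bar>s - t\<bar>"
      proof -
        have "integrable Y (past s)" for s by (rule Y.integrable_const_bound[of _ 1]) (auto simp: past_bounds)
        then have i: "(\<integral>s'. past s s' - past t s' \<partial>Y) = s - t" "(\<integral>s'. past t s' - past s s' \<partial>Y) = t - s"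
          using s' t by (simp_all add: integral_past)
        show ?thesis
        proof (cases "s \<le> t")
          case True
          then have "\<bar>past s s' - past t s'\<bar> = past t s' - past s s'" for s' by (auto simp: past_def)
          then show ?thesis using i True by simp
        next
          case False
          then have "\<bar>past s s' - past t s'\<bar> = past s s' - past t s'" for s' by (auto simp: past_def)
          then show ?thesis using i False by simp
        qed
      qed
      finally show "inner_L2 Y (\<lambda>s'. m s s' - m t s') (\<lambda>s'. m s s' - m t s') \<le> \<bar>s - t\<bar>" .
    qed
    finally show ?thesis .
  qed
  show "((\<lambda>s. norm_L2 {0<..<l} (\<lambda>x. opt Y m h (x,s) - opt Y m h (x,t))) \<longlongrightarrow> 0) (at t within {0..T})"
  proof (rule tendsto_sandwich[OF _ _ tendsto_const])
    show "\<forall>\<^sub>F s in at t within {0..T}. 0 \<le> norm_L2 {0<..<l} (\<lambda>x. opt Y m h (x,s) - opt Y m h (x,t))"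
      by (auto simp: norm_L2_eq inner_L2_nonneg)
    show "\<forall>\<^sub>F s in at t within {0..T}. norm_L2 {0<..<l} (\<lambda>x. opt Y m h (x,s) - opt Y m h (x,t)) \<le> sqrt (\<bar>s - t\<bar> * inner_L2 M h h)"
      using bound by (auto simp: eventually_at_filter)
    have "((\<lambda>s. sqrt (\<bar>s - t\<bar> * inner_L2 M h h)) \<longlongrightarrow> sqrt (\<bar>t - t\<bar> * inner_L2 M h h)) (at t within {0..T})"
      by (intro tendsto_intros)
    then show "((\<lambda>s. sqrt (\<bar>s - t\<bar> * inner_L2 M h h)) \<longlongrightarrow> 0) (at t within {0..T})" by simp
  qed
qed

text \<open>An equality of functions, not only almost everywhere: continuity in time and vanishing
  at an end time concern individual times. To this end the Green kernel is bounded for every real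
  \<open>x\<close>.\<close>

lemma green_time_commute:
  assumes "g \<in> sqi M"
  shows "k (L g) = L (k g)" "k (I g) = I (k g)"
proof -
  have b: "\<bar>green l x y\<bar> \<le> 2 * \<bar>x\<bar> + l" if "y \<in> space X" for x y
  proof -
    have "\<bar>x * green0 l y\<bar> \<le> \<bar>x\<bar>"
      using green_bounds(3)[OF l_pos, of y] that by (auto simp: abs_mult mult_left_le)
    then show ?thesis using that l_pos by (auto simp: green_def past_def)
  qed
  have m: "green l x \<in> borel_measurable X" for x by (intro measurable_ival green_measurable)
  show "k (L g) = L (k g)" "k (I g) = I (k g)"
    using opx_opt_commute[of "green l" _ _ past _ 1, OF m b _ _ assms]
      opx_opt_commute[of "green l" _ _ future _ 1, OF m b _ _ assms]
    by (auto simp: past_bounds)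
qed

lemma abs_past_diff: "\<bar>past t s - past t' s'\<bar> \<le> 1"
  by (auto simp: past_def)

lemma AE_future: "AE s in Y. \<bar>past s t - past s t'\<bar> \<le> \<bar>past t s - past t' s\<bar>"
  using AE_ival_neq[of t] AE_ival_neq[of t'] by eventually_elim (auto simp: past_def)

text \<open>With \<open>k (I g) = I (k g)\<close> the function is a time integral up to
  \<open>T\<close> of an element of \<open>L2\<close>; so its time derivative is
  \<open>- k g\<close>, it is continuous in time, and it vanishes at \<open>T\<close>.\<close>

lemma test_forward:
  assumes g: "g \<in> sqi M"
  shows "H1_V2 l T (k (I g)) (k' (I g)) (I g) (\<lambda>z. - k g z) (\<lambda>z. - g z)"
    "vanishes_at_time l T (k (I g))"
proof -
  have kg: "k g \<in> sqi M" by (rule opx_sqi[OF kernel_green(1)[OF l_pos] g])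
  have "L2_V2 l T (k (\<lambda>z. -1 * g z)) (k' (\<lambda>z. -1 * g z)) (\<lambda>z. -1 * g z)"
    by (intro L2_V2_green sqi_cmult g)
  then have "L2_V2 l T (\<lambda>z. -1 * k g z) (\<lambda>z. -1 * k' g z) (\<lambda>z. -1 * g z)"
    unfolding opx_cmult .
  then have "\<exists>vxt. L2_V2 l T (\<lambda>z. - k g z) vxt (\<lambda>z. - g z)" by auto
  then show "H1_V2 l T (k (I g)) (k' (I g)) (I g) (\<lambda>z. - k g z) (\<lambda>z. - g z)"
    unfolding H1_V2_def
    using L2_V2_green[OF I_sqi[OF g]] time_primitive_weak_dt(2)[OF kg]
      time_integral_continuous[OF kg, of future] AE_future
    by (auto simp: green_time_commute[OF g] past_bounds abs_past_diff)
  show "vanishes_at_time l T (k (I g))"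
    unfolding vanishes_at_time_def green_time_commute[OF g] opt_apply kop_def
    by (auto simp: past_def intro!: AE_I2 integral_eq_zero_AE)
qed

text \<open>The mirror image with integration from 0, as adjoint test functions have to vanish at
  time 0.\<close>

lemma test_adjoint:
  assumes g: "g \<in> sqi M"
  shows "H1_V2 l T (k (L g)) (k' (L g)) (L g) (k g) g"
    "vanishes_at_time l 0 (k (L g))"
proof -
  have kg: "k g \<in> sqi M" by (rule opx_sqi[OF kernel_green(1)[OF l_pos] g])
  show "H1_V2 l T (k (L g)) (k' (L g)) (L g) (k g) g"
    unfolding H1_V2_def
    using L2_V2_green[OF L_sqi[OF g]] L2_V2_green[OF g] time_primitive_weak_dt(1)[OF kg]
      time_integral_continuous[OF kg, of past]
    by (auto simp add: green_time_commute[OF g] past_bounds abs_past_diff)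
  show "vanishes_at_time l 0 (k (L g))"
    unfolding vanishes_at_time_def green_time_commute[OF g] opt_apply kop_def
    by (auto simp: past_def intro!: AE_I2 integral_eq_zero_AE)
qed

end


text \<open>Measurability of \<open>g\<close> is a conclusion, not an assumption: a function that
  agrees almost everywhere with a Borel function is measurable for the completed measure. This
  handles integrands such as boundary slopes.\<close>

lemma integral_lebesgue_on_AE:
  fixes g G :: "'a::euclidean_space \<Rightarrow> real"
  assumes S: "S \<in> sets borel" and G: "G \<in> borel_measurable (borel_on S)" and e: "AE x in borel_on S. g x = G x"
  shows "integral\<^sup>L (lebesgue_on S) g = integral\<^sup>L (borel_on S) G"
proof -
  have G': "G \<in> borel_measurable (lebesgue_on S)" by (rule measurable_lebesgue_onI[OF S G])
  then have "(\<lambda>t. indicator S t * G t) \<in> borel_measurable lebesgue"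
    using borel_measurable_restrict_space_iff[of S lebesgue G] S by simp
  moreover have "AE t in lebesgue. indicator S t * G t = indicator S t * g t"
  proof -
    have "AE t in lborel. t \<in> S \<longrightarrow> g t = G t" using e S by (simp add: AE_restrict_space_iff)
    then show ?thesis
      unfolding AE_completion_iff by eventually_elim (auto split: split_indicator)
  qed
  ultimately have "(\<lambda>t. indicator S t * g t) \<in> borel_measurable lebesgue"
    by (rule borel_measurable_AE)
  then have "g \<in> borel_measurable (lebesgue_on S)"
    using borel_measurable_restrict_space_iff[of S lebesgue g] S by simp
  then have "integral\<^sup>L (lebesgue_on S) g = integral\<^sup>L (lebesgue_on S) G"
    using G' e unfolding AE_lebesgue_on_borel[OF S, symmetric] by (rule integral_cong_AE)
  then show ?thesis using integral_lebesgue_on_borel[OF S G] by simp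
qed

lemma integral_lebesgue_on_ival:
  fixes g G :: "real \<Rightarrow> real"
  assumes "G \<in> borel_measurable (ival a b)" "AE x in ival a b. g x = G x"
  shows "integral\<^sup>L (lebesgue_on {a<..<b}) g = integral\<^sup>L (ival a b) G"
  unfolding ival_def by (rule integral_lebesgue_on_AE[OF _ assms[unfolded ival_def]]) simp

section \<open>Recovering a curve from its weak time derivative\<close>

context strip begin

text \<open>The interval \<open>(0,l)\<close> is not a null set.\<close>

lemma AE_X_const: "(AE x in X. P) \<Longrightarrow> P"
  using AE_ival_ex[of "\<lambda>_. P" 0 l 0 l] l_pos by auto

lemma integral_tensor:
  assumes f: "f \<in> sqi M" and a: "a \<in> sqi X" and b: "b \<in> sqi Y"
  shows "inner_L2 M f (\<lambda>z. a (fst z) * b (snd z)) = (\<integral>x. a x * inner_L2 Y (\<lambda>t. f (x,t)) b \<partial>X)"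
    "inner_L2 M f (\<lambda>z. a (fst z) * b (snd z)) = (\<integral>t. b t * inner_L2 X (\<lambda>x. f (x,t)) a \<partial>Y)"
proof -
  note ab = const_tensor_sqi[OF a b]
  show "inner_L2 M f (\<lambda>z. a (fst z) * b (snd z)) = (\<integral>x. a x * inner_L2 Y (\<lambda>t. f (x,t)) b \<partial>X)"
    unfolding inner_sections_fst(1)[OF f ab] by (simp add: inner_L2_cmult)
  have "inner_L2 X (\<lambda>x. f (x,t)) (\<lambda>x. a x * b t) = b t * inner_L2 X (\<lambda>x. f (x,t)) a" for t
    using inner_L2_cmult(2)[of X "\<lambda>x. f (x,t)" "b t" a] by (simp add: mult.commute)
  then show "inner_L2 M f (\<lambda>z. a (fst z) * b (snd z)) = (\<integral>t. b t * inner_L2 X (\<lambda>x. f (x,t)) a \<partial>Y)"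
    unfolding inner_sections_snd(1)[OF f ab] by simp
qed

text \<open>The moment is \<open>opx\<close> with a kernel independent of \<open>x\<close>. Its time
  sections are square integrable for almost every \<open>x\<close> and are all the same.\<close>

lemma moment_sqi:
  assumes f: "f \<in> sqi M" and a: "a \<in> sqi X" "\<And>x. x \<in> space X \<Longrightarrow> \<bar>a x\<bar> \<le> c"
  shows "(\<lambda>t. inner_L2 X (\<lambda>x. f (x,t)) a) \<in> sqi Y"
proof -
  have c: "0 \<le> c" using a(2)[of "l/2"] l_pos by auto
  have "(\<lambda>z. a (snd z)) \<in> borel_measurable (X \<Otimes>\<^sub>M X)"
    by (rule measurable_compose[OF measurable_snd sqi_measurable[OF a(1)]])
  then have k: "kernel X (\<lambda>x. a) c"
    using c a(2) by (auto simp: kernel_def split_def)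
  have "AE x in X. (\<lambda>t. opx X (\<lambda>x. a) f (x,t)) \<in> sqi Y"
    by (rule sqi_section_fst[OF opx_sqi[OF k f]])
  then have "AE x in X. (\<lambda>t. inner_L2 X (\<lambda>x. f (x,t)) a) \<in> sqi Y"
    by (simp add: opx_apply kop_def inner_L2_def mult.commute)
  then show ?thesis by (rule AE_X_const)
qed

lemma past_sqi: "past q \<in> sqi X" "past q \<in> sqi Y"
  by (auto intro!: X.sqi_bounded[of _ 1] Y.sqi_bounded[of _ 1] simp: past_bounds)

text \<open>Integrated in \<open>x\<close> over \<open>(0,q)\<close> with \<open>q\<close> rational, \<open>w\<close> is a primitive of \<open>wt\<close> by du Bois-Reymond; continuity
  in time determines the constant.\<close>

lemma time_representation:
  assumes w: "weak_dt l T w wt" "time_continuous l T w" "vanishes_at_time l e w" and e: "e \<in> {0..T}"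
    and g: "g \<in> sqi M" "AE z in M. wt z = g z"
  shows "AE z in M. w z = opt Y (\<lambda>t s. past t s - past e s) g z"
proof -
  \<comment> \<open>The signed kernel of integration from \<open>e\<close> to \<open>t\<close>;
    \<open>e\<close> will be 0 or \<open>T\<close>.\<close>
  define m where "m t s = past t s - past e s" for t s
  have m: "m t \<in> borel_measurable Y" "\<bar>m t s\<bar> \<le> 1" for t s
    unfolding m_def by (rule borel_measurable_diff[OF past_section(1) past_section(1)]) (rule abs_past_diff)
  have km: "kernel Y m 1"
  proof -
    have "(\<lambda>(t,s). past t s - past e s) \<in> borel_measurable (borel \<Otimes>\<^sub>M borel)"
      unfolding past_def by measurable
    then show ?thesis by (intro kernel_ival) (auto simp: m_def m[unfolded m_def] borel_prod)
  qed
  have wL: "w \<in> L2 (Omega l T)" "wt \<in> L2 (Omega l T)" using w(1) by (auto simp: weak_dt_def)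
  obtain w' where w': "w' \<in> sqi M" "AE z in M. w z = w' z" by (rule representative[OF wL(1)])
  define D where "D = (\<lambda>z. w' z - opt Y m g z)"
  have D: "D \<in> sqi M" unfolding D_def by (intro sqi_diff w' opt_sqi[OF km] g)
  have main: "AE t in Y. inner_L2 X (\<lambda>x. D (x,t)) (past q) = 0" for q
  proof -
    \<comment> \<open>Integration over \<open>(0,q)\<close> in \<open>x\<close> reduces the claim to
      scalar functions of time: \<open>V\<close> turns out to be the weak derivative of
      \<open>U\<close>.\<close>
    define U where "U t = inner_L2 X (\<lambda>x. w' (x,t)) (past q)" for t
    define V where "V t = inner_L2 X (\<lambda>x. g (x,t)) (past q)" for t
    have UV: "U \<in> sqi Y" "V \<in> sqi Y"
      unfolding U_def V_def using past_sqi(1) by (auto intro!: moment_sqi[of _ _ 1] w' g simp: past_bounds)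
    have "weak_deriv 0 T U V"
    proof (subst weak_deriv_borel[of U 0 T V U V])
      show "U \<in> L2 {0<..<T}" "V \<in> L2 {0<..<T}"
        using UV unfolding ival_def by (auto intro: sqi_L2)
      show "\<forall>\<eta>. test_function 0 T \<eta> \<longrightarrow> inner_L2 Y U (deriv \<eta>) = - inner_L2 Y V \<eta>"
      proof (intro allI impI)
        fix \<eta> assume t: "test_function 0 T \<eta>"
        note ts = test_function_sqi[OF t]
        have "AE x in X. (\<integral>t. w (x,t) * deriv \<eta> t \<partial>lebesgue_on {0<..<T}) = - (\<integral>t. wt (x,t) * \<eta> t \<partial>lebesgue_on {0<..<T})"
          using w(1) t unfolding weak_dt_def AE_lebesgue_ival by blast
        then have ae: "AE x in X. inner_L2 Y (\<lambda>t. w' (x,t)) (deriv \<eta>) = - inner_L2 Y (\<lambda>t. g (x,t)) \<eta>"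
          using AE_section_fst[OF w'(2)] AE_section_fst[OF g(2)] sqi_section_fst[OF w'(1)] sqi_section_fst[OF g(1)]
        proof eventually_elim
          case (elim x)
          have c: "(\<integral>t. h t * \<theta> t \<partial>lebesgue_on {0<..<T}) = inner_L2 Y h' \<theta>"
            if "AE t in Y. h t = h' t" "h' \<in> sqi Y" "\<theta> \<in> sqi Y" for h h' \<theta>
            unfolding inner_L2_def
            by (rule integral_lebesgue_on_ival) (use that(2,3)[THEN sqi_measurable] that(1) in \<open>auto elim: eventually_mono\<close>)
          show ?case using elim(1) c[OF elim(2,4) ts(2)] c[OF elim(3,5) ts(1)] by simp
        qed
        have "inner_L2 Y U (deriv \<eta>) = inner_L2 M w' (\<lambda>z. past q (fst z) * deriv \<eta> (snd z))"
          unfolding integral_tensor(2)[OF w'(1) past_sqi(1) ts(2)] by (simp add: inner_L2_def[of Y] U_def mult.commute)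
        also have "\<dots> = (\<integral>x. past q x * inner_L2 Y (\<lambda>t. w' (x,t)) (deriv \<eta>) \<partial>X)"
          by (rule integral_tensor(1)[OF w'(1) past_sqi(1) ts(2)])
        also have "\<dots> = (\<integral>x. - (past q x * inner_L2 Y (\<lambda>t. g (x,t)) \<eta>) \<partial>X)"
        proof (rule integral_cong_AE)
          show "AE x in X. past q x * inner_L2 Y (\<lambda>t. w' (x,t)) (deriv \<eta>) = - (past q x * inner_L2 Y (\<lambda>t. g (x,t)) \<eta>)"
            using ae by eventually_elim simp
          have "(\<lambda>x. inner_L2 Y (\<lambda>t. f (x,t)) \<theta>) \<in> borel_measurable X" if "f \<in> sqi M" "\<theta> \<in> sqi Y" for f \<theta>
          proof -
            note [measurable] = that[THEN sqi_measurable]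
            show ?thesis unfolding inner_L2_def
              by (rule Y.borel_measurable_lebesgue_integral) measurable
          qed
          then show "(\<lambda>x. past q x * inner_L2 Y (\<lambda>t. w' (x,t)) (deriv \<eta>)) \<in> borel_measurable X"
            "(\<lambda>x. - (past q x * inner_L2 Y (\<lambda>t. g (x,t)) \<eta>)) \<in> borel_measurable X"
            using w'(1) g(1) ts by (auto intro!: borel_measurable_times borel_measurable_uminus)
        qed
        also have "\<dots> = - inner_L2 M g (\<lambda>z. past q (fst z) * \<eta> (snd z))"
          unfolding integral_tensor(1)[OF g(1) past_sqi(1) ts(1)] by simp
        also have "\<dots> = - inner_L2 Y V \<eta>"
          unfolding integral_tensor(2)[OF g(1) past_sqi(1) ts(1)] by (simp add: inner_L2_def[of Y] V_def mult.commute)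
        finally show "inner_L2 Y U (deriv \<eta>) = - inner_L2 Y V \<eta>" .
      qed
    qed (use UV in auto)
    then obtain c where "AE t in lebesgue_on {0<..<T}. U t = c + kop Y past V t"
      by (rule weak_deriv_imp_primitive[OF T_pos _ UV(2)]) auto
    then have c: "AE t in Y. U t = c + kop Y past V t" by (simp only: AE_lebesgue_ival)
    \<comment> \<open>\<open>U\<close> comes from a representative and is meaningful for almost
      every time only. \<open>W\<close> uses \<open>w\<close> itself, so it can be evaluated at
      \<open>e\<close> and has a limit there.\<close>
    define W where "W t = inner_L2 (lebesgue_on {0<..<l}) (\<lambda>x. w (x,t)) (past q)" for t
    have pq: "past q \<in> L2 {0<..<l}" by (rule sqi_L2_X[OF past_sqi(1)])
    have WU: "AE t in Y. W t = U t"
    proof -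
      have "AE t in Y. t \<in> {0<..<T}" using AE_space[of Y] by simp
      then show ?thesis
        using AE_section_snd[OF w'(2)] sqi_section_snd[OF w'(1)]
      proof eventually_elim
        case (elim t)
        then have "(\<lambda>x. w (x,t)) \<in> L2 {0<..<l}" using w(2) by (auto simp: time_continuous_def)
        then show ?case unfolding W_def U_def
          by (rule inner_lebesgue_X[OF _ pq elim(3) past_sqi(1) elim(2)]) simp
      qed
    qed
    have W0: "W e = 0"
    proof -
      have "(\<lambda>x. w (x,e)) \<in> L2 {0<..<l}" using w(2) e by (auto simp: time_continuous_def)
      moreover have "(\<lambda>_. 0) \<in> sqi X" by (rule X.sqi_bounded[of _ 0]) auto
      ultimately have "W e = inner_L2 X (\<lambda>_. 0) (past q)"
        unfolding W_def using w(3)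
        by (intro inner_lebesgue_X pq past_sqi) (auto simp: vanishes_at_time_def AE_lebesgue_ival)
      then show ?thesis by (simp add: inner_L2_def)
    qed
    have Wlim: "(W \<longlongrightarrow> 0) (at e within {0..T})"
    proof (rule Lim_null_comparison)
      show "\<forall>\<^sub>F s in at e within {0..T}. norm (W s) \<le> norm_L2 {0<..<l} (\<lambda>x. w (x,s) - w (x,e)) * norm_L2 {0<..<l} (past q)"
      proof -
        have "\<bar>W s\<bar> \<le> norm_L2 {0<..<l} (\<lambda>x. w (x,s) - w (x,e)) * norm_L2 {0<..<l} (past q)" if s: "s \<in> {0..T}" for s
        proof -
          have L: "(\<lambda>x. w (x,s)) \<in> sqi (lebesgue_on {0<..<l})" "(\<lambda>x. w (x,e)) \<in> sqi (lebesgue_on {0<..<l})"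
            using w(2) s e by (auto simp: time_continuous_def L2_eq_sqi)
          have "W s = inner_L2 (lebesgue_on {0<..<l}) (\<lambda>x. w (x,s) - w (x,e)) (past q)"
            using W0 L pq by (simp add: W_def inner_L2_diff L2_eq_sqi)
          then show ?thesis
            using Cauchy_Schwarz_L2[OF sqi_diff[OF L] pq[unfolded L2_eq_sqi]] by (simp add: norm_L2_eq)
        qed
        then show ?thesis by (auto simp: eventually_at_filter)
      qed
      have "((\<lambda>s. norm_L2 {0<..<l} (\<lambda>x. w (x,s) - w (x,e))) \<longlongrightarrow> 0) (at e within {0..T})"
        using w(2) e by (auto simp: time_continuous_def)
      then show "((\<lambda>s. norm_L2 {0<..<l} (\<lambda>x. w (x,s) - w (x,e)) * norm_L2 {0<..<l} (past q)) \<longlongrightarrow> 0) (at e within {0..T})"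
        by (rule tendsto_mult_left_zero)
    qed
    have "((\<lambda>t. W t - kop Y past V t) \<longlongrightarrow> 0 - kop Y past V e) (at e within {0..T})"
      using kop_past_continuous[OF UV(2), of UNIV]
      by (intro tendsto_diff Wlim) (auto simp: continuous_on_eq_continuous_at isCont_def intro: tendsto_within_subset)
    moreover have cW: "AE t in Y. W t - kop Y past V t = c"
      using c WU by eventually_elim simp
    ultimately have "c = - kop Y past V e"
    proof -
      assume lim: "((\<lambda>t. W t - kop Y past V t) \<longlongrightarrow> 0 - kop Y past V e) (at e within {0..T})"
      \<comment> \<open>The difference equals \<open>c\<close> almost everywhere, hence at some time
        in every neighbourhood of \<open>e\<close>, where it is also close to its limit.\<close>
      have "\<exists>t\<in>{0<..<T}. W t - kop Y past V t = c \<and> dist (W t - kop Y past V t) (- kop Y past V e) < \<epsilon>" if pe: "\<epsilon> > 0" for \<epsilon>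
      proof -
        obtain d where d: "d > 0" "\<And>t. t \<in> {0..T} \<Longrightarrow> t \<noteq> e \<Longrightarrow> dist t e < d \<Longrightarrow> dist (W t - kop Y past V t) (- kop Y past V e) < \<epsilon>"
          using tendstoD[OF lim pe] by (auto simp: eventually_at)
        have "\<exists>t\<in>{max 0 (e - d)<..<min T (e + d)}. W t - kop Y past V t = c \<and> t \<noteq> e"
          using e d(1) T_pos by (intro AE_ival_ex[where a = 0 and b = T] AE_conjI cW AE_ival_neq) auto
        then obtain t where "t \<in> {max 0 (e - d)<..<min T (e + d)}" "W t - kop Y past V t = c" "t \<noteq> e" by blast
        then show ?thesis using d(2)[of t] by (intro bexI[of _ t]) (auto simp: dist_real_def)
      qed
      then have "\<forall>\<epsilon>>0. dist c (- kop Y past V e) < \<epsilon>" by metis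
      then show ?thesis by (metis dist_pos_lt less_irrefl)
    qed
    then have U: "AE t in Y. U t = kop Y m V t"
    proof -
      have "integrable Y (\<lambda>s. past t s * V s)" for t
        by (rule Y.integrable_bounded_mult[OF UV(2), where c = 1]) (auto simp: past_bounds)
      then have "kop Y m V t = kop Y past V t - kop Y past V e" for t
        by (simp add: kop_def m_def left_diff_distrib)
      then show ?thesis using c \<open>c = - kop Y past V e\<close> by simp
    qed
    have comm: "kop Y m V t = inner_L2 X (\<lambda>x. opt Y m g (x,t)) (past q)" for t
    proof -
      have "opx X (\<lambda>_. past q) (opt Y m g) (0,t) = opt Y m (opx X (\<lambda>_. past q) g) (0,t)"
        by (rule opx_opt_commute[where c = 1 and d = 1]) (auto simp: past_bounds m g)
      then show ?thesis
        by (simp add: opx_apply opt_apply kop_def inner_L2_def V_def mult.commute)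
    qed
    show "AE t in Y. inner_L2 X (\<lambda>x. D (x,t)) (past q) = 0"
      using U sqi_section_snd[OF w'(1)] sqi_section_snd[OF opt_sqi[OF km g(1)]]
      by eventually_elim (simp add: D_def inner_L2_diff past_sqi comm U_def)
  qed
  \<comment> \<open>Rational \<open>q\<close> only, because a countable union of null sets of times
    is null.\<close>
  have "AE t in Y. \<forall>q\<in>\<rat>. inner_L2 X (\<lambda>x. D (x,t)) (past q) = 0"
    by (subst AE_ball_countable[OF countable_rat]) (blast intro: main)
  then have "AE t in Y. AE x in X. D (x,t) = 0"
    using sqi_section_snd[OF D]
  proof eventually_elim
    case (elim t)
    show ?case
      by (rule AE_ival_eq_0[OF l_pos elim(2)]) (use elim(1) in \<open>simp add: kop_def inner_L2_def mult.commute\<close>)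
  qed
  then have "AE z in M. D z = 0" using AE_M_iff[of D "\<lambda>_. 0"] D by simp
  with w'(2) show ?thesis unfolding D_def m_def[abs_def, symmetric] by eventually_elim simp
qed

lemma time_representation_0:
  assumes "weak_dt l T w wt" "time_continuous l T w" "vanishes_at_time l 0 w"
    and g: "g \<in> sqi M" "AE z in M. wt z = g z"
  shows "AE z in M. w z = L g z"
proof -
  have "opt Y (\<lambda>t s. past t s - past 0 s) g z = L g z" for z
    unfolding opt_def kop_def by (cases z) (auto simp: past_def intro!: Bochner_Integration.integral_cong)
  then show ?thesis using time_representation[OF assms(1-3) _ g] T_pos by simp
qed

text \<open>For \<open>s\<close> before \<open>T\<close> and different from \<open>t\<close>,
  \<open>past t s - 1\<close> is minus \<open>past s t\<close>.\<close>

lemma time_representation_T: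
  assumes "weak_dt l T w wt" "time_continuous l T w" "vanishes_at_time l T w"
    and g: "g \<in> sqi M" "AE z in M. wt z = g z"
  shows "AE z in M. w z = I (\<lambda>z. - g z) z"
proof -
  have e: "opt Y (\<lambda>t s. past t s - past T s) g (x,t) = I (\<lambda>z. - g z) (x,t)" if "x \<in> space X" for x t
    unfolding opt_apply kop_def
  proof (rule integral_cong_AE)
    have [measurable]: "(\<lambda>s. g (x,s)) \<in> borel_measurable Y" using measurable_Pair2[OF sqi_measurable[OF g(1)] that] .
    show "(\<lambda>s. (past t s - past T s) * g (x,s)) \<in> borel_measurable Y" "(\<lambda>s. past s t * - g (x,s)) \<in> borel_measurable Y"
      by measurable
    show "AE s in Y. (past t s - past T s) * g (x, s) = past s t * - g (x, s)"
      using AE_space[of Y] AE_ival_neq[of t] by eventually_elim (auto simp: past_def)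
  qed
  have "AE z in M. w z = opt Y (\<lambda>t s. past t s - past T s) g z"
    using time_representation[OF assms(1-3) _ g] T_pos by simp
  with AE_space show ?thesis
    by eventually_elim (auto simp: space_pair_measure e)
qed

end


subsection \<open>Density of the range of time integration\<close>

lemma L2_dominated_convergence:
  assumes f: "\<And>n::nat. f n \<in> borel_measurable M" and g: "g \<in> borel_measurable M" and w: "w \<in> sqi M"
    and lim: "AE x in M. (\<lambda>n. f n x) \<longlonglongrightarrow> g x" and dom: "\<And>n. AE x in M. \<bar>f n x\<bar> \<le> w x"
  shows "(\<lambda>n. inner_L2 M (\<lambda>x. f n x - g x) (\<lambda>x. f n x - g x)) \<longlonglongrightarrow> 0"
proof -
  have "AE x in M. \<forall>n. \<bar>f n x\<bar> \<le> w x" using dom by (simp add: AE_all_countable)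
  with lim have gw: "AE x in M. \<bar>g x\<bar> \<le> w x"
    by eventually_elim (auto intro!: LIMSEQ_le_const2 tendsto_rabs)
  have "(\<lambda>n. \<integral>x. (f n x - g x) * (f n x - g x) \<partial>M) \<longlonglongrightarrow> (\<integral>x. 0 \<partial>M)"
  \<comment> \<open>Sequence and limit are bounded by \<open>w\<close>, hence their difference by
    \<open>2 * w\<close>.\<close>
  proof (rule integral_dominated_convergence[where w = "\<lambda>x. 4 * (w x * w x)"])
    show "integrable M (\<lambda>x. 4 * (w x * w x))" using sqi_integrable_sq[OF w] by simp
    show "AE x in M. (\<lambda>n. (f n x - g x) * (f n x - g x)) \<longlonglongrightarrow> 0"
      using lim
    proof eventually_elim
      case (elim x)
      then have "(\<lambda>n. (f n x - g x) * (f n x - g x)) \<longlonglongrightarrow> (g x - g x) * (g x - g x)"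
        by (intro tendsto_intros)
      then show ?case by simp
    qed
    show "AE x in M. norm ((f n x - g x) * (f n x - g x)) \<le> 4 * (w x * w x)" for n
      using dom[of n] gw
    proof eventually_elim
      case (elim x)
      then have "\<bar>f n x - g x\<bar> \<le> 2 * w x" by linarith
      then have "\<bar>f n x - g x\<bar> * \<bar>f n x - g x\<bar> \<le> (2 * w x) * (2 * w x)"
        by (intro mult_mono) auto
      then show ?case by (simp add: abs_mult)
    qed
  qed (use f g in measurable)
  then show ?thesis by (simp add: inner_L2_def)
qed

text \<open>Needed to write a polynomial as its value at time 0 plus \<open>L\<close> of its time
  derivative; continuity makes that derivative an admissible argument of \<open>L\<close>.\<close>

lemma real_polynomial_partial_derivative:
  fixes q :: "real \<times> real \<Rightarrow> real"
  assumes "real_polynomial_function q"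
  shows "\<exists>d. continuous_on UNIV d \<and> (\<forall>x t. ((\<lambda>t. q (x,t)) has_real_derivative d (x,t)) (at t))"
  using assms
proof induction
  case (linear f)
  then have f: "linear f" by (rule bounded_linear.linear)
  have "f (x,t) = f (x,0) + t * f (0,1)" for x t
    using linear_add[OF f, of "(x,0)" "(0,t)"] linear_cmul[OF f, of t "(0,1)"] by simp
  then have "(\<lambda>t. f (x,t)) = (\<lambda>t. f (x,0) + t * f (0,1))" for x by blast
  moreover have "((\<lambda>t. f (x,0) + t * f (0,1)) has_real_derivative f (0,1)) (at t)" for x t
    by (auto intro!: derivative_eq_intros)
  ultimately have "((\<lambda>t. f (x,t)) has_real_derivative f (0,1)) (at t)" for x t by simp
  then show ?case by (intro exI[of _ "\<lambda>_. f (0,1)"]) auto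
next
  case (const c)
  show ?case by (intro exI[of _ "\<lambda>_. 0"]) auto
next
  case (add f g)
  then obtain d e where d: "continuous_on UNIV d" "continuous_on UNIV e"
    "\<And>x t. ((\<lambda>t. f (x,t)) has_real_derivative d (x,t)) (at t)"
    "\<And>x t. ((\<lambda>t. g (x,t)) has_real_derivative e (x,t)) (at t)" by auto
  have "continuous_on UNIV (\<lambda>z. d z + e z)" by (intro continuous_intros d)
  moreover have "((\<lambda>t. f (x,t) + g (x,t)) has_real_derivative d (x,t) + e (x,t)) (at t)" for x t
    by (rule DERIV_add[OF d(3,4)])
  ultimately show ?case by (intro exI[of _ "\<lambda>z. d z + e z"]) simp
next
  case (mult f g)
  then obtain d e where d: "continuous_on UNIV d" "continuous_on UNIV e"
    "\<And>x t. ((\<lambda>t. f (x,t)) has_real_derivative d (x,t)) (at t)"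
    "\<And>x t. ((\<lambda>t. g (x,t)) has_real_derivative e (x,t)) (at t)" by auto
  have "continuous_on UNIV f" "continuous_on UNIV g"
    using mult.hyps by (auto intro!: continuous_on_polymonial_function simp: real_polynomial_function_eq)
  then have "continuous_on UNIV (\<lambda>z. d z * g z + e z * f z)"
    by (intro continuous_intros d)
  moreover have "((\<lambda>t. f (x,t) * g (x,t)) has_real_derivative d (x,t) * g (x,t) + e (x,t) * f (x,t)) (at t)" for x t
    by (rule DERIV_mult[OF d(3,4)])
  ultimately show ?case by (intro exI[of _ "\<lambda>z. d z * g z + e z * f z"]) simp
qed

context strip begin

text \<open>The closure of the range of \<open>L\<close>. It is shown to contain polynomials,
  continuous, bounded and finally all square integrable functions, each class being reached from the
  previous one by limits in \<open>L2\<close>.\<close>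

definition L_closure :: "(real \<times> real \<Rightarrow> real) set" where
  "L_closure = {F \<in> sqi M. \<forall>\<epsilon>>0. \<exists>G\<in>sqi M. inner_L2 M (\<lambda>z. L G z - F z) (\<lambda>z. L G z - F z) < \<epsilon>}"

lemma L_closure_limit:
  assumes F: "\<And>n::nat. F n \<in> L_closure" "H \<in> sqi M"
    and lim: "(\<lambda>n. inner_L2 M (\<lambda>z. F n z - H z) (\<lambda>z. F n z - H z)) \<longlonglongrightarrow> 0"
  shows "H \<in> L_closure"
proof -
  have sq: "F n \<in> sqi M" for n using F(1)[of n] by (simp add: L_closure_def)
  have "\<exists>G\<in>sqi M. inner_L2 M (\<lambda>z. L G z - H z) (\<lambda>z. L G z - H z) < \<epsilon>" if "\<epsilon> > 0" for \<epsilon>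
  proof -
    have "\<forall>\<^sub>F n in sequentially. inner_L2 M (\<lambda>z. F n z - H z) (\<lambda>z. F n z - H z) < \<epsilon> / 4"
      using order_tendstoD(2)[OF lim, of "\<epsilon> / 4"] that by simp
    then obtain n where n: "inner_L2 M (\<lambda>z. F n z - H z) (\<lambda>z. F n z - H z) < \<epsilon> / 4"
      by (auto simp: eventually_sequentially)
    have "\<exists>G\<in>sqi M. inner_L2 M (\<lambda>z. L G z - F n z) (\<lambda>z. L G z - F n z) < \<epsilon> / 4"
    proof -
      have "\<forall>\<epsilon>>0. \<exists>G\<in>sqi M. inner_L2 M (\<lambda>z. L G z - F n z) (\<lambda>z. L G z - F n z) < \<epsilon>"
        using F(1)[of n] by (simp add: L_closure_def)
      moreover have "\<epsilon> / 4 > 0" using that by simp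
      ultimately show ?thesis by blast
    qed
    then obtain G where G: "G \<in> sqi M" "inner_L2 M (\<lambda>z. L G z - F n z) (\<lambda>z. L G z - F n z) < \<epsilon> / 4"
      by blast
    \<comment> \<open>Two errors below \<open>\<epsilon> / 4\<close>, each with the factor 2 of the
      triangle inequality for squares.\<close>
    have "inner_L2 M (\<lambda>z. (L G z - F n z) + (F n z - H z)) (\<lambda>z. (L G z - F n z) + (F n z - H z))
      \<le> 2 * inner_L2 M (\<lambda>z. L G z - F n z) (\<lambda>z. L G z - F n z) + 2 * inner_L2 M (\<lambda>z. F n z - H z) (\<lambda>z. F n z - H z)"
      by (rule inner_L2_add_self_le) (intro sqi_diff L_sqi G sq F)+
    then show ?thesis using n G by (intro bexI[of _ G]) auto
  qed
  then show ?thesis using F(2) by (simp add: L_closure_def)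
qed

lemma L_closureI_AE:
  assumes "G \<in> sqi M" "F \<in> sqi M" "AE z in M. L G z = F z" shows "F \<in> L_closure"
proof -
  have "inner_L2 M (\<lambda>z. L G z - F z) (\<lambda>z. L G z - F z) = 0"
    unfolding inner_L2_def by (rule integral_eq_zero_AE) (use assms(3) in \<open>auto elim: eventually_mono\<close>)
  then have "\<exists>G\<in>sqi M. inner_L2 M (\<lambda>z. L G z - F z) (\<lambda>z. L G z - F z) < \<epsilon>" if "\<epsilon> > 0" for \<epsilon>
    using that assms(1) by (intro bexI[of _ G]) auto
  then show ?thesis using assms(2) by (simp add: L_closure_def)
qed

lemma continuous_sqi:
  fixes q :: "real \<times> real \<Rightarrow> real"
  assumes "continuous_on UNIV q"
  shows "\<exists>c. (\<forall>z\<in>{0..l} \<times> {0..T}. \<bar>q z\<bar> \<le> c) \<and> q \<in> sqi M \<and> c \<ge> 0"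
proof -
  have "compact (q ` ({0..l} \<times> {0..T}))"
    by (rule compact_continuous_image[OF continuous_on_subset[OF assms]]) (auto intro: compact_Times)
  then obtain c where c: "\<forall>y\<in>q ` ({0..l} \<times> {0..T}). norm y \<le> c"
    using compact_imp_bounded bounded_iff by metis
  have "q \<in> sqi M"
    by (rule M.sqi_bounded[of _ c])
      (use c in \<open>auto simp: space_pair_measure intro!: measurable_ival_pair borel_measurable_continuous_onI assms\<close>)
  moreover have "c \<ge> 0" using c l_pos T_pos by (force intro: order_trans[OF norm_ge_zero])
  ultimately show ?thesis using c by (intro exI[of _ c]) simp
qed

text \<open>\<open>L\<close> of the time derivative misses the value at time 0, while everything in
  the range of \<open>L\<close> starts from 0. The missing value is supplied by a pulse concentrated
  near time 0, whose primitive rises to 1 within time \<open>1/n\<close>.\<close>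

lemma polynomial_L_closure:
  assumes q: "real_polynomial_function q"
  shows "q \<in> L_closure"
proof -
  obtain d where d: "continuous_on UNIV d" "\<And>x t. ((\<lambda>t. q (x,t)) has_real_derivative d (x,t)) (at t)"
    using real_polynomial_partial_derivative[OF q] by blast
  have qc: "continuous_on UNIV q" using q by (auto intro!: continuous_on_polymonial_function simp: real_polynomial_function_eq)
  have q0c: "continuous_on UNIV (\<lambda>z. q (fst z, 0))"
    by (rule continuous_on_compose2[OF qc]) (auto intro!: continuous_intros)
  obtain cd where cd: "\<And>z. z \<in> {0..l} \<times> {0..T} \<Longrightarrow> \<bar>d z\<bar> \<le> cd" "d \<in> sqi M"
    using continuous_sqi[OF d(1)] by blast
  obtain c where c: "\<And>z. z \<in> {0..l} \<times> {0..T} \<Longrightarrow> \<bar>q z\<bar> \<le> c" "q \<in> sqi M" "c \<ge> 0"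
    using continuous_sqi[OF qc] by blast
  obtain c0 where c0: "\<And>z. z \<in> {0..l} \<times> {0..T} \<Longrightarrow> \<bar>q (fst z, 0)\<bar> \<le> c0" "(\<lambda>z. q (fst z, 0)) \<in> sqi M" "c0 \<ge> 0"
    using continuous_sqi[OF q0c] by blast
  \<comment> \<open>A pulse of height \<open>n\<close> and duration \<open>1/n\<close>; its
    primitive is \<open>min 1 (n * t)\<close>.\<close>
  define h where "h n t = real n * past (1 / real n) t" for n :: nat and t
  have hm: "h n \<in> sqi Y" for n
    by (rule Y.sqi_bounded[of _ "real n"]) (auto simp: h_def[abs_def] abs_mult past_def measurable_ival)
  have Lh: "kop Y past (h n) t = min 1 (real n * t)" if n: "n > 0" "1 / real n < T" and t: "t \<in> {0<..<T}" for n t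
  proof -
    have "kop Y past (h n) t = (\<integral>s. real n * past (min t (1 / real n)) s \<partial>Y)"
      unfolding kop_def h_def by (rule Bochner_Integration.integral_cong) (auto simp: past_def)
    also have "\<dots> = real n * min t (1 / real n)"
      using n t by (simp add: integral_past)
    also have "\<dots> = min 1 (real n * t)" using n by (auto simp: min_def field_simps)
    finally show ?thesis .
  qed
  define G where "G n z = d z + q (fst z, 0) * h n (snd z)" for n z
  have Gs: "G n \<in> sqi M" for n
  proof -
    have "(\<lambda>z. h n (snd z) * q (fst z, 0)) \<in> sqi M"
      by (rule sqi_bounded_mult[OF c0(2), where c = "real n"])
        (rule measurable_compose[OF measurable_snd sqi_measurable[OF hm]], simp add: h_def abs_mult past_def)
    then show ?thesis unfolding G_def by (intro sqi_add cd(2)) (simp add: mult.commute)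
  qed
  have LG: "L (G n) (x,t) = q (x,t) - q (x,0) + q (x,0) * min 1 (real n * t)"
    if n: "n > 0" "1 / real n < T" and x: "x \<in> {0<..<l}" and t: "t \<in> {0<..<T}" for n x t
  proof -
    have dx: "(\<lambda>s. d (x,s)) \<in> sqi Y"
    proof (rule Y.sqi_bounded[of _ cd])
      have "continuous_on UNIV (\<lambda>s. d (x,s))"
        by (rule continuous_on_compose2[OF d(1)]) (auto intro!: continuous_intros)
      then show "(\<lambda>s. d (x,s)) \<in> borel_measurable Y"
        by (intro measurable_ival borel_measurable_continuous_onI)
      show "\<bar>d (x,s)\<bar> \<le> cd" if "s \<in> space Y" for s using cd(1)[of "(x,s)"] that x by auto
    qed
    have i: "integrable Y (\<lambda>s. past t s * d (x,s))" "integrable Y (\<lambda>s. past t s * h n s)"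
      by (rule Y.integrable_bounded_mult[OF dx, where c = 1] Y.integrable_bounded_mult[OF hm, where c = 1]; simp add: past_bounds)+
    have "L (G n) (x,t) = (\<integral>s. past t s * d (x,s) + q (x,0) * (past t s * h n s) \<partial>Y)"
      unfolding opt_apply kop_def G_def by (rule Bochner_Integration.integral_cong) (auto simp: algebra_simps)
    also have "\<dots> = kop Y past (\<lambda>s. d (x,s)) t + q (x,0) * kop Y past (h n) t"
      using i by (simp add: kop_def)
    also have "kop Y past (\<lambda>s. d (x,s)) t = (\<integral>s. indicator {0<..<t} s * d (x,s) \<partial>Y)"
      unfolding kop_def by (rule Bochner_Integration.integral_cong) (auto simp: past_def)
    also have "\<dots> = q (x,t) - q (x,0)"
    proof (rule integral_FTC_ival[OF d(2)])
      show "isCont (\<lambda>s. d (x,s)) s" for s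
        by (rule continuous_on_interior[of UNIV])
          (auto intro!: continuous_on_compose2[OF d(1)] continuous_intros)
    qed (use t in auto)
    finally show ?thesis using Lh[OF n t] by simp
  qed
  \<comment> \<open>The pulse must end before \<open>T\<close> to reach full mass, so the sequence
    starts at \<open>N\<close>.\<close>
  obtain N :: nat where N: "N > 0" "1 / real N < T"
    using reals_Archimedean[OF T_pos] by (metis Suc_neq_Zero inverse_eq_divide neq0_conv)
  have N': "n + N > 0" "1 / real (n + N) < T" for n
  proof -
    show "n + N > 0" using N by simp
    have "1 / real (n + N) \<le> 1 / real N" using N by (intro divide_left_mono) auto
    then show "1 / real (n + N) < T" using N by linarith
  qed
  show ?thesis
  proof (rule L_closure_limit[where F = "\<lambda>n. L (G (n + N))"])
    show "L (G (n + N)) \<in> L_closure" for n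
      by (rule L_closureI_AE[OF Gs L_sqi[OF Gs]]) (rule AE_I2, rule refl)
    show "(\<lambda>n. inner_L2 M (\<lambda>z. L (G (n + N)) z - q z) (\<lambda>z. L (G (n + N)) z - q z)) \<longlonglongrightarrow> 0"
    proof (rule L2_dominated_convergence[where w = "\<lambda>_. c + c0 + c0"])
      show "AE z in M. (\<lambda>n. L (G (n + N)) z) \<longlonglongrightarrow> q z"
        using AE_space
      proof eventually_elim
        case (elim z)
        then obtain x t where z: "z = (x,t)" "x \<in> {0<..<l}" "t \<in> {0<..<T}" by (auto simp: space_pair_measure)
        have "\<forall>\<^sub>F n in sequentially. L (G (n + N)) z = q z"
        proof -
          \<comment> \<open>Once the pulse has ended before \<open>t\<close>, the approximation is
            exact at \<open>t\<close>.\<close>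
          obtain m :: nat where m: "1 / t < real m" using reals_Archimedean2 by blast
          have "L (G (n + N)) z = q z" if "n \<ge> m" for n
          proof -
            have "1 / t \<le> real (n + N)" using m that by simp
            then have "1 \<le> real (n + N) * t" using z by (simp add: field_simps)
            then show ?thesis using LG[OF N' z(2,3), of n] z by simp
          qed
          then show ?thesis by (auto simp: eventually_sequentially)
        qed
        then show ?case by (rule tendsto_eventually)
      qed
      show "AE z in M. \<bar>L (G (n + N)) z\<bar> \<le> c + c0 + c0" for n
        using AE_space
      proof eventually_elim
        case (elim z)
        then obtain x t where z: "z = (x,t)" "x \<in> {0<..<l}" "t \<in> {0<..<T}" by (auto simp: space_pair_measure)
        have "\<bar>q (x,0) * min 1 (real (n + N) * t)\<bar> \<le> c0 * 1"
          unfolding abs_mult using c0(1)[of z] z c0(3) by (intro mult_mono) (auto simp: min_def)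
        then show ?case using LG[OF N' z(2,3), of n] c(1)[of z] c0(1)[of z] z by auto
      qed
      show "(\<lambda>_. c + c0 + c0) \<in> sqi M" by (rule M.sqi_bounded[of _ "\<bar>c + c0 + c0\<bar>"]) auto
    qed (intro sqi_measurable L_sqi Gs c(2))+
  qed (rule c(2))
qed

lemma uniform_L_closure:
  assumes F: "F \<in> sqi M" and u: "\<And>\<epsilon>. \<epsilon> > 0 \<Longrightarrow> \<exists>q\<in>L_closure. \<forall>z\<in>space M. \<bar>F z - q z\<bar> < \<epsilon>"
  shows "F \<in> L_closure"
proof -
  have "\<exists>q\<in>L_closure. \<forall>z\<in>space M. \<bar>F z - q z\<bar> < 1 / (real n + 1)" for n :: nat using u[of "1 / (real n + 1)"] by simp
  then obtain q where q: "\<And>n::nat. q n \<in> L_closure" "\<And>n z. z \<in> space M \<Longrightarrow> \<bar>F z - q n z\<bar> < 1 / (real n + 1)"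
    by metis
  have qs: "q n \<in> sqi M" for n using q(1)[of n] by (simp add: L_closure_def)
  show ?thesis
  proof (rule L_closure_limit[OF q(1) F])
    have "(\<lambda>n. inner_L2 M (\<lambda>z. (q n z - F z) - 0) (\<lambda>z. (q n z - F z) - 0)) \<longlonglongrightarrow> 0"
    proof (rule L2_dominated_convergence[where w = "\<lambda>_. 1"])
      show "AE z in M. \<bar>q n z - F z\<bar> \<le> 1" for n
      proof (rule AE_I2)
        fix z assume "z \<in> space M"
        from q(2)[OF this, of n] have "\<bar>F z - q n z\<bar> < 1 / (real n + 1)" .
        also have "\<dots> \<le> 1" by simp
        finally show "\<bar>q n z - F z\<bar> \<le> 1" by linarith
      qed
      show "AE z in M. (\<lambda>n. q n z - F z) \<longlonglongrightarrow> 0"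
      proof (rule AE_I2)
        fix z assume "z \<in> space M"
        show "(\<lambda>n. q n z - F z) \<longlonglongrightarrow> 0"
        proof (rule Lim_null_comparison)
          show "\<forall>\<^sub>F n in sequentially. norm (q n z - F z) \<le> 1 / real (Suc n)"
            using q(2)[OF \<open>z \<in> space M\<close>] by (auto simp: abs_minus_commute add.commute intro!: always_eventually less_imp_le)
        qed (rule lim_inverse_n'[THEN LIMSEQ_Suc])
      qed
      show "(\<lambda>_. 1) \<in> sqi M" by (rule M.sqi_bounded[of _ 1]) auto
    qed (intro sqi_measurable sqi_diff qs F borel_measurable_const)+
    then show "(\<lambda>n. inner_L2 M (\<lambda>z. q n z - F z) (\<lambda>z. q n z - F z)) \<longlonglongrightarrow> 0" by simp
  qed
qed

lemma continuous_L_closure: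
  fixes F :: "real \<times> real \<Rightarrow> real"
  assumes F: "continuous_on UNIV F"
  shows "F \<in> L_closure"
proof (rule uniform_L_closure)
  show "F \<in> sqi M" using continuous_sqi[OF F] by blast
  fix \<epsilon> :: real assume "\<epsilon> > 0"
  have "compact ({0..l} \<times> {0..T})" by (auto intro: compact_Times)
  from Stone_Weierstrass_real_polynomial_function[OF this continuous_on_subset[OF F] \<open>\<epsilon> > 0\<close>]
  obtain q where "real_polynomial_function q" "\<And>z. z \<in> {0..l} \<times> {0..T} \<Longrightarrow> \<bar>F z - q z\<bar> < \<epsilon>" by auto
  then show "\<exists>q\<in>L_closure. \<forall>z\<in>space M. \<bar>F z - q z\<bar> < \<epsilon>"
    by (intro bexI[of _ q] polynomial_L_closure) (auto simp: space_pair_measure)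
qed

text \<open>A measurable function is a pointwise limit of continuous functions outside a negligible
  set. Truncating these at \<open>c\<close> keeps them continuous, does not change the limit, and
  provides the dominating constant.\<close>

lemma bounded_L_closure:
  assumes F: "F \<in> borel_measurable M" "\<And>z. \<bar>F z\<bar> \<le> c"
  shows "F \<in> L_closure"
proof -
  have "F \<in> borel_measurable (lebesgue_on (Omega l T))"
    using F(1) unfolding M_eq by (intro measurable_lebesgue_onI) auto
  then have "F measurable_on (Omega l T)"
    by (subst measurable_on_iff_borel_measurable) (auto intro: sets_completionI_sets)
  then obtain N g where g: "negligible N" "\<And>n::nat. continuous_on UNIV (g n)"
    "\<And>x. x \<notin> N \<Longrightarrow> (\<lambda>n. g n x) \<longlonglongrightarrow> (if x \<in> Omega l T then F x else 0)"
    unfolding measurable_on_def by blast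
  let ?g = "\<lambda>n z. max (- c) (min c (g n z))"
  have "?g n \<in> L_closure" for n by (intro continuous_L_closure continuous_intros g)
  then show ?thesis
  proof (rule L_closure_limit)
    show Fs: "F \<in> sqi M" by (rule M.sqi_bounded[OF F])
    have gs: "?g n \<in> sqi M" for n using \<open>\<And>n. ?g n \<in> L_closure\<close>[of n] by (simp add: L_closure_def)
    show "(\<lambda>n. inner_L2 M (\<lambda>z. ?g n z - F z) (\<lambda>z. ?g n z - F z)) \<longlonglongrightarrow> 0"
    proof (rule L2_dominated_convergence[where w = "\<lambda>_. c"])
      have c: "0 \<le> c" using F(2)[of "(0,0)"] by linarith
      show "(\<lambda>_. c) \<in> sqi M" by (rule M.sqi_bounded[of _ "\<bar>c\<bar>"]) auto
      show "AE z in M. \<bar>?g n z\<bar> \<le> c" for n using c by (auto simp: max_def min_def)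
      have "AE z in lebesgue. z \<notin> N" using g(1) by (simp add: AE_not_in negligible_iff_null_sets)
      then have "AE z in lborel. z \<in> Omega l T \<longrightarrow> z \<notin> N"
        unfolding AE_completion_iff by eventually_elim auto
      then have "AE z in M. z \<notin> N"
        unfolding M_eq by (subst AE_restrict_space_iff) auto
      with AE_space show "AE z in M. (\<lambda>n. ?g n z) \<longlonglongrightarrow> F z"
      proof eventually_elim
        case (elim z)
        then have "z \<in> Omega l T" by (simp add: Omega_def space_pair_measure)
        then have "(\<lambda>n. g n z) \<longlonglongrightarrow> F z" using g(3)[OF elim(2)] by simp
        then have "(\<lambda>n. ?g n z) \<longlonglongrightarrow> max (- c) (min c (F z))" by (intro tendsto_intros)
        moreover have "max (- c) (min c (F z)) = F z" using F(2)[of z] by auto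
        ultimately show ?case by simp
      qed
    qed (intro sqi_measurable gs Fs)+
  qed
qed

lemma L_dense:
  assumes F: "F \<in> sqi M"
  shows "\<exists>G. (\<forall>n. G n \<in> sqi M) \<and>
      (\<lambda>n::nat. inner_L2 M (\<lambda>z. L (G n) z - F z) (\<lambda>z. L (G n) z - F z)) \<longlonglongrightarrow> 0"
proof -
  let ?F = "\<lambda>n z. max (- real n) (min (real n) (F z))"
  have b: "?F n \<in> L_closure" for n
  proof (rule bounded_L_closure[of _ "real n"])
    note [measurable] = sqi_measurable[OF F]
    show "?F n \<in> borel_measurable M" by measurable
  qed auto
  have "F \<in> L_closure"
  proof (rule L_closure_limit[OF b F])
    have Fs: "?F n \<in> sqi M" for n using b[of n] by (simp add: L_closure_def)
    show "(\<lambda>n. inner_L2 M (\<lambda>z. ?F n z - F z) (\<lambda>z. ?F n z - F z)) \<longlonglongrightarrow> 0"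
    proof (rule L2_dominated_convergence[where w = "\<lambda>z. \<bar>F z\<bar>"])
      show "(\<lambda>z. \<bar>F z\<bar>) \<in> sqi M" using F by (auto simp: sqi_def)
      show "AE z in M. (\<lambda>n. ?F n z) \<longlonglongrightarrow> F z"
      proof (rule AE_I2)
        fix z
        obtain m :: nat where m: "\<bar>F z\<bar> < real m" using reals_Archimedean2 by blast
        have "?F n z = F z" if "n \<ge> m" for n using m that by auto
        then show "(\<lambda>n. ?F n z) \<longlonglongrightarrow> F z" by (intro tendsto_eventually) (auto simp: eventually_sequentially)
      qed
      show "AE z in M. \<bar>?F n z\<bar> \<le> \<bar>F z\<bar>" for n by (rule AE_I2) auto
    qed (intro sqi_measurable Fs F)+
  qed
  then have "\<exists>G\<in>sqi M. inner_L2 M (\<lambda>z. L G z - F z) (\<lambda>z. L G z - F z) < 1 / real (Suc n)" for n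
    by (simp add: L_closure_def)
  then obtain G where G: "\<And>n. G n \<in> sqi M"
    "\<And>n. inner_L2 M (\<lambda>z. L (G n) z - F z) (\<lambda>z. L (G n) z - F z) < 1 / real (Suc n)" by metis
  have "(\<lambda>n. inner_L2 M (\<lambda>z. L (G n) z - F z) (\<lambda>z. L (G n) z - F z)) \<longlonglongrightarrow> 0"
  proof (rule tendsto_sandwich[OF _ _ tendsto_const lim_inverse_n'[THEN LIMSEQ_Suc]])
    show "\<forall>\<^sub>F n in sequentially. inner_L2 M (\<lambda>z. L (G n) z - F z) (\<lambda>z. L (G n) z - F z) \<le> 1 / real (Suc n)"
      using G(2) by (intro always_eventually allI less_imp_le)
  qed (simp add: inner_L2_nonneg)
  with G(1) show ?thesis by blast
qed

end


subsection \<open>From weak solutions to the integrated identities\<close>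

context strip begin

lemma integral_Omega_AE:
  fixes g G :: "real \<times> real \<Rightarrow> real"
  assumes "G \<in> borel_measurable M" "AE z in M. g z = G z"
  shows "integral\<^sup>L (lebesgue_on (Omega l T)) g = integral\<^sup>L M G"
  unfolding M_eq by (rule integral_lebesgue_on_AE[OF Omega_borel assms[unfolded M_eq]])

text \<open>Clamping a Borel representative to the essential bounds makes them hold at every point
  and changes it on a null set only. That \<open>lo\<close> is at most \<open>hi\<close> follows
  because the bounds hold somewhere.\<close>

lemma coefficient_representative:
  assumes "coefficient l lo hi a"
  obtains a' where "a' \<in> borel_measurable X" "\<forall>x. lo \<le> a' x" "\<forall>x. a' x \<le> hi" "AE x in X. a x = a' x"
proof -
  have a: "a \<in> borel_measurable (lebesgue_on {0<..<l})" and b: "AE x in X. lo \<le> a x \<and> a x \<le> hi"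
    using assms unfolding coefficient_def AE_lebesgue_ival by auto
  obtain c where c: "c \<in> borel_measurable (borel_on {0<..<l})" "AE x in lebesgue_on {0<..<l}. a x = c x"
    by (rule borel_representative[OF _ a]) auto
  have [measurable]: "c \<in> borel_measurable X" using c(1) by (simp add: ival_def)
  have "AE x in X. lo \<le> hi" using b by eventually_elim auto
  then have "lo \<le> hi" by (rule AE_X_const)
  show ?thesis
  proof (rule that[of "\<lambda>x. max lo (min hi (c x))"])
    show "(\<lambda>x. max lo (min hi (c x))) \<in> borel_measurable X" by measurable
    show "AE x in X. a x = max lo (min hi (c x))"
      using b c(2)[unfolded AE_lebesgue_ival] by eventually_elim auto
  qed (use \<open>lo \<le> hi\<close> in auto)
qed

end

text \<open>The coefficients with suffix \<open>A\<close> are the given ones; those of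
  \<open>beam\<close> are representatives bounded everywhere. \<open>l / 4 * l\<close> is the sup
  bound of the Green kernel times the length of the interval.\<close>

locale beam_problem = strip l T +
  B: beam "ival 0 l" T "green l" "green' l" "l / 4" 1 "l / 4 * l" \<rho> \<mu> Tr r \<kappa> \<rho>0 \<rho>1 \<mu>1 Tr1 r0 r1 \<kappa>0 \<kappa>1
  for l T :: real and \<rho> \<mu> Tr r \<kappa> and \<rho>0 \<rho>1 \<mu>1 Tr1 r0 r1 \<kappa>0 \<kappa>1 :: real +
  fixes \<rho>A \<mu>A TrA rA \<kappa>A :: "real \<Rightarrow> real"
  assumes coef_AE: "AE x in ival 0 l. \<rho>A x = \<rho> x" "AE x in ival 0 l. \<mu>A x = \<mu> x" "AE x in ival 0 l. TrA x = Tr x"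
    "AE x in ival 0 l. rA x = r x" "AE x in ival 0 l. \<kappa>A x = \<kappa> x"
begin

abbreviation "N0 \<equiv> opx X (\<lambda>_. green0 l)"
abbreviation "Nl \<equiv> opx X (\<lambda>_. greenl l)"

lemmas kernN = kernel_green(3)[OF l_pos] kernel_green(4)[OF l_pos]

text \<open>The sign \<open>s\<close> is 1 for the forward and -1 for the adjoint problem, which
  differ in the signs of the two damping terms.\<close>

lemma weak_form_eq:
  assumes ae: "AE z in M. wt z = wt' z" "AE z in M. wx z = wx' z" "AE z in M. wxx z = f z"
    and sq: "wt' \<in> sqi M" "wx' \<in> sqi M" "f \<in> sqi M" "v \<in> sqi M" "vx \<in> sqi M" "vxx \<in> sqi M" "vt \<in> sqi M" "vxxt \<in> sqi M"
  shows "(\<integral>(x,t). - \<rho>A x * wt (x,t) * vt (x,t) + s * \<mu>A x * wt (x,t) * v (x,t)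
                + TrA x * wx (x,t) * vx (x,t) + rA x * wxx (x,t) * vxx (x,t)
                - s * \<kappa>A x * wxx (x,t) * vxxt (x,t) \<partial>lebesgue_on (Omega l T))
    = - inner_L2 M (mulx \<rho> wt') vt + s * inner_L2 M (mulx \<mu> wt') v + inner_L2 M (mulx Tr wx') vx
      + inner_L2 M (mulx r f) vxx - s * inner_L2 M (mulx \<kappa> f) vxxt" (is "?l = ?r")
proof -
  note i = B.coef_sqi(1)[OF sq(1)] B.coef_sqi(2)[OF sq(1)] B.coef_sqi(3)[OF sq(2)] B.coef_sqi(4)[OF sq(3)] B.coef_sqi(5)[OF sq(3)]
  note j = sqi_integrable_mult[OF i(1) sq(7)] sqi_integrable_mult[OF i(2) sq(4)] sqi_integrable_mult[OF i(3) sq(5)]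
    sqi_integrable_mult[OF i(4) sq(6)] sqi_integrable_mult[OF i(5) sq(8)]
  let ?G = "\<lambda>z. - (mulx \<rho> wt' z * vt z) + s * (mulx \<mu> wt' z * v z) + mulx Tr wx' z * vx z + mulx r f z * vxx z
      - s * (mulx \<kappa> f z * vxxt z)"
  have "?l = integral\<^sup>L M ?G"
  proof (rule integral_Omega_AE)
    note [measurable] = j[THEN borel_measurable_integrable]
    show "?G \<in> borel_measurable M" by measurable
    show "AE z in M. (case z of (x, t) \<Rightarrow> - \<rho>A x * wt (x,t) * vt (x,t) + s * \<mu>A x * wt (x,t) * v (x,t)
                + TrA x * wx (x,t) * vx (x,t) + rA x * wxx (x,t) * vxx (x,t)
                - s * \<kappa>A x * wxx (x,t) * vxxt (x,t)) = ?G z"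
      using ae AE_fst[OF coef_AE(1)] AE_fst[OF coef_AE(2)] AE_fst[OF coef_AE(3)] AE_fst[OF coef_AE(4)] AE_fst[OF coef_AE(5)]
      by eventually_elim (auto simp: mulx_def)
  qed
  also have "\<dots> = ?r" using j by (simp add: inner_L2_def)
  finally show ?thesis .
qed

text \<open>Inserts the test functions \<open>k (I h)\<close> and moves every \<open>I\<close> to
  the other factor; the boundary slopes come from the Green representation of
  \<open>u\<close>.\<close>

lemma forward_solves:
  assumes u: "forward_weak_solution l T \<rho>A \<mu>A TrA rA \<kappa>A F u" and F: "F \<in> L2 (Omega l T)"
    and F': "F' \<in> sqi M" "AE z in M. F z = F' z"
  obtains f ut where "B.solves F' f ut"
    "AE t in Y. dx_at l u 0 t = (\<integral>y. green0 l y * f (y,t) \<partial>X)"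
    "AE t in Y. dx_at l u l t = (\<integral>y. greenl l y * f (y,t) \<partial>X)"
proof -
  obtain ux uxx ut0 where w: "weak_solution_space l T u ux uxx ut0" "vanishes_at_time l 0 u"
    and eq: "\<And>v vx vxx vt vxxt. H1_V2 l T v vx vxx vt vxxt \<Longrightarrow> vanishes_at_time l T v \<Longrightarrow>
           (\<integral>(x,t). - \<rho>A x * ut0 (x,t) * vt (x,t) + \<mu>A x * ut0 (x,t) * v (x,t)
                + TrA x * ux (x,t) * vx (x,t) + rA x * uxx (x,t) * vxx (x,t)
                - \<kappa>A x * uxx (x,t) * vxxt (x,t) \<partial>lebesgue_on (Omega l T))
             = (\<integral>z. F z * v z \<partial>lebesgue_on (Omega l T))"
    using u unfolding forward_weak_solution_def by blast
  have w': "L2_V2 l T u ux uxx" "weak_dt l T u ut0" "time_continuous l T u"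
    using w(1) by (auto simp: weak_solution_space_def)
  have uL2: "uxx \<in> L2 (Omega l T)" "ut0 \<in> L2 (Omega l T)" using w' by (auto simp: L2_V2_def weak_dt_def)
  obtain f where f: "f \<in> sqi M" "AE z in M. uxx z = f z" by (rule representative[OF uL2(1)])
  obtain ut where ut: "ut \<in> sqi M" "AE z in M. ut0 z = ut z" by (rule representative[OF uL2(2)])
  note g = L2_V2_eq_green[OF w'(1) f]
  have uL: "AE z in M. u z = L ut z" by (rule time_representation_0[OF w'(2,3) w(2) ut])
  have kL: "AE z in M. k f z = L ut z" using g(1) uL by eventually_elim simp
  note S = B.sqi_rules
  have "B.form f (L f) ut h = inner_L2 M (L F') (k h)" if h: "h \<in> sqi M" for h
  proof -
    note s = f(1) ut(1) h F'(1)
    have "(\<integral>(x,t). - \<rho>A x * ut0 (x,t) * - k h (x,t) + 1 * \<mu>A x * ut0 (x,t) * k (I h) (x,t)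
                + TrA x * ux (x,t) * k' (I h) (x,t) + rA x * uxx (x,t) * I h (x,t)
                - 1 * \<kappa>A x * uxx (x,t) * - h (x,t) \<partial>lebesgue_on (Omega l T))
      = - inner_L2 M (mulx \<rho> ut) (\<lambda>z. - k h z) + 1 * inner_L2 M (mulx \<mu> ut) (k (I h)) + inner_L2 M (mulx Tr (k' f)) (k' (I h))
      + inner_L2 M (mulx r f) (I h) - 1 * inner_L2 M (mulx \<kappa> f) (\<lambda>z. - h z)"
      by (rule weak_form_eq[OF ut(2) g(2) f(2)]) (intro S s)+
    moreover have "(\<integral>z. F z * k (I h) z \<partial>lebesgue_on (Omega l T)) = inner_L2 M F' (k (I h))"
      unfolding inner_L2_def
    proof (rule integral_Omega_AE)
      have "k (I h) \<in> sqi M" by (intro S s)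
      then show "(\<lambda>z. F' z * k (I h) z) \<in> borel_measurable M"
        by (rule borel_measurable_integrable[OF sqi_integrable_mult[OF F'(1)]])
    qed (use F'(2) in \<open>auto elim: eventually_mono\<close>)
    ultimately have "inner_L2 M (mulx \<rho> ut) (k h) + inner_L2 M (mulx \<mu> ut) (k (I h)) + inner_L2 M (mulx Tr (k' f)) (k' (I h))
      + inner_L2 M (mulx r f) (I h) + inner_L2 M (mulx \<kappa> f) h = inner_L2 M F' (k (I h))"
      using eq[OF test_forward[OF h]] by (simp add: inner_L2_uminus)
    \<comment> \<open>The time derivative disappears here: \<open>I\<close> moved to
      \<open>ut\<close> becomes \<open>L ut\<close>, which is \<open>k f\<close>.\<close>
    moreover have "inner_L2 M (mulx \<mu> ut) (k (I h)) = inner_L2 M (mulx \<mu> (k f)) (k h)"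
    proof -
      have "inner_L2 M (mulx \<mu> ut) (k (I h)) = inner_L2 M (mulx \<mu> (L ut)) (k h)"
        by (rule B.inner_k_I(1)[OF ut(1) h B.meas(2) B.coef_bounds(2)])
      also have "\<dots> = inner_L2 M (mulx \<mu> (k f)) (k h)"
        using kL by (intro inner_L2_cong_AE B.mulx_cong_AE) (auto intro!: sqi_measurable S s elim: eventually_mono)
      finally show ?thesis .
    qed
    moreover have "inner_L2 M (mulx Tr (k' f)) (k' (I h)) = inner_L2 M (mulx Tr (k' (L f))) (k' h)"
    proof -
      have "inner_L2 M (mulx Tr (k' f)) (k' (I h)) = inner_L2 M (mulx Tr (L (k' f))) (k' h)"
        by (rule B.inner_k_I(2)[OF _ h B.meas(3) B.coef_bounds(3)]) (intro S s)
      also have "\<dots> = inner_L2 M (mulx Tr (k' (L f))) (k' h)"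
        using B.commute_AE(2)[OF f(1)]
        by (intro inner_L2_cong_AE B.mulx_cong_AE) (auto intro!: sqi_measurable S s elim: eventually_mono)
      finally show ?thesis .
    qed
    moreover have "inner_L2 M (mulx r f) (I h) = inner_L2 M (mulx r (L f)) h"
      by (rule B.inner_k_I(3)[OF f(1) h B.meas(4) B.coef_bounds(4)])
    moreover have "inner_L2 M F' (k (I h)) = inner_L2 M (L F') (k h)"
      using B.inner_k_I(1)[OF F'(1) h, of "\<lambda>_. 1" 1] by (simp add: B.mulx_1)
    ultimately show ?thesis by (simp add: B.form_def)
  qed
  then have "B.solves F' f ut" using f(1) ut(1) F'(1) kL by (simp add: B.solves_def)
  then show ?thesis using g(3,4) by (rule that)
qed

lemma trace_sqi:
  assumes f: "f \<in> sqi M" and th: "\<theta> \<in> sqi Y" and n: "kernel X (\<lambda>_. n) c"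
  shows "(\<lambda>z. (opx X (\<lambda>_. n) f z - \<theta> (snd z)) / l) \<in> sqi M"
proof -
  have "(\<lambda>z. 1 * \<theta> (snd z)) \<in> sqi M"
    by (rule const_tensor_sqi[OF _ th, of "\<lambda>_. 1"]) (auto intro: X.sqi_bounded[of _ 1])
  then have "(\<lambda>z. 1 / l * (opx X (\<lambda>_. n) f z - \<theta> (snd z))) \<in> sqi M"
    by (intro sqi_cmult sqi_diff opx_sqi[OF n f]) simp
  then show ?thesis by simp
qed

text \<open>Explains the division by \<open>l\<close> in the lifted boundary data: integrating over
  \<open>x\<close> multiplies by the length \<open>l\<close>.\<close>

lemma inner_time_only:
  assumes "f \<in> sqi M" "g \<in> sqi M" "\<And>x t. f (x,t) = a t" "\<And>x t. g (x,t) = b t"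
  shows "inner_L2 M f g = l * inner_L2 Y a b"
proof -
  have "inner_L2 X (\<lambda>x. f (x,t)) (\<lambda>x. g (x,t)) = l * (a t * b t)" for t
    using l_pos measure_ival[of 0 l] by (simp add: inner_L2_def assms)
  then show ?thesis using inner_sections_snd(1)[OF assms(1,2)] by (simp add: inner_L2_def[of Y])
qed

lemma adjoint_solves_L:
  assumes "adjoint_weak_solution l T \<rho>A \<mu>A TrA rA \<kappa>A p q \<phi>"
    and P: "P \<in> sqi M" "\<And>x t. P (x,t) = p' t / l" "AE t in Y. p t = p' t"
    and Q: "Q \<in> sqi M" "\<And>x t. Q (x,t) = q' t / l" "AE t in Y. q t = q' t"
  obtains \<psi> \<omega> where "B.adjoint_solves (\<lambda>_. green0 l) (\<lambda>_. greenl l) P Q \<psi> \<omega>" "AE z in M. \<phi> z = k \<psi> z" "\<phi> \<in> L2 (Omega l T)"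
proof -
  obtain \<phi>x \<phi>xx \<phi>t where w: "weak_solution_space l T \<phi> \<phi>x \<phi>xx \<phi>t" "vanishes_at_time l T \<phi>"
    and eq: "\<And>v vx vxx vt vxxt. H1_V2 l T v vx vxx vt vxxt \<Longrightarrow> vanishes_at_time l 0 v \<Longrightarrow>
           (\<integral>(x,t). - \<rho>A x * \<phi>t (x,t) * vt (x,t) - \<mu>A x * \<phi>t (x,t) * v (x,t)
                + TrA x * \<phi>x (x,t) * vx (x,t) + rA x * \<phi>xx (x,t) * vxx (x,t)
                + \<kappa>A x * \<phi>xx (x,t) * vxxt (x,t) \<partial>lebesgue_on (Omega l T))
             = (\<integral>t. p t * dx_at l v 0 t + q t * dx_at l v l t \<partial>lebesgue_on {0<..<T})"
    using assms(1) unfolding adjoint_weak_solution_def by blast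
  have w': "L2_V2 l T \<phi> \<phi>x \<phi>xx" "weak_dt l T \<phi> \<phi>t" "time_continuous l T \<phi>"
    using w(1) by (auto simp: weak_solution_space_def)
  have \<phi>L: "\<phi> \<in> L2 (Omega l T)" "\<phi>xx \<in> L2 (Omega l T)" "\<phi>t \<in> L2 (Omega l T)"
    using w' by (auto simp: L2_V2_def weak_dt_def)
  obtain \<psi> where f: "\<psi> \<in> sqi M" "AE z in M. \<phi>xx z = \<psi> z" by (rule representative[OF \<phi>L(2)])
  obtain ft where ft: "ft \<in> sqi M" "AE z in M. \<phi>t z = ft z" by (rule representative[OF \<phi>L(3)])
  \<comment> \<open>As the adjoint solution vanishes at \<open>T\<close>, it is \<open>I\<close> of
    minus its time derivative.\<close>
  define \<omega> where "\<omega> = (\<lambda>z. - ft z)"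
  have om: "\<omega> \<in> sqi M" unfolding \<omega>_def by (rule sqi_uminus[OF ft(1)])
  have m\<omega>: "mulx a \<omega> = (\<lambda>z. - mulx a ft z)" for a by (auto simp: mulx_def \<omega>_def)
  note g = L2_V2_eq_green[OF w'(1) f]
  have uL: "AE z in M. \<phi> z = I \<omega> z" unfolding \<omega>_def by (rule time_representation_T[OF w'(2,3) w(2) ft])
  have kL: "AE z in M. k \<psi> z = I \<omega> z" using g(1) uL by eventually_elim simp
  note S = B.sqi_rules
  \<comment> \<open>Trace kernels act in \<open>x\<close> and commute with \<open>L\<close>; its
    adjoint \<open>I\<close> then falls on the boundary data.\<close>
  have tr: "inner_L2 M P' (opx X (\<lambda>_. n) (L h)) = inner_L2 M (I P') (opx X (\<lambda>_. n) h)"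
    if h: "h \<in> sqi M" and P': "P' \<in> sqi M" and n: "kernel X (\<lambda>_. n) c" for h P' n c
  proof -
    have "inner_L2 M P' (opx X (\<lambda>_. n) (L h)) = inner_L2 M P' (L (opx X (\<lambda>_. n) h))"
      using opx_opt_commute_AE[OF n kernel_past h]
      by (intro inner_L2_cong_AE) (auto intro!: sqi_measurable S h P' opx_sqi[OF n] elim: eventually_mono)
    then show ?thesis
      using L_adjoint[OF opx_sqi[OF n h] P'] by (simp add: inner_L2_commute)
  qed
  have "B.form \<psi> (I \<psi>) \<omega> h = inner_L2 M (I P) (N0 h) + inner_L2 M (I Q) (Nl h)" if h: "h \<in> sqi M" for h
  proof -
    note s = f(1) ft(1) h om
    have "(\<integral>(x,t). - \<rho>A x * \<phi>t (x,t) * k h (x,t) + (-1) * \<mu>A x * \<phi>t (x,t) * k (L h) (x,t)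
                + TrA x * \<phi>x (x,t) * k' (L h) (x,t) + rA x * \<phi>xx (x,t) * L h (x,t)
                - (-1) * \<kappa>A x * \<phi>xx (x,t) * h (x,t) \<partial>lebesgue_on (Omega l T))
      = - inner_L2 M (mulx \<rho> ft) (k h) + (-1) * inner_L2 M (mulx \<mu> ft) (k (L h)) + inner_L2 M (mulx Tr (k' \<psi>)) (k' (L h))
      + inner_L2 M (mulx r \<psi>) (L h) - (-1) * inner_L2 M (mulx \<kappa> \<psi>) h"
      by (rule weak_form_eq[OF ft(2) g(2) f(2)]) (intro S s)+
    then have lhs: "(\<integral>(x,t). - \<rho>A x * \<phi>t (x,t) * k h (x,t) - \<mu>A x * \<phi>t (x,t) * k (L h) (x,t)
                + TrA x * \<phi>x (x,t) * k' (L h) (x,t) + rA x * \<phi>xx (x,t) * L h (x,t)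
                + \<kappa>A x * \<phi>xx (x,t) * h (x,t) \<partial>lebesgue_on (Omega l T))
      = inner_L2 M (mulx \<rho> \<omega>) (k h) + inner_L2 M (mulx \<mu> \<omega>) (k (L h)) + inner_L2 M (mulx Tr (k' \<psi>)) (k' (L h))
      + inner_L2 M (mulx r \<psi>) (L h) + inner_L2 M (mulx \<kappa> \<psi>) h"
      by (simp add: m\<omega> inner_L2_uminus)
    have Lh: "L h \<in> sqi M" by (rule L_sqi[OF h])
    note gv = L2_V2_eq_green(3,4)[OF L2_V2_green[OF Lh] Lh, OF AE_I2[OF refl]]
    have nsq: "N0 (L h) \<in> sqi M" "Nl (L h) \<in> sqi M" by (intro opx_sqi[OF kernN(1)] opx_sqi[OF kernN(2)] Lh)+
    define a b where "a t = (\<integral>y. green0 l y * L h (y,t) \<partial>X)" and "b t = (\<integral>y. greenl l y * L h (y,t) \<partial>X)" for t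
    have N: "N0 (L h) (x,t) = a t" "Nl (L h) (x,t) = b t" for x t by (simp_all add: opx_apply kop_def a_def b_def)
    have sY: "h \<in> sqi Y" if "f \<in> sqi M" "\<And>x t. f (x,t) = h t" for f h
    proof -
      have "AE x in X. h \<in> sqi Y" using sqi_section_fst[OF that(1)] by (simp add: that(2) eta_contract_eq)
      then show ?thesis by (rule AE_X_const)
    qed
    have ab: "a \<in> sqi Y" "b \<in> sqi Y" using sY[OF nsq(1) N(1)] sY[OF nsq(2) N(2)] by auto
    have pq: "(\<lambda>t. p' t / l) \<in> sqi Y" "(\<lambda>t. q' t / l) \<in> sqi Y" using sY[OF P(1,2)] sY[OF Q(1,2)] by auto
    note i = sqi_integrable_mult[OF pq(1) ab(1)] sqi_integrable_mult[OF pq(2) ab(2)]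
    have "(\<integral>t. p t * dx_at l (k (L h)) 0 t + q t * dx_at l (k (L h)) l t \<partial>lebesgue_on {0<..<T})
      = (\<integral>t. l * (p' t / l * a t) + l * (q' t / l * b t) \<partial>Y)"
    proof (rule integral_lebesgue_on_ival)
      note [measurable] = i[THEN borel_measurable_integrable]
      show "(\<lambda>t. l * (p' t / l * a t) + l * (q' t / l * b t)) \<in> borel_measurable Y" by measurable
      show "AE t in Y. p t * dx_at l (k (L h)) 0 t + q t * dx_at l (k (L h)) l t = l * (p' t / l * a t) + l * (q' t / l * b t)"
        using gv P(3) Q(3) by eventually_elim (use l_pos in \<open>simp add: a_def b_def\<close>)
    qed
    also have "\<dots> = l * (\<integral>t. p' t / l * a t \<partial>Y) + l * (\<integral>t. q' t / l * b t \<partial>Y)"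
      using i by (simp only: Bochner_Integration.integral_add integrable_mult_right integral_mult_right_zero)
    also have "\<dots> = inner_L2 M P (N0 (L h)) + inner_L2 M Q (Nl (L h))"
      using inner_time_only[OF P(1) nsq(1) P(2) N(1)] inner_time_only[OF Q(1) nsq(2) Q(2) N(2)]
      by (simp add: inner_L2_def[of Y])
    also have "\<dots> = inner_L2 M (I P) (N0 h) + inner_L2 M (I Q) (Nl h)"
      using tr[OF h P(1) kernN(1)] tr[OF h Q(1) kernN(2)] by simp
    finally have rhs: "(\<integral>t. p t * dx_at l (k (L h)) 0 t + q t * dx_at l (k (L h)) l t \<partial>lebesgue_on {0<..<T})
      = inner_L2 M (I P) (N0 h) + inner_L2 M (I Q) (Nl h)" .
    \<comment> \<open>The counterpart of \<open>inner_k_I\<close> with \<open>L\<close> and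
      \<open>I\<close> exchanged.\<close>
    have com: "inner_L2 M (mulx a A) (k (L h)) = inner_L2 M (mulx a (I A)) (k h)"
      "inner_L2 M (mulx a A) (k' (L h)) = inner_L2 M (mulx a (I A)) (k' h)"
      "inner_L2 M (mulx a A) (L h) = inner_L2 M (mulx a (I A)) h"
      if A: "A \<in> sqi M" and a: "a \<in> borel_measurable X" "\<And>x. x \<in> space X \<Longrightarrow> \<bar>a x\<bar> \<le> c" for a A c
    proof -
      note m = mulx_sqi[OF A a]
      have e: "inner_L2 M (mulx a A) (L w) = inner_L2 M (mulx a (I A)) w" if "w \<in> sqi M" for w
        using L_adjoint[OF that m] by (simp add: inner_L2_commute mulx_def opt_mult_fst)
      show "inner_L2 M (mulx a A) (L h) = inner_L2 M (mulx a (I A)) h" by (rule e[OF h])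
      have "inner_L2 M (mulx a A) (k (L h)) = inner_L2 M (mulx a A) (L (k h))"
        by (intro inner_L2_cong_AE B.commute_AE h) (auto intro!: sqi_measurable m S h)
      then show "inner_L2 M (mulx a A) (k (L h)) = inner_L2 M (mulx a (I A)) (k h)" using e[of "k h"] S h by auto
      have "inner_L2 M (mulx a A) (k' (L h)) = inner_L2 M (mulx a A) (L (k' h))"
        by (intro inner_L2_cong_AE B.commute_AE h) (auto intro!: sqi_measurable m S h)
      then show "inner_L2 M (mulx a A) (k' (L h)) = inner_L2 M (mulx a (I A)) (k' h)" using e[of "k' h"] S h by auto
    qed
    have 1: "inner_L2 M (mulx \<mu> (I \<omega>)) (k h) = inner_L2 M (mulx \<mu> (k \<psi>)) (k h)"
      using kL by (intro inner_L2_cong_AE B.mulx_cong_AE) (auto intro!: sqi_measurable S s elim: eventually_mono)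
    have 2: "inner_L2 M (mulx Tr (I (k' \<psi>))) (k' h) = inner_L2 M (mulx Tr (k' (I \<psi>))) (k' h)"
      using B.commute_AE(4)[OF f(1)]
      by (intro inner_L2_cong_AE B.mulx_cong_AE) (auto intro!: sqi_measurable S s elim: eventually_mono)
    have 3: "inner_L2 M (mulx \<mu> \<omega>) (k (L h)) = inner_L2 M (mulx \<mu> (I \<omega>)) (k h)"
      by (rule com(1)[OF om B.meas(2) B.coef_bounds(2)])
    have 4: "inner_L2 M (mulx Tr (k' \<psi>)) (k' (L h)) = inner_L2 M (mulx Tr (I (k' \<psi>))) (k' h)"
      by (rule com(2)[OF B.K'_sqi[OF f(1)] B.meas(3) B.coef_bounds(3)])
    have 5: "inner_L2 M (mulx r \<psi>) (L h) = inner_L2 M (mulx r (I \<psi>)) h"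
      by (rule com(3)[OF f(1) B.meas(4) B.coef_bounds(4)])
    show ?thesis
      using eq[OF test_adjoint[OF h]] unfolding lhs rhs B.form_def 3 4 5 1 2 .
  qed
  then have "B.adjoint_solves (\<lambda>_. green0 l) (\<lambda>_. greenl l) P Q \<psi> \<omega>"
    using f(1) om P(1) Q(1) kL by (simp add: B.adjoint_solves_def)
  then show ?thesis using g(1) \<phi>L(1) by (rule that)
qed

end


subsection \<open>The gradient\<close>

locale load_identification = beam_problem +
  fixes CF :: real and \<theta>\<^sub>0 \<theta>\<^sub>l :: "real \<Rightarrow> real" and u \<phi> :: "(real \<times> real \<Rightarrow> real) \<Rightarrow> real \<times> real \<Rightarrow> real"
  assumes CF: "CF > 0" and data: "\<theta>\<^sub>0 \<in> L2 {0<..<T}" "\<theta>\<^sub>l \<in> L2 {0<..<T}"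
    and forward: "\<And>F. F \<in> admissible_loads l T CF \<Longrightarrow> forward_weak_solution l T \<rho>A \<mu>A TrA rA \<kappa>A F (u F)"
    and adjoint: "\<And>F. F \<in> admissible_loads l T CF \<Longrightarrow> adjoint_weak_solution l T \<rho>A \<mu>A TrA rA \<kappa>A
        (\<lambda>t. dx_at l (u F) 0 t - \<theta>\<^sub>0 t) (\<lambda>t. dx_at l (u F) l t - \<theta>\<^sub>l t) (\<phi> F)"
begin

lemma norm_Omega: "h \<in> L2 (Omega l T) \<Longrightarrow> h' \<in> sqi M \<Longrightarrow> AE z in M. h z = h' z \<Longrightarrow> norm_L2 (Omega l T) h = sqrt (inner_L2 M h' h')"
  unfolding norm_L2_eq using inner_Omega[of h h h' h'] by simp

text \<open>The problem is linear and the admissible loads contain a ball around \<open>0\<close>.\<close>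

lemma solution_exists:
  assumes h: "h \<in> sqi M"
  shows "\<exists>f ut. B.solves h f ut"
proof -
  \<comment> \<open>Scales \<open>h\<close> into the admissible ball; the summand 1 prevents
    division by 0.\<close>
  define c where "c = sqrt (CF / (1 + inner_L2 M h h))"
  have nn: "0 \<le> inner_L2 M h h" by (rule inner_L2_nonneg)
  have c: "c > 0" "c\<^sup>2 * inner_L2 M h h \<le> CF"
    using CF nn by (auto simp: c_def field_simps)
  have ch: "(\<lambda>z. c * h z) \<in> sqi M" by (rule sqi_cmult[OF h])
  note chL = sqi_L2_Omega[OF ch]
  have "(norm_L2 (Omega l T) (\<lambda>z. c * h z))\<^sup>2 = c\<^sup>2 * inner_L2 M h h"
    using norm_Omega[OF chL ch] inner_L2_nonneg[of M "\<lambda>z. c * h z"] by (simp add: inner_L2_cmult power2_eq_square)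
  then have adm: "(\<lambda>z. c * h z) \<in> admissible_loads l T CF"
    using c chL by (simp add: admissible_loads_def)
  obtain f ut where S: "B.solves (\<lambda>z. c * h z) f ut"
    by (rule forward_solves[OF forward[OF adm] chL ch AE_I2[OF refl]])
  \<comment> \<open>Undoes the scaling in the form that \<open>solves_lincomb\<close> offers: one
    copy of the solution plus \<open>1/c - 1\<close> further ones.\<close>
  have "c * h z + (1 / c - 1) * (c * h z) = h z" for z using c by (simp add: field_simps)
  then show ?thesis using B.solves_lincomb[OF S S, of "1 / c - 1"] by auto
qed

sublocale BD: beam_dense "ival 0 l" T "green l" "green' l" "l / 4" 1 "l / 4 * l" \<rho> \<mu> Tr r \<kappa> \<rho>0 \<rho>1 \<mu>1 Tr1 r0 r1 \<kappa>0 \<kappa>1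
  by unfold_locales (rule L_dense solution_exists; assumption)+

text \<open>The geometric mean of the two constants of \<open>energy_bound\<close>, divided by
  \<open>r0\<close>. As it compares squared norms, its square root bounds the map from the load to
  the second space derivative.\<close>

definition \<Gamma> :: real where
  "\<Gamma> = sqrt (4 * T\<^sup>2 / \<rho>0 * (T * (l / 4 * l)\<^sup>2 / (2 * \<kappa>0))) / r0"

lemma \<Gamma>_nonneg: "0 \<le> \<Gamma>"
  unfolding \<Gamma>_def using B.pos T_pos by (intro divide_nonneg_pos real_sqrt_ge_zero) auto

text \<open>The two bounds are multiplied and the square root is taken for \<open>L f\<close> and
  \<open>L F\<close>; \<open>solution_bound\<close> then passes to \<open>f\<close> and
  \<open>F\<close>.\<close>

lemma solution_norm_le:
  assumes "B.solves F f ut"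
  shows "inner_L2 M f f \<le> \<Gamma> * inner_L2 M F F"
proof (rule BD.solution_bound[OF assms])
  fix F f ut assume S: "B.solves F f ut"
  define x A a b where "x = inner_L2 M (L f) (L f)" and "A = inner_L2 M (L F) (L F)"
    and "a = 4 * T\<^sup>2 / \<rho>0" and "b = T * (l / 4 * l)\<^sup>2 / (2 * \<kappa>0)"
  have 1: "r0 * x \<le> a * A" "r0 * x \<le> b * A"
    using B.energy_bound[OF S] by (simp_all add: x_def A_def a_def b_def)
  have nn: "0 \<le> x" "0 \<le> A" "0 \<le> a" "0 \<le> b"
    using B.pos T_pos by (auto simp: x_def A_def a_def b_def inner_L2_nonneg)
  have "(r0 * x) * (r0 * x) \<le> (a * A) * (b * A)"
    by (rule mult_mono[OF 1]) (use nn B.pos in auto)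
  also have "\<dots> = (sqrt (a * b) * A)\<^sup>2"
  proof -
    have "(sqrt (a * b) * A)\<^sup>2 = (a * b) * A\<^sup>2" using nn by (simp only: power_mult_distrib real_sqrt_pow2 mult_nonneg_nonneg)
    then show ?thesis by (simp only: power2_eq_square mult_ac)
  qed
  finally have "(r0 * x)\<^sup>2 \<le> (sqrt (a * b) * A)\<^sup>2" by (simp only: power2_eq_square)
  then have "r0 * x \<le> sqrt (a * b) * A"
    by (rule power2_le_imp_le) (intro mult_nonneg_nonneg real_sqrt_ge_zero nn)
  then have "x \<le> sqrt (a * b) * A / r0" using B.pos by (simp add: pos_le_divide_eq mult.commute)
  then show "x \<le> \<Gamma> * A" by (simp add: \<Gamma>_def a_def b_def)
qed

lemma solution_norm_le': "B.solves F f ut \<Longrightarrow> sqrt (inner_L2 M f f) \<le> sqrt \<Gamma> * sqrt (inner_L2 M F F)"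
  using real_sqrt_le_mono[OF solution_norm_le] by (simp add: real_sqrt_mult)

lemma trace_norm_le:
  assumes "f \<in> sqi M"
  shows "inner_L2 M (N0 f) (N0 f) \<le> l\<^sup>2 * inner_L2 M f f" "inner_L2 M (Nl f) (Nl f) \<le> l\<^sup>2 * inner_L2 M f f"
  using opx_bound[OF kernN(1) assms] opx_bound[OF kernN(2) assms] measure_ival[of 0 l] l_pos by simp_all

lemma trace_norm_le':
  assumes "f \<in> sqi M"
  shows "sqrt (inner_L2 M (N0 f) (N0 f)) \<le> l * sqrt (inner_L2 M f f)" "sqrt (inner_L2 M (Nl f) (Nl f)) \<le> l * sqrt (inner_L2 M f f)"
  using real_sqrt_le_mono[OF trace_norm_le(1)[OF assms]] real_sqrt_le_mono[OF trace_norm_le(2)[OF assms]] l_pos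
  by (simp_all add: real_sqrt_mult)

text \<open>The adjoint data \<open>p\<close>, \<open>q\<close> are lifted to the functions \<open>p(t)/l\<close>, \<open>q(t)/l\<close> of \<open>(x,t)\<close>, so that boundary
  integrals become inner products over the rectangle.\<close>

lemma admissible_data:
  obtains \<theta> \<theta>' where "\<theta> \<in> sqi Y" "\<theta>' \<in> sqi Y"
    "\<forall>F F'. F \<in> admissible_loads l T CF \<longrightarrow> F' \<in> sqi M \<longrightarrow> (AE z in M. F z = F' z) \<longrightarrow>
      (\<exists>f ut P Q \<psi> \<omega>. B.solves F' f ut \<and> P \<in> sqi M \<and> Q \<in> sqi M \<and>
        (\<forall>z. P z = (N0 f z - \<theta> (snd z)) / l) \<and> (\<forall>z. Q z = (Nl f z - \<theta>' (snd z)) / l) \<and>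
        B.adjoint_solves (\<lambda>_. green0 l) (\<lambda>_. greenl l) P Q \<psi> \<omega> \<and> (AE z in M. \<phi> F z = k \<psi> z) \<and> \<phi> F \<in> L2 (Omega l T) \<and>
        tikhonov l T \<theta>\<^sub>0 \<theta>\<^sub>l u F = l / 2 * (inner_L2 M P P + inner_L2 M Q Q))"
proof -
  have rep: "\<exists>\<theta>'\<in>sqi Y. AE t in Y. \<theta> t = \<theta>' t" if "\<theta> \<in> L2 {0<..<T}" for \<theta>
    using L2_borel_representative[OF _ that] unfolding AE_lebesgue_ival ival_def by auto
  obtain \<theta> where th: "\<theta> \<in> sqi Y" "AE t in Y. \<theta>\<^sub>0 t = \<theta> t" using rep[OF data(1)] by blast
  obtain \<theta>' where th': "\<theta>' \<in> sqi Y" "AE t in Y. \<theta>\<^sub>l t = \<theta>' t" using rep[OF data(2)] by blast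
  show ?thesis
  proof (rule that[OF th(1) th'(1)], intro allI impI)
    fix F F' assume F: "F \<in> admissible_loads l T CF" and F': "F' \<in> sqi M" "AE z in M. F z = F' z"
    have FL: "F \<in> L2 (Omega l T)" using F by (simp add: admissible_loads_def)
    obtain f ut where S: "B.solves F' f ut"
      and d0: "AE t in Y. dx_at l (u F) 0 t = (\<integral>y. green0 l y * f (y,t) \<partial>X)"
      and dl: "AE t in Y. dx_at l (u F) l t = (\<integral>y. greenl l y * f (y,t) \<partial>X)"
      by (rule forward_solves[OF forward[OF F] FL F'])
    have f: "f \<in> sqi M" using S by (simp add: B.solves_def)
    define p q where "p t = (\<integral>y. green0 l y * f (y,t) \<partial>X) - \<theta> t" and "q t = (\<integral>y. greenl l y * f (y,t) \<partial>X) - \<theta>' t" for t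
    define P Q where "P z = (N0 f z - \<theta> (snd z)) / l" and "Q z = (Nl f z - \<theta>' (snd z)) / l" for z
    have PQ: "P \<in> sqi M" "Q \<in> sqi M"
      unfolding P_def Q_def by (rule trace_sqi[OF f th(1) kernN(1)] trace_sqi[OF f th'(1) kernN(2)])+
    have Pp: "P (x,t) = p t / l" "Q (x,t) = q t / l" for x t
      by (simp_all add: P_def Q_def p_def q_def opx_apply kop_def)
    have ae: "AE t in Y. dx_at l (u F) 0 t - \<theta>\<^sub>0 t = p t" "AE t in Y. dx_at l (u F) l t - \<theta>\<^sub>l t = q t"
      using d0 th(2) dl th'(2) by (auto simp: p_def q_def elim: eventually_elim2)
    obtain \<psi> \<omega> where A: "B.adjoint_solves (\<lambda>_. green0 l) (\<lambda>_. greenl l) P Q \<psi> \<omega>" "AE z in M. \<phi> F z = k \<psi> z" "\<phi> F \<in> L2 (Omega l T)"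
      by (rule adjoint_solves_L[OF adjoint[OF F] PQ(1) Pp(1) ae(1) PQ(2) Pp(2) ae(2)])
    \<comment> \<open>The lift is divided by \<open>l\<close>, so its squared norm over the
      rectangle is the boundary integral divided by \<open>l\<close>.\<close>
    have J: "(\<integral>t. (w t)\<^sup>2 \<partial>lebesgue_on {0<..<T}) = l * inner_L2 M R R"
      if "R \<in> sqi M" "\<And>x t. R (x,t) = p t / l" "AE t in Y. w t = p t" for R p w
    proof -
      have "AE x in X. (\<lambda>t. p t / l) \<in> sqi Y"
        using sqi_section_fst[OF that(1)] by (simp add: that(2))
      then have "(\<lambda>t. p t / l) \<in> sqi Y" by (rule AE_X_const)
      then have "(\<lambda>t. l * (p t / l)) \<in> sqi Y" by (rule sqi_cmult)
      then have "p \<in> sqi Y" using l_pos by simp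
      then have "(\<integral>t. (w t)\<^sup>2 \<partial>lebesgue_on {0<..<T}) = (\<integral>t. (p t)\<^sup>2 \<partial>Y)"
        by (intro integral_lebesgue_on_ival) (use that(3) in \<open>auto simp: sqi_def elim: eventually_mono\<close>)
      also have "\<dots> = l * inner_L2 M R R"
      proof -
        have "inner_L2 Y (\<lambda>t. p t / l) (\<lambda>t. p t / l) = (\<integral>t. (p t)\<^sup>2 \<partial>Y) / (l * l)"
          by (simp add: inner_L2_def power2_eq_square)
        then show ?thesis using inner_time_only[OF that(1,1,2,2)] l_pos by simp
      qed
      finally show ?thesis .
    qed
    have "tikhonov l T \<theta>\<^sub>0 \<theta>\<^sub>l u F = l / 2 * (inner_L2 M P P + inner_L2 M Q Q)"
      unfolding tikhonov_def J[OF PQ(1) Pp(1) ae(1)] J[OF PQ(2) Pp(2) ae(2)] by (simp add: algebra_simps)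
    then show "\<exists>f ut P Q \<psi> \<omega>. B.solves F' f ut \<and> P \<in> sqi M \<and> Q \<in> sqi M \<and>
        (\<forall>z. P z = (N0 f z - \<theta> (snd z)) / l) \<and> (\<forall>z. Q z = (Nl f z - \<theta>' (snd z)) / l) \<and>
        B.adjoint_solves (\<lambda>_. green0 l) (\<lambda>_. greenl l) P Q \<psi> \<omega> \<and> (AE z in M. \<phi> F z = k \<psi> z) \<and> \<phi> F \<in> L2 (Omega l T) \<and>
        tikhonov l T \<theta>\<^sub>0 \<theta>\<^sub>l u F = l / 2 * (inner_L2 M P P + inner_L2 M Q Q)"
      using S PQ A P_def Q_def by blast
  qed
qed

text \<open>By superposition the difference of the two solutions belongs to the load
  \<open>h'\<close>, and the measured data cancel in the difference of the adjoint data. Everything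
  needed about a pair of loads is collected here.\<close>

lemma load_increment:
  assumes F: "F \<in> admissible_loads l T CF" and Fh: "(\<lambda>z. F z + h z) \<in> admissible_loads l T CF"
    and h: "h' \<in> sqi M" "AE z in M. h z = h' z"
  obtains f ut P Q P' Q' \<psi> \<psi>' \<omega> \<omega>' where "B.solves h' f ut"
    "B.adjoint_solves (\<lambda>_. green0 l) (\<lambda>_. greenl l) P Q \<psi> \<omega>" "AE z in M. \<phi> F z = k \<psi> z" "\<phi> F \<in> L2 (Omega l T)"
    "B.adjoint_solves (\<lambda>_. green0 l) (\<lambda>_. greenl l) P' Q' \<psi>' \<omega>'" "AE z in M. \<phi> (\<lambda>z. F z + h z) z = k \<psi>' z"
    "\<phi> (\<lambda>z. F z + h z) \<in> L2 (Omega l T)"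
    "AE z in M. P' z = P z + 1 / l * N0 f z" "AE z in M. Q' z = Q z + 1 / l * Nl f z"
    "tikhonov l T \<theta>\<^sub>0 \<theta>\<^sub>l u F = l / 2 * (inner_L2 M P P + inner_L2 M Q Q)"
    "tikhonov l T \<theta>\<^sub>0 \<theta>\<^sub>l u (\<lambda>z. F z + h z) = l / 2 * (inner_L2 M P' P' + inner_L2 M Q' Q')"
proof -
  obtain \<theta> \<theta>' where th: "\<theta> \<in> sqi Y" "\<theta>' \<in> sqi Y"
    and D: "\<forall>F F'. F \<in> admissible_loads l T CF \<longrightarrow> F' \<in> sqi M \<longrightarrow> (AE z in M. F z = F' z) \<longrightarrow>
      (\<exists>f ut P Q \<psi> \<omega>. B.solves F' f ut \<and> P \<in> sqi M \<and> Q \<in> sqi M \<and>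
        (\<forall>z. P z = (N0 f z - \<theta> (snd z)) / l) \<and> (\<forall>z. Q z = (Nl f z - \<theta>' (snd z)) / l) \<and>
        B.adjoint_solves (\<lambda>_. green0 l) (\<lambda>_. greenl l) P Q \<psi> \<omega> \<and> (AE z in M. \<phi> F z = k \<psi> z) \<and> \<phi> F \<in> L2 (Omega l T) \<and>
        tikhonov l T \<theta>\<^sub>0 \<theta>\<^sub>l u F = l / 2 * (inner_L2 M P P + inner_L2 M Q Q))"
    by (rule admissible_data)
  have "F \<in> L2 (Omega l T)" using F by (simp add: admissible_loads_def)
  then obtain F' where F': "F' \<in> sqi M" "AE z in M. F z = F' z" by (rule representative)
  have Fh': "(\<lambda>z. F' z + h' z) \<in> sqi M" "AE z in M. F z + h z = F' z + h' z"
    using F' h by (auto intro!: sqi_add elim: eventually_elim2)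
  obtain f ut P Q \<psi> \<omega> where 1: "B.solves F' f ut" "\<And>z. P z = (N0 f z - \<theta> (snd z)) / l" "\<And>z. Q z = (Nl f z - \<theta>' (snd z)) / l"
    "B.adjoint_solves (\<lambda>_. green0 l) (\<lambda>_. greenl l) P Q \<psi> \<omega>" "AE z in M. \<phi> F z = k \<psi> z" "\<phi> F \<in> L2 (Omega l T)"
    "tikhonov l T \<theta>\<^sub>0 \<theta>\<^sub>l u F = l / 2 * (inner_L2 M P P + inner_L2 M Q Q)"
    using D[rule_format, OF F F'] by blast
  obtain f' ut' P' Q' \<psi>' \<omega>' where 2: "B.solves (\<lambda>z. F' z + h' z) f' ut'" "\<And>z. P' z = (N0 f' z - \<theta> (snd z)) / l" "\<And>z. Q' z = (Nl f' z - \<theta>' (snd z)) / l"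
    "B.adjoint_solves (\<lambda>_. green0 l) (\<lambda>_. greenl l) P' Q' \<psi>' \<omega>'" "AE z in M. \<phi> (\<lambda>z. F z + h z) z = k \<psi>' z" "\<phi> (\<lambda>z. F z + h z) \<in> L2 (Omega l T)"
    "tikhonov l T \<theta>\<^sub>0 \<theta>\<^sub>l u (\<lambda>z. F z + h z) = l / 2 * (inner_L2 M P' P' + inner_L2 M Q' Q')"
    using D[rule_format, OF Fh Fh'] by blast
  have fs: "f \<in> sqi M" "f' \<in> sqi M" using 1(1) 2(1) by (auto simp: B.solves_def)
  have S: "B.solves h' (\<lambda>z. f' z + -1 * f z) (\<lambda>z. ut' z + -1 * ut z)"
    using B.solves_lincomb[OF 2(1) 1(1), of "-1"] by simp
  have P: "AE z in M. P' z = P z + 1 / l * N0 (\<lambda>z. f' z + -1 * f z) z"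
    using B.opx_lincomb_AE[OF kernN(1) fs(2,1), of "-1"]
    by eventually_elim (simp add: 1(2) 2(2) diff_divide_distrib)
  have Q: "AE z in M. Q' z = Q z + 1 / l * Nl (\<lambda>z. f' z + -1 * f z) z"
    using B.opx_lincomb_AE[OF kernN(2) fs(2,1), of "-1"]
    by eventually_elim (simp add: 1(3) 2(3) diff_divide_distrib)
  show ?thesis by (rule that[OF S 1(4-6) 2(4-6) P Q 1(7) 2(7)])
qed

lemma inner_increment:
  assumes "AE z in M. P' z = P z + c * A z" "P \<in> sqi M" "P' \<in> sqi M" "A \<in> sqi M"
  shows "inner_L2 M P' P' = inner_L2 M P P + 2 * c * inner_L2 M P A + c\<^sup>2 * inner_L2 M A A"
proof -
  have "inner_L2 M P' P' = inner_L2 M P P' + c * inner_L2 M A P'"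
    by (rule B.inner_lincomb_AE[OF assms(1,2,4,3,3)])
  moreover have "inner_L2 M P' w = inner_L2 M P w + c * inner_L2 M A w" if "w \<in> sqi M" for w
    by (rule B.inner_lincomb_AE[OF assms(1,2,4,3) that])
  ultimately show ?thesis using assms
    by (simp add: inner_L2_commute[of M P P'] inner_L2_commute[of M A P'] inner_L2_commute[of M A P] power2_eq_square algebra_simps)
qed

text \<open>The functional is quadratic: by duality its linear part is the pairing with the adjoint
  solution, so the remainder is exactly the squared trace term, which is bounded by a multiple of
  the squared norm of \<open>h\<close>.\<close>

lemma gradient:
  assumes F: "F \<in> admissible_loads l T CF"
  shows "has_L2_gradient (tikhonov l T \<theta>\<^sub>0 \<theta>\<^sub>l u) (\<phi> F) F (Omega l T) (admissible_loads l T CF)"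
proof -
  have rem: "\<bar>tikhonov l T \<theta>\<^sub>0 \<theta>\<^sub>l u (\<lambda>z. F z + h z) - tikhonov l T \<theta>\<^sub>0 \<theta>\<^sub>l u F - (\<integral>z. \<phi> F z * h z \<partial>lebesgue_on (Omega l T))\<bar>
      \<le> l * \<Gamma> * (norm_L2 (Omega l T) h)\<^sup>2"
    if h: "h \<in> L2 (Omega l T)" and Fh: "(\<lambda>z. F z + h z) \<in> admissible_loads l T CF" for h
  proof -
    obtain h' where h': "h' \<in> sqi M" "AE z in M. h z = h' z" by (rule representative[OF h])
    obtain f ut P Q P' Q' \<psi> \<psi>' \<omega> \<omega>' where S: "B.solves h' f ut"
      and A: "B.adjoint_solves (\<lambda>_. green0 l) (\<lambda>_. greenl l) P Q \<psi> \<omega>" "AE z in M. \<phi> F z = k \<psi> z" "\<phi> F \<in> L2 (Omega l T)"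
      and A': "B.adjoint_solves (\<lambda>_. green0 l) (\<lambda>_. greenl l) P' Q' \<psi>' \<omega>'" "AE z in M. \<phi> (\<lambda>z. F z + h z) z = k \<psi>' z"
        "\<phi> (\<lambda>z. F z + h z) \<in> L2 (Omega l T)"
      and P: "AE z in M. P' z = P z + 1 / l * N0 f z" "AE z in M. Q' z = Q z + 1 / l * Nl f z"
      and J: "tikhonov l T \<theta>\<^sub>0 \<theta>\<^sub>l u F = l / 2 * (inner_L2 M P P + inner_L2 M Q Q)"
        "tikhonov l T \<theta>\<^sub>0 \<theta>\<^sub>l u (\<lambda>z. F z + h z) = l / 2 * (inner_L2 M P' P' + inner_L2 M Q' Q')"
      by (rule load_increment[OF F Fh h'])
    have sq: "f \<in> sqi M" "P \<in> sqi M" "Q \<in> sqi M" "P' \<in> sqi M" "Q' \<in> sqi M" "\<psi> \<in> sqi M"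
      using S A(1) A'(1) by (auto simp: B.solves_def B.adjoint_solves_def)
    note N = opx_sqi[OF kernN(1) sq(1)] opx_sqi[OF kernN(2) sq(1)]
    have "(\<integral>z. \<phi> F z * h z \<partial>lebesgue_on (Omega l T)) = inner_L2 M h' (k \<psi>)"
      using inner_Omega[OF A(3) h B.K_sqi[OF sq(6)] h'(1) A(2) h'(2)] by (simp add: inner_L2_def mult.commute)
    also have "\<dots> = inner_L2 M P (N0 f) + inner_L2 M Q (Nl f)"
      by (rule BD.duality[OF S A(1) kernN])
    finally have d: "(\<integral>z. \<phi> F z * h z \<partial>lebesgue_on (Omega l T)) = inner_L2 M P (N0 f) + inner_L2 M Q (Nl f)" .
    \<comment> \<open>The factor is the 1/2 of the functional times the \<open>1 / l\<close> of the
      lifted inner products.\<close>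
    have e: "tikhonov l T \<theta>\<^sub>0 \<theta>\<^sub>l u (\<lambda>z. F z + h z) - tikhonov l T \<theta>\<^sub>0 \<theta>\<^sub>l u F - (\<integral>z. \<phi> F z * h z \<partial>lebesgue_on (Omega l T))
      = 1 / (2 * l) * (inner_L2 M (N0 f) (N0 f) + inner_L2 M (Nl f) (Nl f))"
      unfolding J d inner_increment[OF P(1) sq(2,4) N(1)] inner_increment[OF P(2) sq(3,5) N(2)]
      using l_pos by (simp add: field_simps power2_eq_square)
    have "1 / (2 * l) * (inner_L2 M (N0 f) (N0 f) + inner_L2 M (Nl f) (Nl f))
      \<le> 1 / (2 * l) * (l\<^sup>2 * inner_L2 M f f + l\<^sup>2 * inner_L2 M f f)"
      using l_pos trace_norm_le[OF sq(1)] by (intro mult_left_mono add_mono) auto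
    also have "\<dots> = l * inner_L2 M f f" using l_pos by (simp add: field_simps power2_eq_square)
    also have "\<dots> \<le> l * (\<Gamma> * inner_L2 M h' h')" using l_pos solution_norm_le[OF S] by simp
    finally have "1 / (2 * l) * (inner_L2 M (N0 f) (N0 f) + inner_L2 M (Nl f) (Nl f)) \<le> l * (\<Gamma> * inner_L2 M h' h')" .
    moreover have "0 \<le> 1 / (2 * l) * (inner_L2 M (N0 f) (N0 f) + inner_L2 M (Nl f) (Nl f))"
      using l_pos by (simp add: inner_L2_nonneg)
    moreover have "(norm_L2 (Omega l T) h)\<^sup>2 = inner_L2 M h' h'"
      using norm_Omega[OF h h'] by (simp add: inner_L2_nonneg)
    ultimately show ?thesis unfolding e by simp
  qed
  show ?thesis
    unfolding has_L2_gradient_def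
  proof (intro conjI allI impI)
    show "\<phi> F \<in> L2 (Omega l T)"
      using adjoint[OF F] unfolding adjoint_weak_solution_def weak_solution_space_def L2_V2_def by blast
    fix \<epsilon> :: real assume "\<epsilon> > 0"
    \<comment> \<open>Adding 1 makes the denominator of the radius positive, \<Gamma> being known
      only to be nonnegative.\<close>
    have g: "l * \<Gamma> + 1 > 0" using l_pos \<Gamma>_nonneg by (simp add: add_nonneg_pos)
    show "\<exists>\<delta>>0. \<forall>h\<in>L2 (Omega l T). (\<lambda>z. F z + h z) \<in> admissible_loads l T CF \<longrightarrow> norm_L2 (Omega l T) h < \<delta> \<longrightarrow>
        \<bar>tikhonov l T \<theta>\<^sub>0 \<theta>\<^sub>l u (\<lambda>z. F z + h z) - tikhonov l T \<theta>\<^sub>0 \<theta>\<^sub>l u F - (\<integral>z. \<phi> F z * h z \<partial>lebesgue_on (Omega l T))\<bar>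
        \<le> \<epsilon> * norm_L2 (Omega l T) h"
    proof (intro exI[of _ "\<epsilon> / (l * \<Gamma> + 1)"] conjI ballI impI)
      show "0 < \<epsilon> / (l * \<Gamma> + 1)" using g \<open>\<epsilon> > 0\<close> by simp
      fix h assume h: "h \<in> L2 (Omega l T)" "(\<lambda>z. F z + h z) \<in> admissible_loads l T CF" "norm_L2 (Omega l T) h < \<epsilon> / (l * \<Gamma> + 1)"
      have n: "0 \<le> norm_L2 (Omega l T) h" by (simp add: norm_L2_eq inner_L2_nonneg)
      have "norm_L2 (Omega l T) h * (l * \<Gamma> + 1) \<le> \<epsilon>" using h(3) g by (simp add: pos_less_divide_eq)
      then have "norm_L2 (Omega l T) h * (l * \<Gamma>) \<le> \<epsilon>" using n by (simp add: distrib_left)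
      from mult_right_mono[OF this n]
      have "l * \<Gamma> * (norm_L2 (Omega l T) h)\<^sup>2 \<le> \<epsilon> * norm_L2 (Omega l T) h"
        by (simp add: power2_eq_square mult_ac)
      with rem[OF h(1,2)] show "\<bar>tikhonov l T \<theta>\<^sub>0 \<theta>\<^sub>l u (\<lambda>z. F z + h z) - tikhonov l T \<theta>\<^sub>0 \<theta>\<^sub>l u F - (\<integral>z. \<phi> F z * h z \<partial>lebesgue_on (Omega l T))\<bar>
        \<le> \<epsilon> * norm_L2 (Omega l T) h" by linarith
    qed
  qed
qed

text \<open>With \<open>B\<close> the map from loads to traces, the increment of the gradient is \<open>B\<^sup>*B \<delta>F\<close>, so its norm
  squared is the inner product of \<open>B (B\<^sup>*B \<delta>F)\<close> and \<open>B \<delta>F\<close>.\<close>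

lemma gradient_lipschitz:
  assumes F: "F \<in> admissible_loads l T CF" and Fh: "(\<lambda>z. F z + h z) \<in> admissible_loads l T CF"
  shows "norm_L2 (Omega l T) (\<lambda>z. \<phi> (\<lambda>z. F z + h z) z - \<phi> F z) \<le> 2 * l * \<Gamma> * norm_L2 (Omega l T) h"
proof -
  have FL: "F \<in> L2 (Omega l T)" "(\<lambda>z. F z + h z) \<in> L2 (Omega l T)"
    using F Fh by (auto simp: admissible_loads_def)
  have h: "h \<in> L2 (Omega l T)"
    using sqi_diff[OF FL(2)[unfolded L2_eq_sqi] FL(1)[unfolded L2_eq_sqi]] by (simp add: L2_eq_sqi)
  obtain h' where h': "h' \<in> sqi M" "AE z in M. h z = h' z" by (rule representative[OF h])
  obtain f ut P Q P' Q' \<psi> \<psi>' \<omega> \<omega>' where S: "B.solves h' f ut"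
    and A: "B.adjoint_solves (\<lambda>_. green0 l) (\<lambda>_. greenl l) P Q \<psi> \<omega>" "AE z in M. \<phi> F z = k \<psi> z" "\<phi> F \<in> L2 (Omega l T)"
    and A': "B.adjoint_solves (\<lambda>_. green0 l) (\<lambda>_. greenl l) P' Q' \<psi>' \<omega>'" "AE z in M. \<phi> (\<lambda>z. F z + h z) z = k \<psi>' z"
      "\<phi> (\<lambda>z. F z + h z) \<in> L2 (Omega l T)"
    and P: "AE z in M. P' z = P z + 1 / l * N0 f z" "AE z in M. Q' z = Q z + 1 / l * Nl f z"
    and J: "tikhonov l T \<theta>\<^sub>0 \<theta>\<^sub>l u F = l / 2 * (inner_L2 M P P + inner_L2 M Q Q)"
      "tikhonov l T \<theta>\<^sub>0 \<theta>\<^sub>l u (\<lambda>z. F z + h z) = l / 2 * (inner_L2 M P' P' + inner_L2 M Q' Q')"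
    by (rule load_increment[OF F Fh h'])
  have sq: "f \<in> sqi M" "P \<in> sqi M" "Q \<in> sqi M" "P' \<in> sqi M" "Q' \<in> sqi M" "\<psi> \<in> sqi M" "\<psi>' \<in> sqi M"
    using S A(1) A'(1) by (auto simp: B.solves_def B.adjoint_solves_def)
  define \<Phi> where "\<Phi> = (\<lambda>z. k \<psi>' z - k \<psi> z)"
  have \<Phi>: "\<Phi> \<in> sqi M" unfolding \<Phi>_def by (intro sqi_diff B.K_sqi sq)
  \<comment> \<open>The increment of the gradient is itself used as a load; duality with both
    adjoint solutions then computes its squared norm.\<close>
  obtain g gt where G: "B.solves \<Phi> g gt" using solution_exists[OF \<Phi>] by blast
  have g: "g \<in> sqi M" using G by (simp add: B.solves_def)
  note N = opx_sqi[OF kernN(1) sq(1)] opx_sqi[OF kernN(2) sq(1)] opx_sqi[OF kernN(1) g] opx_sqi[OF kernN(2) g]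
  define n m where "n = sqrt (inner_L2 M \<Phi> \<Phi>)" and "m = sqrt (inner_L2 M h' h')"
  have nm: "0 \<le> n" "0 \<le> m" by (auto simp: n_def m_def inner_L2_nonneg)
  have fg: "sqrt (inner_L2 M f f) * sqrt (inner_L2 M g g) \<le> \<Gamma> * (m * n)"
  proof -
    have "sqrt (inner_L2 M f f) * sqrt (inner_L2 M g g) \<le> (sqrt \<Gamma> * m) * (sqrt \<Gamma> * n)"
      unfolding n_def m_def using solution_norm_le'[OF S] solution_norm_le'[OF G] \<Gamma>_nonneg
      by (intro mult_mono) (auto simp: inner_L2_nonneg)
    also have "\<dots> = (sqrt \<Gamma> * sqrt \<Gamma>) * (m * n)" by (simp only: mult_ac)
    finally show ?thesis using \<Gamma>_nonneg by simp
  qed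
  have tr: "inner_L2 M V W \<le> l\<^sup>2 * (\<Gamma> * (m * n))"
    if "V \<in> sqi M" "W \<in> sqi M" "sqrt (inner_L2 M V V) \<le> l * sqrt (inner_L2 M f f)" "sqrt (inner_L2 M W W) \<le> l * sqrt (inner_L2 M g g)" for V W
  proof -
    have "inner_L2 M V W \<le> sqrt (inner_L2 M V V) * sqrt (inner_L2 M W W)"
      using Cauchy_Schwarz_L2[OF that(1,2)] by linarith
    also have "\<dots> \<le> (l * sqrt (inner_L2 M f f)) * (l * sqrt (inner_L2 M g g))"
      using that(3,4) l_pos by (intro mult_mono) (auto simp: inner_L2_nonneg)
    also have "\<dots> = l\<^sup>2 * (sqrt (inner_L2 M f f) * sqrt (inner_L2 M g g))" by (simp add: power2_eq_square)
    also have "\<dots> \<le> l\<^sup>2 * (\<Gamma> * (m * n))" using fg by (intro mult_left_mono) auto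
    finally show ?thesis .
  qed
  have inc: "inner_L2 M P' w = inner_L2 M P w + 1 / l * inner_L2 M (N0 f) w"
    "inner_L2 M Q' w = inner_L2 M Q w + 1 / l * inner_L2 M (Nl f) w" if "w \<in> sqi M" for w
    by (rule B.inner_lincomb_AE[OF P(1) sq(2) N(1) sq(4) that], rule B.inner_lincomb_AE[OF P(2) sq(3) N(2) sq(5) that])
  have "n * n = inner_L2 M \<Phi> \<Phi>" by (simp add: n_def inner_L2_nonneg)
  also have "\<dots> = inner_L2 M \<Phi> (k \<psi>') - inner_L2 M \<Phi> (k \<psi>)"
    using inner_L2_diff(2)[OF B.K_sqi[OF sq(7)] B.K_sqi[OF sq(6)] \<Phi>] unfolding \<Phi>_def[symmetric] .
  also have "\<dots> = 1 / l * (inner_L2 M (N0 f) (N0 g) + inner_L2 M (Nl f) (Nl g))"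
    unfolding BD.duality[OF G A(1) kernN] BD.duality[OF G A'(1) kernN] inc(1)[OF N(3)] inc(2)[OF N(4)]
    by (simp add: algebra_simps)
  \<comment> \<open>Two traces, each contributing \<open>l\<close> squared, against the
    \<open>1 / l\<close> of the lift: this is the constant \<open>2 * l * \<Gamma>\<close>.\<close>
  also have "\<dots> \<le> 1 / l * (l\<^sup>2 * (\<Gamma> * (m * n)) + l\<^sup>2 * (\<Gamma> * (m * n)))"
    using l_pos by (intro mult_left_mono add_mono tr N trace_norm_le' sq g) auto
  also have "\<dots> = (2 * l * \<Gamma> * m) * n" using l_pos by (simp add: power2_eq_square field_simps)
  finally have "n \<le> 2 * l * \<Gamma> * m"
    using nm l_pos \<Gamma>_nonneg by (cases "n = 0") auto
  moreover have "norm_L2 (Omega l T) (\<lambda>z. \<phi> (\<lambda>z. F z + h z) z - \<phi> F z) = n"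
    unfolding n_def
  proof (rule norm_Omega[OF _ \<Phi>])
    show "(\<lambda>z. \<phi> (\<lambda>z. F z + h z) z - \<phi> F z) \<in> L2 (Omega l T)"
      using A(3) A'(3) unfolding L2_eq_sqi by (intro sqi_diff)
    show "AE z in M. \<phi> (\<lambda>z. F z + h z) z - \<phi> F z = \<Phi> z"
      using A(2) A'(2) unfolding \<Phi>_def by eventually_elim simp
  qed
  moreover have "norm_L2 (Omega l T) h = m"
    unfolding m_def by (rule norm_Omega[OF h h'])
  ultimately show ?thesis by simp
qed

end

text \<open>After squaring and removing common factors, a cubic in \<open>T\<close> has to be
  bounded by exponentials. Two Taylor bounds suffice: first order for \<open>exp T\<close>, second
  order for \<open>exp (T / \<rho>0)\<close>.\<close>

lemma lipschitz_constant_le: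
  fixes l T \<rho>0 r0 \<kappa>0 CT C0 C1 :: real
  assumes pos: "l > 0" "T > 0" "\<rho>0 > 0" "r0 > 0" "\<kappa>0 > 0" and CT: "CT \<ge> 1"
    and C: "C0 > 0" "C0\<^sup>2 = 20 * l * CT / (3 * r0\<^sup>2)" "C1 > 0" "C1\<^sup>2 = 5 * l * \<rho>0 / 3 * (exp (T / \<rho>0) - 1)"
  shows "2 * l * (sqrt (4 * T\<^sup>2 / \<rho>0 * (T * (l / 4 * l)\<^sup>2 / (2 * \<kappa>0))) / r0) \<le> sqrt ((exp T - 1) / (2 * \<kappa>0)) * l\<^sup>2 * C0 * C1"
proof (rule power2_le_imp_le)
  have e1: "T \<le> exp T - 1" using exp_ge_add_one_self[of T] by linarith
  have e2: "(T / \<rho>0)\<^sup>2 / 2 \<le> exp (T / \<rho>0) - 1"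
  proof -
    have "0 \<le> T / \<rho>0" using pos by simp
    with exp_lower_Taylor_quadratic[OF this] show ?thesis by linarith
  qed
  \<comment> \<open>50/9 is the product of the 1/2, 20/3 and 5/3 in the squared constant; it is pure
    surplus.\<close>
  have "T ^ 3 / (2 * \<rho>0) \<le> (50 / 9) * (T * 1 * (\<rho>0 * ((T / \<rho>0)\<^sup>2 / 2)))"
    using pos by (simp add: field_simps power2_eq_square power3_eq_cube)
  also have "\<dots> \<le> (50 / 9) * ((exp T - 1) * CT * (\<rho>0 * (exp (T / \<rho>0) - 1)))"
    using e1 e2 CT pos by (intro mult_left_mono mult_mono) auto
  finally have key: "T ^ 3 / (2 * \<rho>0) \<le> (50 / 9) * ((exp T - 1) * CT * (\<rho>0 * (exp (T / \<rho>0) - 1)))" .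
  have "(2 * l * (sqrt (4 * T\<^sup>2 / \<rho>0 * (T * (l / 4 * l)\<^sup>2 / (2 * \<kappa>0))) / r0))\<^sup>2
    = l ^ 6 / (\<kappa>0 * r0\<^sup>2) * (T ^ 3 / (2 * \<rho>0))"
    using pos by (simp add: power_mult_distrib power_divide field_simps power2_eq_square power3_eq_cube eval_nat_numeral)
  also have "\<dots> \<le> l ^ 6 / (\<kappa>0 * r0\<^sup>2) * ((50 / 9) * ((exp T - 1) * CT * (\<rho>0 * (exp (T / \<rho>0) - 1))))"
    using key pos by (intro mult_left_mono) auto
  also have "\<dots> = (exp T - 1) / (2 * \<kappa>0) * l ^ 4 * (20 * l * CT / (3 * r0\<^sup>2)) * (5 * l * \<rho>0 / 3 * (exp (T / \<rho>0) - 1))"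
    using pos by (simp add: field_simps eval_nat_numeral)
  also have "\<dots> = (sqrt ((exp T - 1) / (2 * \<kappa>0)) * l\<^sup>2 * C0 * C1)\<^sup>2"
    using pos by (simp add: power_mult_distrib C flip: power_mult)
  finally show "(2 * l * (sqrt (4 * T\<^sup>2 / \<rho>0 * (T * (l / 4 * l)\<^sup>2 / (2 * \<kappa>0))) / r0))\<^sup>2
    \<le> (sqrt ((exp T - 1) / (2 * \<kappa>0)) * l\<^sup>2 * C0 * C1)\<^sup>2" .
  show "0 \<le> sqrt ((exp T - 1) / (2 * \<kappa>0)) * l\<^sup>2 * C0 * C1"
    using pos C by (intro mult_nonneg_nonneg real_sqrt_ge_zero divide_nonneg_pos) auto
qed

theorem theorem5:
  fixes l T CF \<rho>\<^sub>0 \<rho>\<^sub>1 Tr\<^sub>0 Tr\<^sub>1 r\<^sub>0 r\<^sub>1 \<mu>\<^sub>0 \<mu>\<^sub>1 \<kappa>\<^sub>0 \<kappa>\<^sub>1 C\<^sub>0 C\<^sub>1 C\<^sub>T L\<^sub>G :: real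
    and \<rho>A \<mu> Tr r \<kappa> \<theta>\<^sub>0 \<theta>\<^sub>l :: "real \<Rightarrow> real"
    and u \<phi> :: "(real \<times> real \<Rightarrow> real) \<Rightarrow> (real \<times> real \<Rightarrow> real)"
  assumes "l > 0" and "T > 0" and "CF > 0"
    and "0 < \<rho>\<^sub>0" and "coefficient l \<rho>\<^sub>0 \<rho>\<^sub>1 \<rho>A"
    and "0 \<le> Tr\<^sub>0" and "coefficient l Tr\<^sub>0 Tr\<^sub>1 Tr"
    and "0 < r\<^sub>0" and "coefficient l r\<^sub>0 r\<^sub>1 r"
    and "0 \<le> \<mu>\<^sub>0" and "coefficient l \<mu>\<^sub>0 \<mu>\<^sub>1 \<mu>"
    and "0 < \<kappa>\<^sub>0" and "coefficient l \<kappa>\<^sub>0 \<kappa>\<^sub>1 \<kappa>"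
    and "\<theta>\<^sub>0 \<in> H1 0 T" and "\<theta>\<^sub>l \<in> H1 0 T"
    and "\<And>F. F \<in> admissible_loads l T CF \<Longrightarrow> forward_weak_solution l T \<rho>A \<mu> Tr r \<kappa> F (u F)"
    and "\<And>F. F \<in> admissible_loads l T CF \<Longrightarrow>
           adjoint_weak_solution l T \<rho>A \<mu> Tr r \<kappa>
             (\<lambda>t. dx_at l (u F) 0 t - \<theta>\<^sub>0 t) (\<lambda>t. dx_at l (u F) l t - \<theta>\<^sub>l t) (\<phi> F)"
    and "C\<^sub>T = max (2 / T) (1 + 2 * T / 3)"
    and "C\<^sub>0 > 0" and "C\<^sub>0\<^sup>2 = 20 * l * C\<^sub>T / (3 * r\<^sub>0\<^sup>2)"
    and "C\<^sub>1 > 0" and "C\<^sub>1\<^sup>2 = 5 * l * \<rho>\<^sub>0 / 3 * (exp (T / \<rho>\<^sub>0) - 1)"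
    and "L\<^sub>G = sqrt ((exp T - 1) / (2 * \<kappa>\<^sub>0)) * l\<^sup>2 * C\<^sub>0 * C\<^sub>1"
  shows "(\<forall>F \<in> admissible_loads l T CF.
            has_L2_gradient (tikhonov l T \<theta>\<^sub>0 \<theta>\<^sub>l u) (\<phi> F) F (Omega l T) (admissible_loads l T CF)) \<and>
         (\<forall>F \<delta>F. F \<in> admissible_loads l T CF \<longrightarrow> (\<lambda>z. F z + \<delta>F z) \<in> admissible_loads l T CF \<longrightarrow>
            norm_L2 (Omega l T) (\<lambda>z. \<phi> (\<lambda>z. F z + \<delta>F z) z - \<phi> F z)
              \<le> L\<^sub>G * norm_L2 (Omega l T) \<delta>F)"
proof -
  note a = assms
  interpret S: strip l T by unfold_locales (use a in auto)
  \<comment> \<open>The coefficients are replaced by representatives that satisfy their bounds at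
    every point, as \<open>beam\<close> requires.\<close>
  obtain \<rho> where \<rho>: "\<rho> \<in> borel_measurable (ival 0 l)" "\<forall>x. \<rho>\<^sub>0 \<le> \<rho> x" "\<forall>x. \<rho> x \<le> \<rho>\<^sub>1" "AE x in ival 0 l. \<rho>A x = \<rho> x"
    by (rule S.coefficient_representative[OF a(5)])
  obtain \<mu>' where \<mu>': "\<mu>' \<in> borel_measurable (ival 0 l)" "\<forall>x. \<mu>\<^sub>0 \<le> \<mu>' x" "\<forall>x. \<mu>' x \<le> \<mu>\<^sub>1" "AE x in ival 0 l. \<mu> x = \<mu>' x"
    by (rule S.coefficient_representative[OF a(11)])
  obtain Tr' where Tr': "Tr' \<in> borel_measurable (ival 0 l)" "\<forall>x. Tr\<^sub>0 \<le> Tr' x" "\<forall>x. Tr' x \<le> Tr\<^sub>1" "AE x in ival 0 l. Tr x = Tr' x"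
    by (rule S.coefficient_representative[OF a(7)])
  obtain r' where r': "r' \<in> borel_measurable (ival 0 l)" "\<forall>x. r\<^sub>0 \<le> r' x" "\<forall>x. r' x \<le> r\<^sub>1" "AE x in ival 0 l. r x = r' x"
    by (rule S.coefficient_representative[OF a(9)])
  obtain \<kappa>' where \<kappa>': "\<kappa>' \<in> borel_measurable (ival 0 l)" "\<forall>x. \<kappa>\<^sub>0 \<le> \<kappa>' x" "\<forall>x. \<kappa>' x \<le> \<kappa>\<^sub>1" "AE x in ival 0 l. \<kappa> x = \<kappa>' x"
    by (rule S.coefficient_representative[OF a(13)])
  have nonneg: "0 \<le> \<mu>' x" "0 \<le> Tr' x" for x
    using \<mu>'(2) Tr'(2) a(6,10) order_trans by blast+
  interpret P: load_identification l T \<rho> \<mu>' Tr' r' \<kappa>' \<rho>\<^sub>0 \<rho>\<^sub>1 \<mu>\<^sub>1 Tr\<^sub>1 r\<^sub>0 r\<^sub>1 \<kappa>\<^sub>0 \<kappa>\<^sub>1 \<rho>A \<mu> Tr r \<kappa> CF \<theta>\<^sub>0 \<theta>\<^sub>l u \<phi>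
  proof unfold_locales
    show "kernel (ival 0 l) (green l) (l / 4)" "kernel (ival 0 l) (green' l) 1"
      using kernel_green a by auto
    show "l / 4 * l = l / 4 * measure (ival 0 l) (space (ival 0 l))"
      using measure_ival[of 0 l] a by simp
    show "\<theta>\<^sub>0 \<in> L2 {0<..<T}" "\<theta>\<^sub>l \<in> L2 {0<..<T}"
      using a(14,15) by (auto simp: H1_def weak_deriv_def)
    fix F assume F: "F \<in> admissible_loads l T CF"
    show "forward_weak_solution l T \<rho>A \<mu> Tr r \<kappa> F (u F)" by (rule a(16)[OF F])
    show "adjoint_weak_solution l T \<rho>A \<mu> Tr r \<kappa> (\<lambda>t. dx_at l (u F) 0 t - \<theta>\<^sub>0 t) (\<lambda>t. dx_at l (u F) l t - \<theta>\<^sub>l t) (\<phi> F)"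
      by (rule a(17)[OF F])
  qed (use a(3,4,8,12) \<rho> \<mu>' Tr' r' \<kappa>' nonneg in simp_all)
  \<comment> \<open>The second entry of the maximum is already at least 1.\<close>
  have CT: "C\<^sub>T \<ge> 1" using a(2) a(18) by (simp add: le_max_iff_disj)
  have "2 * l * P.\<Gamma> \<le> L\<^sub>G"
    unfolding P.\<Gamma>_def a(23) by (rule lipschitz_constant_le[OF a(1,2,4,8,12) CT a(19-22)])
  moreover have "0 \<le> norm_L2 (Omega l T) h" for h by (simp add: norm_L2_eq inner_L2_nonneg)
  ultimately have "2 * l * P.\<Gamma> * norm_L2 (Omega l T) h \<le> L\<^sub>G * norm_L2 (Omega l T) h" for h
    by (rule mult_right_mono)
  then show ?thesis using P.gradient P.gradient_lipschitz order_trans by blast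
qed

end
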